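(* The hyperelliptic curve $$v^2=z^5-10z^3+9z=z(z-1)(z+1)(z-3)(z+3)$$ is described by the Fuchsian equation $$[z,\tau]=-\frac12\,\frac{(z^2+3)^4}{(z^5-10z^3+9z)^2}$$ and has the following parametrization: $$z=3\,\frac{\vartheta_3^2(3\tau)}{\vartheta_3^2(\tau)},\qquad v=48\sqrt3\,i\;\frac{\vartheta_3^3(3\tau)}{\vartheta_3^3(\tau)}\,\frac{\vartheta_2^2(\tau)\,\vartheta_4^2(\tau)}{9\,\vartheta_3^4(3\tau)-\vartheta_3^4(\tau)}.$$
   Context: $\tau$ lies in the upper half-plane; $\vartheta_2=\sum_ke^{\pi i(k+1/2)^2\tau}$, $\vartheta_3=\sum_ke^{\pi ik^2\tau}$, $\vartheta_4=\sum_k(-1)^ke^{\pi ik^2\tau}$ ($k\in\mathbb Z$). The meromorphic derivative is $[z,\tau]=\frac{\dddot z}{\dot z^3}-\frac32\frac{\ddot z^2}{\dot z^4}$ (dots are $\tau$-derivatives). That the curve is described by the Fuchsian equation means that the uniformizing function $z(\tau)$ in the parametrization satisfies it. *)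

theory Defs
  imports "HOL-Complex_Analysis.Complex_Analysis"
begin

abbreviation upper_half_plane :: "complex set" where
  "upper_half_plane \<equiv> {\<tau>. 0 < Im \<tau>}"

text \<open>
  The theta constants as functions of \<open>\<tau>\<close> rather than of the nome. The bilateral series converge
  absolutely for \<open>0 < Im \<tau>\<close>, so \<open>infsum\<close> is their ordinary sum there.
\<close>

definition theta2 :: "complex \<Rightarrow> complex" where
  "theta2 \<tau> = (\<Sum>\<^sub>\<infinity>k::int. exp (of_real pi * \<i> * (of_int k + 1 / 2) ^ 2 * \<tau>))"

definition theta3 :: "complex \<Rightarrow> complex" where
  "theta3 \<tau> = (\<Sum>\<^sub>\<infinity>k::int. exp (of_real pi * \<i> * of_int k ^ 2 * \<tau>))"

definition theta4 :: "complex \<Rightarrow> complex" where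
  "theta4 \<tau> = (\<Sum>\<^sub>\<infinity>k::int. (-1) powi k * exp (of_real pi * \<i> * of_int k ^ 2 * \<tau>))"

text \<open>
  The meromorphic derivative \<open>[z, \<tau>]\<close>: the Schwarzian derivative divided by the square of the
  first derivative. It is meaningful only where the first derivative does not vanish.
\<close>

definition mero_deriv :: "(complex \<Rightarrow> complex) \<Rightarrow> complex \<Rightarrow> complex" where
  "mero_deriv z \<tau> =
     (deriv ^^ 3) z \<tau> / deriv z \<tau> ^ 3 - 3 / 2 * ((deriv ^^ 2) z \<tau> ^ 2 / deriv z \<tau> ^ 4)"

text \<open>
  The affine curve. Its finite branch points, the points with \<open>y = 0\<close>, are punctures of the
  uniformization (cusps of the uniformizing group), so no \<open>\<tau>\<close> in the upper half-plane maps to them.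
\<close>

definition hyperelliptic_curve :: "(complex \<times> complex) set" where
  "hyperelliptic_curve = {(x, y). y ^ 2 = x ^ 5 - 10 * x ^ 3 + 9 * x}"

end

theory Submission
  imports Defs "HOL-Probability.Characteristic_Functions"
begin

text \<open>
  Write \<open>a, b, c\<close> for \<open>\<theta>\<^sub>3, \<theta>\<^sub>4, \<theta>\<^sub>2\<close> at \<open>\<tau>\<close> and \<open>A, B, C\<close> for the same functions at \<open>3\<tau>\<close>, so
  that \<open>z = 3A\<^sup>2/a\<^sup>2\<close>. Put \<open>x = exp(\<pi>i\<tau>)\<close>. Everything is governed by the group \<open>G\<close> generated by the
  translation \<open>\<tau> \<mapsto> \<tau> + 1\<close> and the Fricke involution \<open>\<tau> \<mapsto> -1/(3\<tau>)\<close>. Both generators permute the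
  six theta constants up to elementary factors, and they act on \<open>z\<close> by the Moebius maps
  \<open>z \<mapsto> (z + 3)/(z - 1)\<close> and \<open>z \<mapsto> 3/z\<close>, which generate a dihedral group of order 12 permuting the
  branch points \<open>0, \<plusminus>1, \<plusminus>3, \<infinity>\<close> of the curve.

  The reason for working with \<open>G\<close> is that it has a single cusp, at \<open>i\<infinity>\<close>, where \<open>x\<close> is a local
  coordinate. A function of weight \<open>k\<close> for \<open>G\<close> that vanishes to order \<open>m\<close> in \<open>x\<close> with \<open>3m > k\<close> is
  therefore zero: its cube divided by the \<open>k\<close>-th power of \<open>aAbBcC\<close>, a form of weight 3 without
  zeros, has invariant modulus and tends to 0 at the cusp, so that it attains its maximum inside the
  half-plane. This is \<open>fricke_weight_vanishing\<close>. It reduces each of the following identities to a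
  comparison of the constant terms, or of the first two terms, at the cusp:

  \<^item> the identities \<open>aA = bB + cC\<close>, \<open>a\<^sup>4 = b\<^sup>4 + c\<^sup>4\<close> and two more quadratic ones determine \<open>b\<^sup>4, c\<^sup>4, B\<^sup>4\<close>
    as functions of \<open>a\<^sup>2\<close> and \<open>A\<^sup>2\<close>, which gives the equation of the curve and shows that \<open>z\<close> avoids
    the branch points;

  \<^item> the formula \<open>z' = -\<pi>i z bBcC\<close> shows that \<open>z'\<close> has no zeros;

  \<^item> the Schwarzian derivative of \<open>z\<close> has weight 4, since \<open>z\<close> is permuted by Moebius maps, and is
    compared with \<open>\<pi>\<^sup>2/2\<close> times the fourth power of a form of weight 1. Division by \<open>z'\<^sup>2\<close> gives the
    Fuchsian equation.

  For surjectivity, the square of \<open>(z\<^sup>2 + 3)\<^sup>3/(z(z\<^sup>2 - 1)(z\<^sup>2 - 9))\<close> is invariant under \<open>G\<close> and has its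
  only pole at the cusp, so its image in the complex plane is open and closed. Since the fibres of
  the squared rational function are orbits of the dihedral group, \<open>z\<close> takes every value except the branch
  points. The translation by 2 fixes \<open>z\<close> and changes the sign of \<open>v\<close>, so both points of the curve
  above each value occur.

  Two analytic facts on theta constants are the input. Poisson summation for Gaussians gives the
  behaviour under \<open>\<tau> \<mapsto> -1/\<tau>\<close>. The duplication formula \<open>\<theta>\<^sub>3(\<tau>) \<theta>\<^sub>4(\<tau>) = \<theta>\<^sub>4(2\<tau>)\<^sup>2\<close> excludes zeros,
  because a zero would propagate to \<open>2\<^sup>n\<tau>\<close> for all \<open>n\<close>, where \<open>\<theta>\<^sub>4\<close> tends to 1.
\<close>

section \<open>Theta constants as power series in the nome\<close>

text \<open>
  Ramanujan's function \<open>\<phi>(x) = \<Sum> x\<^bsup>k\<^sup>2\<^esup>\<close> over all integers \<open>k\<close>, folded into a series over the natural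
  numbers.
\<close>

definition phi :: "complex \<Rightarrow> complex" where
  "phi x = 2 * (\<Sum>n. x ^ (n\<^sup>2)) - 1"

text \<open>
  In terms of Ramanujan's \<open>\<psi>(q) = \<Sum> q\<^bsup>n(n+1)/2\<^esup>\<close> this is \<open>\<psi>(x\<^sup>2)\<close>.
\<close>

definition psi :: "complex \<Rightarrow> complex" where
  "psi x = (\<Sum>n. x ^ (n * (n + 1)))"

abbreviation nome :: "complex \<Rightarrow> complex" where
  "nome \<tau> \<equiv> exp (of_real pi * \<i> * \<tau>)"

lemma
  fixes x :: complex
  assumes e: "strict_mono e" and x: "norm x < 1"
  shows lacunary_norm_summable: "summable (\<lambda>n. norm (x ^ e n))"
    and lacunary_summable: "summable (\<lambda>n. x ^ e n)"
proof -
  show *: "summable (\<lambda>n. norm (x ^ e n))"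
  proof (rule summable_comparison_test_ev)
    show "summable (\<lambda>n. norm x ^ n)"
      using x by (simp add: summable_geometric)
    show "\<forall>\<^sub>F n in sequentially. norm (norm (x ^ e n)) \<le> norm x ^ n"
      using x strict_mono_imp_increasing[OF e]
      by (auto intro!: always_eventually power_decreasing simp: norm_power)
  qed
  show "summable (\<lambda>n. x ^ e n)"
    using * by (rule summable_norm_cancel)
qed

text \<open>
  Padding with zero coefficients turns the lacunary series into an ordinary power series.
\<close>

lemma lacunary_holomorphic:
  assumes e: "strict_mono e"
  shows "(\<lambda>x::complex. \<Sum>n. x ^ e n) holomorphic_on ball 0 1"
proof (rule power_series_holomorphic)
  fix w :: complex
  assume "w \<in> ball 0 1"
  then have "(\<lambda>n. w ^ e n) sums (\<Sum>n. w ^ e n)"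
    using lacunary_summable[OF e, of w] by (simp add: summable_sums)
  then have "(\<lambda>n. (if e n \<in> range e then 1 else 0) * w ^ e n) sums (\<Sum>n. w ^ e n)"
    by simp
  then have "(\<lambda>n. (if n \<in> range e then 1 else 0) * w ^ n) sums (\<Sum>n. w ^ e n)"
    by (subst (asm) sums_mono_reindex[OF e, of "\<lambda>n. (if n \<in> range e then 1 else 0) * w ^ n"]) auto
  then show "(\<lambda>n. (if n \<in> range e then 1 else 0) * (w - 0) ^ n) sums (\<Sum>n. w ^ e n)"
    by simp
qed

lemma strict_mono_square: "strict_mono (\<lambda>n::nat. n\<^sup>2)"
  by (auto simp: strict_mono_def power_strict_mono)

lemma strict_mono_pronic: "strict_mono (\<lambda>n::nat. n * (n + 1))"
  unfolding strict_mono_Suc_iff by (simp add: algebra_simps)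

lemma phi_holomorphic: "phi holomorphic_on ball 0 1"
  using lacunary_holomorphic[OF strict_mono_square] unfolding phi_def
  by (intro holomorphic_intros)

lemma psi_holomorphic: "psi holomorphic_on ball 0 1"
  using lacunary_holomorphic[OF strict_mono_pronic] unfolding psi_def .

lemma phi_0 [simp]: "phi 0 = 1"
proof -
  have "(\<Sum>n. (0::complex) ^ (n\<^sup>2)) = (\<Sum>n\<in>{0}. 0 ^ (n\<^sup>2))"
    by (rule suminf_finite) auto
  then show ?thesis by (simp add: phi_def)
qed

lemma psi_0 [simp]: "psi 0 = 1"
proof -
  have "(\<Sum>n. (0::complex) ^ (n * (n + 1))) = (\<Sum>n\<in>{0}. 0 ^ (n * (n + 1)))"
    by (rule suminf_finite) auto
  then show ?thesis by (simp add: psi_def)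
qed

lemma phi_deriv_0: "(phi has_field_derivative 2) (at 0)"
proof -
  \<comment> \<open>\<open>(n + 2)\<^sup>2 = 2 + e n\<close>: splitting off the terms \<open>1 + x\<close> of \<open>\<Sum> x\<^bsup>n\<^sup>2\<^esup>\<close> leaves a multiple of \<open>x\<^sup>2\<close>\<close>
  define e where "e n = n\<^sup>2 + 4 * n + 2" for n :: nat
  have e: "strict_mono e"
    unfolding strict_mono_Suc_iff e_def by (simp add: power2_eq_square)
  define h where "h x = (\<Sum>n. x ^ e n)" for x :: complex
  have h: "h holomorphic_on ball 0 1"
    using lacunary_holomorphic[OF e] unfolding h_def .
  have eq: "phi x = 1 + 2 * x + 2 * x\<^sup>2 * h x" if "x \<in> ball 0 1" for x
  proof -
    have x: "norm x < 1" using that by simp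
    have "(\<Sum>n. x ^ (n\<^sup>2)) = (\<Sum>n. x ^ ((n + 2)\<^sup>2)) + (\<Sum>n<2. x ^ (n\<^sup>2))"
      by (rule suminf_split_initial_segment) (rule lacunary_summable[OF strict_mono_square x])
    also have "(\<lambda>n. x ^ ((n + 2)\<^sup>2)) = (\<lambda>n. x\<^sup>2 * x ^ e n)"
    proof
      fix n
      have "(n + 2)\<^sup>2 = 2 + e n" by (simp add: e_def power2_eq_square)
      then show "x ^ ((n + 2)\<^sup>2) = x\<^sup>2 * x ^ e n" by (simp only: power_add)
    qed
    also have "(\<Sum>n. x\<^sup>2 * x ^ e n) = x\<^sup>2 * h x"
      unfolding h_def by (rule suminf_mult) (rule lacunary_summable[OF e x])
    finally show ?thesis
      by (simp add: phi_def numeral_2_eq_2)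
  qed
  have "(h has_field_derivative deriv h 0) (at 0)"
    using h by (intro holomorphic_derivI[OF h]) auto
  then have "((\<lambda>x. 1 + 2 * x + 2 * x\<^sup>2 * h x) has_field_derivative 2) (at 0)"
    by (auto intro!: derivative_eq_intros)
  then show ?thesis
    by (rule has_field_derivative_transform_within_open[of _ _ _ "ball 0 1"]) (auto simp: eq)
qed

text \<open>
  The integers are split into \<open>n\<close> and \<open>-n - 1\<close> for natural \<open>n\<close>.
\<close>

lemma has_sum_int:
  fixes f :: "int \<Rightarrow> complex"
  assumes "((\<lambda>n. f (int n)) has_sum a) UNIV" "((\<lambda>n. f (- int n - 1)) has_sum b) UNIV"
  shows "(f has_sum (a + b)) UNIV"
proof -
  have UNIV: "range int \<union> range (\<lambda>n. - int n - 1) = UNIV"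
  proof (intro set_eqI iffI UNIV_I)
    fix k :: int
    show "k \<in> range int \<union> range (\<lambda>n. - int n - 1)"
    proof (cases "k \<ge> 0")
      case True
      then have "k = int (nat k)" by simp
      then show ?thesis by blast
    next
      case False
      then have "k = - int (nat (- k - 1)) - 1" by simp
      then show ?thesis by blast
    qed
  qed
  have "(f has_sum a) (range int)" "(f has_sum b) (range (\<lambda>n. - int n - 1))"
    using assms by (subst has_sum_reindex; simp add: o_def inj_on_def)+
  then have "(f has_sum (a + b)) (range int \<union> range (\<lambda>n. - int n - 1))"
    by (rule has_sum_Un_disjoint) auto
  then show ?thesis by (simp only: UNIV)
qed

lemma phi_has_sum:
  assumes x: "norm x < 1"
  shows "((\<lambda>k::int. x ^ nat (k\<^sup>2)) has_sum phi x) UNIV"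
proof -
  let ?S = "\<Sum>n. x ^ (n\<^sup>2)"
  have nat1: "nat ((int n)\<^sup>2) = n\<^sup>2" for n
    by (metis nat_int of_nat_power)
  have nat2: "nat ((- int n - 1)\<^sup>2) = (Suc n)\<^sup>2" for n
  proof -
    have "(- int n - 1)\<^sup>2 = int ((Suc n)\<^sup>2)" by (simp add: power2_eq_square algebra_simps)
    then show ?thesis by (metis nat_int)
  qed
  have sums: "(\<lambda>n. x ^ (n\<^sup>2)) sums ?S" and ns: "summable (\<lambda>n. norm (x ^ (n\<^sup>2)))"
    using lacunary_summable[OF strict_mono_square x] lacunary_norm_summable[OF strict_mono_square x]
    by (auto simp: summable_sums)
  have "((\<lambda>n. x ^ (n\<^sup>2)) has_sum ?S) UNIV"
    using ns sums by (rule norm_summable_imp_has_sum)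
  moreover have "((\<lambda>n. x ^ ((Suc n)\<^sup>2)) has_sum (?S - 1)) UNIV"
  proof (rule norm_summable_imp_has_sum)
    show "summable (\<lambda>n. norm (x ^ (Suc n)\<^sup>2))"
      using ns by (subst summable_Suc_iff[of "\<lambda>n. norm (x ^ (n\<^sup>2))"])
    show "(\<lambda>n. x ^ (Suc n)\<^sup>2) sums (?S - 1)"
      using sums by (subst sums_Suc_iff) simp
  qed
  ultimately have "((\<lambda>k::int. x ^ nat (k\<^sup>2)) has_sum (?S + (?S - 1))) UNIV"
    by (intro has_sum_int) (simp_all only: nat1 nat2)
  then show ?thesis by (simp add: phi_def)
qed

lemma norm_nome: "norm (nome \<tau>) = exp (- pi * Im \<tau>)"
  by simp

lemma norm_nome_less_1: "0 < Im \<tau> \<Longrightarrow> norm (nome \<tau>) < 1"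
  by simp

lemma nome_in_ball: "0 < Im \<tau> \<Longrightarrow> nome \<tau> \<in> ball 0 1"
  by simp

lemma nome_power: "nome \<tau> ^ n = nome (of_nat n * \<tau>)"
  by (simp add: exp_of_nat_mult[symmetric] mult_ac)

lemma
  assumes \<tau>: "0 < Im \<tau>"
  shows theta3_has_sum: "((\<lambda>k::int. exp (of_real pi * \<i> * of_int k ^ 2 * \<tau>)) has_sum phi (nome \<tau>)) UNIV"
    and theta4_has_sum: "((\<lambda>k::int. (-1) powi k * exp (of_real pi * \<i> * of_int k ^ 2 * \<tau>))
           has_sum phi (- nome \<tau>)) UNIV"
proof -
  have eq: "exp (of_real pi * \<i> * of_int k ^ 2 * \<tau>) = nome \<tau> ^ nat (k\<^sup>2)" for k
    unfolding nome_power by (simp add: mult_ac of_nat_nat)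
  show "((\<lambda>k::int. exp (of_real pi * \<i> * of_int k ^ 2 * \<tau>)) has_sum phi (nome \<tau>)) UNIV"
    using phi_has_sum[OF norm_nome_less_1[OF \<tau>]] unfolding eq .
  have sgn: "(-1) powi k = (-1 :: complex) ^ nat (k\<^sup>2)" for k
    by (auto simp: power_int_minus_one_minus uminus_power_if power_int_def even_nat_iff)
  have "((\<lambda>k::int. (- nome \<tau>) ^ nat (k\<^sup>2)) has_sum phi (- nome \<tau>)) UNIV"
    by (rule phi_has_sum) (use norm_nome_less_1[OF \<tau>] in simp)
  moreover have "(- nome \<tau>) ^ nat (k\<^sup>2) = (-1) powi k * exp (of_real pi * \<i> * of_int k ^ 2 * \<tau>)" for k
    unfolding eq sgn by (rule power_minus)
  ultimately show "((\<lambda>k::int. (-1) powi k * exp (of_real pi * \<i> * of_int k ^ 2 * \<tau>))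
           has_sum phi (- nome \<tau>)) UNIV"
    by simp
qed

text \<open>
  The indices \<open>k\<close> and \<open>-k - 1\<close> give equal terms, and \<open>(n + 1/2)\<^sup>2 = n(n + 1) + 1/4\<close>.
\<close>

lemma theta2_has_sum:
  assumes \<tau>: "0 < Im \<tau>"
  shows "((\<lambda>k::int. exp (of_real pi * \<i> * (of_int k + 1 / 2) ^ 2 * \<tau>))
           has_sum (nome (\<tau> / 4) * (2 * psi (nome \<tau>)))) UNIV"
proof -
  let ?e = "\<lambda>n::nat. n * (n + 1)" and ?x = "nome \<tau>"
  have x: "norm ?x < 1" using \<tau> by simp
  have "((\<lambda>n. ?x ^ ?e n) has_sum psi ?x) UNIV"
    unfolding psi_def
    using lacunary_summable[OF strict_mono_pronic x] lacunary_norm_summable[OF strict_mono_pronic x]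
    by (intro norm_summable_imp_has_sum) (auto simp: summable_sums)
  then have *: "((\<lambda>n. nome (\<tau> / 4) * ?x ^ ?e n) has_sum (nome (\<tau> / 4) * psi ?x)) UNIV"
    by (rule has_sum_cmult_right)
  have eq: "nome (\<tau> / 4) * ?x ^ ?e n = exp (of_real pi * \<i> * (of_nat n + 1 / 2) ^ 2 * \<tau>)" for n
    unfolding nome_power exp_add[symmetric] by (simp add: field_simps power2_eq_square)
  have eq': "(of_int (- int n - 1) + 1 / 2) ^ 2 = (of_nat n + 1 / 2 :: complex) ^ 2" for n
    by (simp add: power2_eq_square algebra_simps)
  have "((\<lambda>k::int. exp (of_real pi * \<i> * (of_int k + 1 / 2) ^ 2 * \<tau>))
           has_sum (nome (\<tau> / 4) * psi ?x + nome (\<tau> / 4) * psi ?x)) UNIV"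
    by (rule has_sum_int) (use *[unfolded eq] in \<open>simp_all only: of_int_of_nat_eq eq'\<close>)
  then show ?thesis by (simp add: algebra_simps)
qed

lemma theta2_nome: "0 < Im \<tau> \<Longrightarrow> theta2 \<tau> = nome (\<tau> / 4) * (2 * psi (nome \<tau>))"
  unfolding theta2_def by (rule infsumI) (rule theta2_has_sum)

lemma theta3_nome: "0 < Im \<tau> \<Longrightarrow> theta3 \<tau> = phi (nome \<tau>)"
  unfolding theta3_def by (rule infsumI) (rule theta3_has_sum)

lemma theta4_nome: "0 < Im \<tau> \<Longrightarrow> theta4 \<tau> = phi (- nome \<tau>)"
  unfolding theta4_def by (rule infsumI) (rule theta4_has_sum)

text \<open>
  In the double series \<open>\<Sum> (-1)\<^sup>n x\<^bsup>m\<^sup>2 + n\<^sup>2\<^esup>\<close> the terms with \<open>m + n\<close> odd cancel under exchange of \<open>m\<close> and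
  \<open>n\<close>. The others are reindexed by \<open>m = j + k\<close>, \<open>n = j - k\<close>, where \<open>m\<^sup>2 + n\<^sup>2 = 2j\<^sup>2 + 2k\<^sup>2\<close>.
\<close>

lemma phi_mult_phi_minus:
  assumes x: "norm x < 1"
  shows "phi x * phi (- x) = phi (- x\<^sup>2) ^ 2"
proof -
  define t where "t x = (\<lambda>k::int. x ^ nat (k\<^sup>2))" for x :: complex
  have has: "(t y has_sum phi y) UNIV" if "norm y < 1" for y
    using phi_has_sum[OF that] unfolding t_def .
  have abs: "(\<lambda>k. norm (t y k)) summable_on UNIV" if "norm y < 1" for y
    using has_sum_imp_summable[OF has[OF that]]
    by (simp add: summable_on_iff_abs_summable_on_complex)
  have prod: "((\<lambda>(m, n). t y m * t w n) has_sum (phi y * phi w)) UNIV"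
    if y: "norm y < 1" and w: "norm w < 1" for y w
  proof -
    have 1: "((\<lambda>n. (\<lambda>(m, n). t y m * t w n) (m, n)) has_sum (t y m * phi w)) UNIV" for m
      using has_sum_cmult_right[OF has[OF w]] by simp
    have 2: "((\<lambda>m. t y m * phi w) has_sum (phi y * phi w)) UNIV"
      using has_sum_cmult_left[OF has[OF y]] by simp
    have "(\<lambda>(m, n). t y m * t w n) summable_on (UNIV \<times> UNIV)"
    proof (rule Infinite_Sum.abs_summable_summable, subst Infinite_Sum.abs_summable_on_Sigma_iff, intro conjI ballI)
      show "(\<lambda>n. norm (case (m, n) of (m, n) \<Rightarrow> t y m * t w n)) summable_on UNIV" for m
        using summable_on_cmult_right[OF abs[OF w], of "norm (t y m)"] by (simp add: norm_mult)
      have "(\<lambda>m. norm (t y m) * infsum (\<lambda>n. norm (t w n)) UNIV) summable_on UNIV"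
        by (rule summable_on_cmult_left[OF abs[OF y]])
      then show "(\<lambda>m. norm (\<Sum>\<^sub>\<infinity>n. norm (case (m, n) of (m, n) \<Rightarrow> t y m * t w n))) summable_on UNIV"
        by (simp add: norm_mult infsum_cmult_right' infsum_nonneg)
    qed
    from has_sum_SigmaI[OF 1 2 this] show ?thesis by simp
  qed
  let ?f = "\<lambda>(m, n). t x m * t (- x) n"
  define E where "E = {(m::int, n::int). even (m + n)}"
  have f: "(?f has_sum (phi x * phi (- x))) UNIV"
    by (rule prod) (use x in auto)
  then have summ: "?f summable_on A" for A
    using has_sum_imp_summable summable_on_subset_banach subset_UNIV by metis
  have tm: "t (- x) n = (if even n then t x n else - t x n)" for n
    by (simp add: t_def power_minus_odd even_nat_iff)
  have "infsum ?f (- E) = infsum (\<lambda>p. - ?f p) (- E)"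
    by (rule infsum_reindex_bij_witness[of _ prod.swap prod.swap])
      (auto simp: E_def tm mult.commute split: if_splits)
  then have odd: "infsum ?f (- E) = 0"
    by (simp add: infsum_uminus)
  have tt: "t x m * t x n = x ^ nat (m\<^sup>2 + n\<^sup>2)" for m n
    by (simp add: t_def nat_add_distrib power_add)
  have tt': "t (- x\<^sup>2) j * t (- x\<^sup>2) k = t x (j + k) * t (- x) (j - k)" for j k
  proof -
    have "t (- x\<^sup>2) j * t (- x\<^sup>2) k = (- x\<^sup>2) ^ nat (j\<^sup>2 + k\<^sup>2)"
      by (simp add: t_def nat_add_distrib power_add)
    also have "\<dots> = (if even (j - k) then 1 else -1) * (x\<^sup>2) ^ nat (j\<^sup>2 + k\<^sup>2)"
      by (simp add: even_nat_iff power_minus_odd)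
    also have "(x\<^sup>2) ^ nat (j\<^sup>2 + k\<^sup>2) = x ^ nat ((j + k)\<^sup>2 + (j - k)\<^sup>2)"
      unfolding power_mult[symmetric]
      by (rule arg_cong[of _ _ "power x"]) (simp add: power2_eq_square algebra_simps nat_mult_distrib[symmetric] flip: nat_add_distrib)
    finally show ?thesis by (simp add: tm tt[symmetric])
  qed
  have half: "(m + n) div 2 + (m - n) div 2 = m" "(m + n) div 2 - (m - n) div 2 = n"
    if "even (m + n)" for m n :: int
    using that by presburger+
  have "infsum ?f E = infsum (\<lambda>(j, k). t (- x\<^sup>2) j * t (- x\<^sup>2) k) UNIV"
    by (rule infsum_reindex_bij_witness[of _ "\<lambda>(j, k). (j + k, j - k)" "\<lambda>(m, n). ((m + n) div 2, (m - n) div 2)"])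
      (use half in \<open>auto simp: E_def tt' simp del: even_add\<close>)
  also have "\<dots> = phi (- x\<^sup>2) * phi (- x\<^sup>2)"
    by (rule infsumI, rule prod) (use x in \<open>auto simp: norm_power power_less_one_iff\<close>)
  finally have even: "infsum ?f E = phi (- x\<^sup>2) * phi (- x\<^sup>2)" .
  have "phi x * phi (- x) = infsum ?f (E \<union> - E)"
    using f by (simp add: infsumI)
  also have "\<dots> = infsum ?f E + infsum ?f (- E)"
    by (rule infsum_Un_disjoint) (auto intro: summ)
  finally show ?thesis by (simp add: odd even power2_eq_square)
qed

text \<open>
  By the product formula a zero at \<open>x\<close> forces zeros at \<open>-x\<^sup>2, -x\<^sup>4, -x\<^sup>8, \<dots>\<close>, which tend to 0, while
  \<open>\<phi>(0) = 1\<close>.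
\<close>

lemma phi_nonzero:
  assumes x: "norm x < 1"
  shows "phi x \<noteq> 0"
proof
  assume "phi x = 0"
  define y where "y n = - (x ^ (2 ^ Suc n))" for n :: nat
  have ny: "norm (y n) < 1" for n
    using x by (simp add: y_def norm_power power_less_one_iff)
  have zero: "phi (y n) = 0" for n
  proof (induction n)
    case 0
    have "phi (- x\<^sup>2) ^ 2 = 0"
      using phi_mult_phi_minus[OF x] \<open>phi x = 0\<close> by simp
    then show ?case by (simp add: y_def)
  next
    case (Suc n)
    have "y (Suc n) = - (y n)\<^sup>2"
      by (simp add: y_def power2_eq_square power_add[symmetric] mult_2)
    then have "phi (y (Suc n)) ^ 2 = 0"
      using phi_mult_phi_minus[OF ny[of n]] Suc by simp
    then show ?case by simp
  qed
  have "(\<lambda>n. x ^ n) \<longlonglongrightarrow> 0"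
    using x by (rule LIMSEQ_power_zero)
  moreover have "strict_mono (\<lambda>n. 2 ^ Suc n :: nat)"
    by (rule strict_monoI_Suc) simp
  ultimately have "((\<lambda>n. x ^ n) \<circ> (\<lambda>n. 2 ^ Suc n)) \<longlonglongrightarrow> 0"
    by (rule LIMSEQ_subseq_LIMSEQ)
  then have "y \<longlonglongrightarrow> 0"
    using tendsto_minus[of "(^) x \<circ> (\<lambda>n. 2 ^ Suc n)" 0 sequentially] by (simp add: o_def y_def[abs_def])
  moreover have "isCont phi 0"
    using phi_deriv_0 by (rule DERIV_isCont)
  ultimately have "(\<lambda>n. phi (y n)) \<longlonglongrightarrow> phi 0"
    by (metis isCont_tendsto_compose)
  then show False using zero by (simp add: LIMSEQ_const_iff)
qed

section \<open>Poisson summation for Gaussians\<close>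

lemma has_sum_symmetric_partial_sums:
  fixes f :: "int \<Rightarrow> complex"
  assumes "(f has_sum S) UNIV"
  shows "(\<lambda>N. \<Sum>k\<in>{- int N..int N}. f k) \<longlonglongrightarrow> S"
proof -
  have "filterlim (\<lambda>N. {- int N..int N}) (finite_subsets_at_top UNIV) sequentially"
    unfolding filterlim_finite_subsets_at_top
  proof safe
    fix X :: "int set"
    assume X: "finite X"
    show "\<forall>\<^sub>F N in sequentially. finite {- int N..int N} \<and> X \<subseteq> {- int N..int N} \<and> {- int N..int N} \<subseteq> UNIV"
      using eventually_ge_at_top[of "nat (Max (insert 0 (abs ` X)))"]
    proof eventually_elim
      case (elim N)
      have "\<bar>k\<bar> \<le> int N" if "k \<in> X" for k
      proof -
        have "\<bar>k\<bar> \<le> Max (insert 0 (abs ` X))" using X that by (intro Max_ge) auto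
        then show ?thesis using elim by linarith
      qed
      then show ?case by (auto simp: abs_le_iff minus_le_iff)
    qed
  qed
  then show ?thesis
    using assms unfolding has_sum_def by (rule filterlim_compose[rotated])
qed

lemma sum_int_symmetric_Suc:
  fixes f :: "int \<Rightarrow> complex"
  shows "(\<Sum>k\<in>{- int (Suc N)..int (Suc N)}. f k)
       = (\<Sum>k\<in>{- int N..int N}. f k) + f (int N + 1) + f (- int N - 1)"
proof -
  have "{- int (Suc N)..int (Suc N)} = insert (int N + 1) (insert (- int N - 1) {- int N..int N})"
    by auto
  then show ?thesis by (simp add: algebra_simps)
qed

text \<open>
  Convergence of the Fourier series at an interior point, after Chernoff. The function
  \<open>f(w) - f(0)\<close> is divisible by \<open>exp(2\<pi>iw) - 1\<close>, which has a simple zero at 0 and no other zero in the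
  unit disc. The coefficients of \<open>f\<close> are then differences of consecutive coefficients of the
  quotient \<open>G\<close>, so their sum telescopes, and the coefficients of \<open>G\<close> are \<open>O(1/n)\<close> by integration by
  parts.
\<close>

lemma fourier_partial_sums_tendsto:
  assumes f: "f holomorphic_on ball 0 1"
  shows "(\<lambda>N. \<Sum>n\<in>{- int N..int N}. integral {-(1/2)..1/2}
            (\<lambda>x::real. f (of_real x) * exp (- (2 * of_real pi * \<i> * of_int n * of_real x)))) \<longlonglongrightarrow> f 0"
proof -
  define e where "e n w = exp (- (2 * of_real pi * \<i> * of_int n * w))" for n :: int and w :: complex
  define p where "p w = (if w = 0 then deriv (\<lambda>w. exp (2 * of_real pi * \<i> * w)) 0
      else (exp (2 * of_real pi * \<i> * w) - exp (2 * of_real pi * \<i> * 0)) / (w - 0))" for w :: complex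
  define q where "q w = (if w = 0 then deriv f 0 else (f w - f 0) / (w - 0))" for w
  define G where "G w = q w / p w" for w
  have d0: "deriv (\<lambda>w. exp (2 * of_real pi * \<i> * w)) 0 = 2 * of_real pi * \<i>"
    by (rule DERIV_imp_deriv) (auto intro!: derivative_eq_intros)
  have p: "p holomorphic_on ball 0 1" unfolding p_def
    by (rule pole_lemma_open) (auto intro!: holomorphic_intros)
  have q: "q holomorphic_on ball 0 1" unfolding q_def
    by (rule pole_lemma_open) (use f in auto)
  have p0: "p w \<noteq> 0" if "w \<in> ball 0 1" for w
  proof (cases "w = 0")
    case True
    then show ?thesis by (simp add: p_def d0)
  next
    case False
    have "exp (2 * of_real pi * \<i> * w) \<noteq> 1"
    proof
      assume "exp (2 * of_real pi * \<i> * w) = 1"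
      then obtain n :: int where n: "Im (2 * of_real pi * \<i> * w) = of_int (2 * n) * pi"
          "Re (2 * of_real pi * \<i> * w) = 0"
        unfolding exp_eq_1 by auto
      then have "w = of_int n" by (simp add: complex_eq_iff)
      with that False show False by auto
    qed
    then show ?thesis using False by (simp add: p_def)
  qed
  have G: "G holomorphic_on ball 0 1"
    unfolding G_def using p q p0 by (intro holomorphic_intros) auto
  have fG: "f w = f 0 + G w * (exp (2 * of_real pi * \<i> * w) - 1)" if "w \<in> ball 0 1" for w
    using p0[OF that] by (auto simp: G_def p_def q_def field_simps)
  let ?I = "{-(1/2)..1/2::real}"
  have ball: "of_real x \<in> ball (0::complex) 1" if "x \<in> ?I" for x
    using that by (auto simp: abs_if)
  define c where "c n = integral ?I (\<lambda>x. G (of_real x) * e n (of_real x))" for n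
  have cont_e: "continuous_on ?I (\<lambda>x. e n (of_real x))" for n
    unfolding e_def by (intro continuous_intros)
  have cont_of: "continuous_on ?I (\<lambda>x. H (of_real x))" if "H holomorphic_on ball 0 1" for H :: "complex \<Rightarrow> complex"
    by (rule continuous_on_compose2[OF holomorphic_on_imp_continuous_on[OF that]])
       (use ball in \<open>auto intro!: continuous_intros\<close>)
  have e_deriv: "(e n has_field_derivative (- (2 * of_real pi * \<i> * of_int n) * e n w)) (at w)" for n w
    unfolding e_def by (auto intro!: derivative_eq_intros)
  have e_int: "integral ?I (\<lambda>x. e n (of_real x)) = (if n = 0 then 1 else 0)" for n
  proof (cases "n = 0")
    case True
    then show ?thesis by (simp add: e_def)
  next
    case False
    have "((\<lambda>x. e n (of_real x)) has_integral
        (e n (of_real (1/2)) / - (2 * of_real pi * \<i> * of_int n) -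
         e n (of_real (-(1/2))) / - (2 * of_real pi * \<i> * of_int n))) ?I"
    proof (rule fundamental_theorem_of_calculus)
      fix x assume "x \<in> ?I"
      have "((\<lambda>w. e n w / - (2 * of_real pi * \<i> * of_int n)) has_field_derivative
          e n (of_real x)) (at (of_real x))"
        using False by (auto intro!: derivative_eq_intros e_deriv)
      then show "((\<lambda>x. e n (of_real x) / - (2 * of_real pi * \<i> * of_int n)) has_vector_derivative
          e n (of_real x)) (at x within ?I)"
        by (rule has_vector_derivative_real_field)
    qed simp
    moreover have "e n (of_real (1/2)) = e n (of_real (-(1/2)))"
    proof -
      have "e n (of_real (-(1/2))) = e n (of_real (1/2)) * exp (2 * of_int n * of_real pi * \<i>)"
        unfolding e_def exp_add[symmetric] by (rule arg_cong[of _ _ exp]) (simp add: field_simps)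
      then show ?thesis using exp_integer_2pi[of "of_int n"] by simp
    qed
    ultimately show ?thesis using False by (simp add: integral_unique)
  qed
  have f_int: "integral ?I (\<lambda>x. f (of_real x) * e n (of_real x))
      = f 0 * (if n = 0 then 1 else 0) + (c (n - 1) - c n)" for n
  proof -
    have "integral ?I (\<lambda>x. f (of_real x) * e n (of_real x)) =
        integral ?I (\<lambda>x. f 0 * e n (of_real x) +
          (G (of_real x) * e (n - 1) (of_real x) - G (of_real x) * e n (of_real x)))"
    proof (rule integral_cong)
      fix x assume x: "x \<in> ?I"
      have e_pred: "e (n - 1) (of_real x) = e n (of_real x) * exp (2 * of_real pi * \<i> * of_real x)"
        unfolding e_def exp_add[symmetric] by (rule arg_cong[of _ _ exp]) (simp add: algebra_simps)
      show "f (of_real x) * e n (of_real x) = f 0 * e n (of_real x) +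
          (G (of_real x) * e (n - 1) (of_real x) - G (of_real x) * e n (of_real x))"
        unfolding fG[OF ball[OF x]] e_pred by (simp add: algebra_simps)
    qed
    also have "\<dots> = f 0 * integral ?I (\<lambda>x. e n (of_real x)) + (c (n - 1) - c n)"
      unfolding c_def using cont_e cont_of[OF G]
      by (intro integral_unique has_integral_add has_integral_diff has_integral_mult_right
          integrable_integral integrable_continuous_interval continuous_intros)
    finally show ?thesis unfolding e_int .
  qed
  have sum_eq: "(\<Sum>n\<in>{- int N..int N}. integral ?I (\<lambda>x. f (of_real x) * e n (of_real x)))
      = f 0 + c (- int N - 1) - c (int N)" for N
  proof (induction N)
    case 0
    then show ?case by (simp add: f_int)
  next
    case (Suc N)
    show ?case unfolding sum_int_symmetric_Suc Suc unfolding f_int by (simp add: algebra_simps)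
  qed
  obtain K where K: "norm (c n) \<le> K / \<bar>of_int n\<bar>" if "n \<noteq> 0" for n
  proof -
    have "bounded ((\<lambda>x. G (of_real x)) ` ?I)" "bounded ((\<lambda>x. deriv G (of_real x)) ` ?I)"
      using cont_of[OF G] cont_of[OF holomorphic_deriv[OF G open_ball]]
      by (auto intro!: compact_imp_bounded compact_continuous_image)
    then obtain M M' where M: "norm (G (of_real x)) \<le> M" and M': "norm (deriv G (of_real x)) \<le> M'"
      if "x \<in> ?I" for x
      unfolding bounded_iff by blast
    have ne: "norm (e n (of_real x)) = 1" for n x
      by (simp add: e_def)
    have "norm (c n) \<le> ((2 * M + M') / (2 * pi)) / \<bar>of_int n\<bar>" if n: "n \<noteq> 0" for n
    proof -
      let ?a = "2 * of_real pi * \<i> * of_int n :: complex"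
      have "((\<lambda>x. deriv G (of_real x) * e n (of_real x) - ?a * (G (of_real x) * e n (of_real x))) has_integral
        (G (of_real (1/2)) * e n (of_real (1/2)) - G (of_real (-(1/2))) * e n (of_real (-(1/2))))) ?I"
      proof (rule fundamental_theorem_of_calculus)
        fix x assume x: "x \<in> ?I"
        have "((\<lambda>w. G w * e n w) has_field_derivative
            deriv G (of_real x) * e n (of_real x) - ?a * (G (of_real x) * e n (of_real x))) (at (of_real x))"
          using holomorphic_derivI[OF G open_ball ball[OF x]]
          by (auto intro!: derivative_eq_intros e_deriv simp: algebra_simps)
        then show "((\<lambda>x. G (of_real x) * e n (of_real x)) has_vector_derivative
            deriv G (of_real x) * e n (of_real x) - ?a * (G (of_real x) * e n (of_real x))) (at x within ?I)"
          by (rule has_vector_derivative_real_field)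
      qed simp
      then have "integral ?I (\<lambda>x. deriv G (of_real x) * e n (of_real x) - ?a * (G (of_real x) * e n (of_real x)))
          = G (of_real (1/2)) * e n (of_real (1/2)) - G (of_real (-(1/2))) * e n (of_real (-(1/2)))"
        by (rule integral_unique)
      also have "integral ?I (\<lambda>x. deriv G (of_real x) * e n (of_real x) - ?a * (G (of_real x) * e n (of_real x)))
          = integral ?I (\<lambda>x. deriv G (of_real x) * e n (of_real x)) - ?a * c n"
        unfolding c_def
        using cont_e cont_of[OF G] cont_of[OF holomorphic_deriv[OF G open_ball]]
        by (intro integral_unique has_integral_diff has_integral_mult_right
          integrable_integral integrable_continuous_interval continuous_intros)
      finally have ac: "?a * c n = integral ?I (\<lambda>x. deriv G (of_real x) * e n (of_real x)) -
          (G (of_real (1/2)) * e n (of_real (1/2)) - G (of_real (-(1/2))) * e n (of_real (-(1/2))))"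
        by (simp add: algebra_simps)
      define X where "X = integral ?I (\<lambda>x. deriv G (of_real x) * e n (of_real x))"
      define Y Z where "Y = G (of_real (1/2)) * e n (of_real (1/2))"
        and "Z = G (of_real (-(1/2))) * e n (of_real (-(1/2)))"
      have "norm X \<le> M' * (1/2 - (-(1/2)))"
        unfolding X_def using cont_e cont_of[OF holomorphic_deriv[OF G open_ball]] M'
        by (intro integral_bound continuous_intros) (auto simp: norm_mult ne)
      moreover have "norm Y \<le> M" "norm Z \<le> M"
        unfolding Y_def Z_def norm_mult ne using M[of "1/2"] M[of "-(1/2)"] by simp_all
      moreover have "norm (X - (Y - Z)) \<le> norm X + (norm Y + norm Z)"
        by (rule order_trans[OF norm_triangle_ineq4 add_left_mono[OF norm_triangle_ineq4]])
      ultimately have "norm (?a * c n) \<le> M' + (M + M)"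
        unfolding ac X_def[symmetric] Y_def[symmetric] Z_def[symmetric] by simp
      then show ?thesis using n by (simp add: norm_mult field_simps)
    qed
    then show ?thesis using that by blast
  qed
  have lim: "(\<lambda>N. K / real N) \<longlonglongrightarrow> 0" by (rule lim_const_over_n)
  have "(\<lambda>N. c (int N)) \<longlonglongrightarrow> 0"
  proof (rule Lim_null_comparison[OF _ lim])
    show "\<forall>\<^sub>F N in sequentially. norm (c (int N)) \<le> K / real N"
      using eventually_gt_at_top[of 0] by eventually_elim (use K[of "int N" for N] in simp)
  qed
  moreover have "(\<lambda>N. c (- int N - 1)) \<longlonglongrightarrow> 0"
  proof (rule Lim_null_comparison[OF _ LIMSEQ_Suc[OF lim]])
    have "norm (c (- int N - 1)) \<le> K / real (Suc N)" for N
    proof -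
      have "\<bar>of_int (- int N - 1)\<bar> = real (Suc N)" by simp
      then show ?thesis using K[of "- int N - 1"] by simp
    qed
    then show "\<forall>\<^sub>F N in sequentially. norm (c (- int N - 1)) \<le> K / real (Suc N)"
      by simp
  qed
  ultimately have "(\<lambda>N. f 0 + c (- int N - 1) - c (int N)) \<longlonglongrightarrow> f 0 + 0 - 0"
    by (intro tendsto_intros)
  then show ?thesis unfolding sum_eq[symmetric] e_def by (simp only: add_0_right diff_zero)
qed

text \<open>
  The substitution \<open>y = c(x + u)\<close> with \<open>c\<^sup>2 = 2\<pi>s\<close> turns the integrand into the standard normal
  density times a character, whose integral is the characteristic function of the normal law.
\<close>

lemma
  fixes s u :: real and n :: int
  assumes s: "s > 0"
  defines "g \<equiv> \<lambda>x::real. exp (- (of_real (pi * s) * (of_real x + of_real u)\<^sup>2)) *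
      exp (- (2 * of_real pi * \<i> * of_int n * of_real x)) :: complex"
  shows gaussian_fourier_integrable: "integrable lborel g"
    and gaussian_fourier_integral: "integral\<^sup>L lborel g =
      exp (2 * of_real pi * \<i> * of_int n * of_real u) * exp (- (of_real pi * of_int n ^ 2 / of_real s)) / of_real (sqrt s)"
proof -
  define c where "c = sqrt (2 * pi * s)"
  have c: "c > 0" "c\<^sup>2 = 2 * pi * s" using s by (auto simp: c_def)
  define t where "t = - 2 * pi * of_int n / c"
  define h where "h y = std_normal_density y *\<^sub>R iexp (t * y)" for y
  have "integrable std_normal_distribution (\<lambda>y. iexp (t * y))"
    by (intro prob_space.integrable_iexp prob_space_normal_density) simp_all
  then have int: "integrable lborel h"
    unfolding h_def by (subst (asm) integrable_density) (auto simp: normal_density_nonneg)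
  have val: "integral\<^sup>L lborel h = of_real (exp (- (t^2) / 2))"
    using fun_cong[OF char_std_normal_distribution, of t]
    unfolding char_def h_def by (subst (asm) integral_density) (auto simp: normal_density_nonneg)
  have sq: "(c * (u + x))\<^sup>2 / 2 = pi * s * (x + u)\<^sup>2" for x
    using c by (simp add: power_mult_distrib add.commute)
  have tc: "t * (c * (u + x)) = - 2 * pi * of_int n * (x + u)" for x
    using c by (simp add: t_def)
  have gh: "g x = of_real (sqrt (2 * pi)) * exp (2 * of_real pi * \<i> * of_int n * of_real u) * h (c * u + c * x)" for x
  proof -
    define X where "X = exp (- (of_real (pi * s) * (of_real x + of_real u :: complex)\<^sup>2))"
    define Y where "Y = exp (\<i> * of_real (- 2 * pi * of_int n * (x + u)))"
    define Z where "Z = exp (2 * of_real pi * \<i> * of_int n * of_real u)"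
    have X: "of_real (exp (- (pi * s * (x + u)\<^sup>2))) = X"
      unfolding X_def by (simp flip: exp_of_real)
    have "h (c * u + c * x) = of_real (1 / sqrt (2 * pi) * exp (- (pi * s * (x + u)\<^sup>2))) * Y"
      unfolding h_def ring_distribs(1)[symmetric] tc normal_density_def Y_def
      by (simp add: sq scaleR_conv_of_real)
    then have h: "h (c * u + c * x) = of_real (1 / sqrt (2 * pi)) * X * Y"
      by (simp only: of_real_mult X)
    have "Y * Z = exp (- (2 * of_real pi * \<i> * of_int n * of_real x))"
      unfolding Y_def Z_def exp_add[symmetric] by (rule arg_cong[of _ _ exp]) (simp add: algebra_simps)
    then have "g x = X * (Y * Z)"
      by (simp only: g_def X_def)
    then show ?thesis
      unfolding h Z_def[symmetric] by simp
  qed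
  have "integrable lborel (\<lambda>x. h (c * u + c * x))"
    using int c by (subst lborel_integrable_real_affine_iff) auto
  then show "integrable lborel g" unfolding gh[abs_def] by (rule integrable_mult_right)
  have "integral\<^sup>L lborel h = \<bar>c\<bar> *\<^sub>R integral\<^sup>L lborel (\<lambda>x. h (c * u + c * x))"
    using c by (intro lborel_integral_real_affine) auto
  then have "integral\<^sup>L lborel (\<lambda>x. h (c * u + c * x)) = of_real (exp (- (t^2) / 2)) / of_real c"
    using c by (simp add: val scaleR_conv_of_real field_simps)
  then have "integral\<^sup>L lborel g = of_real (sqrt (2 * pi)) * exp (2 * of_real pi * \<i> * of_int n * of_real u) *
      (of_real (exp (- (t^2) / 2)) / of_real c)"
    unfolding gh[abs_def] by simp
  also have "- (t^2) / 2 = - (pi * of_int n ^ 2 / s)"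
    using s unfolding t_def power_divide c(2) by (simp add: power2_eq_square field_simps)
  also have "of_real (exp (- (pi * of_int n ^ 2 / s))) = exp (- (of_real pi * of_int n ^ 2 / of_real s) :: complex)"
    by (simp flip: exp_of_real)
  also have "c = sqrt (2 * pi) * sqrt s"
    by (simp add: c_def real_sqrt_mult)
  finally show "integral\<^sup>L lborel g =
      exp (2 * of_real pi * \<i> * of_int n * of_real u) * exp (- (of_real pi * of_int n ^ 2 / of_real s)) / of_real (sqrt s)"
    by (simp add: field_simps)
qed

text \<open>
  A summable majorant, uniform in the unit disc, for the translates of a Gaussian by integers. It
  uses \<open>y\<^sup>2 \<ge> \<bar>y\<bar> - 1/4\<close> to replace a quadratic exponent by a linear one.
\<close>

lemma gaussian_translate_bound:
  fixes s u :: real and w :: complex and k :: int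
  assumes s: "s > 0" and w: "norm w < 1"
  shows "norm (exp (- (of_real (pi * s) * (w + of_int k + of_real u)\<^sup>2)))
     \<le> exp (pi * s * (\<bar>u\<bar> + 9 / 4)) * exp (- (pi * s * \<bar>of_int k\<bar>))"
proof -
  define y where "y = of_int k + u + Re w"
  have Re: "Re ((w + of_int k + of_real u)\<^sup>2) = y\<^sup>2 - (Im w)\<^sup>2"
    by (simp add: y_def power2_eq_square algebra_simps)
  have "\<bar>Re w\<bar> < 1" "\<bar>Im w\<bar> < 1"
    using w abs_Re_le_cmod[of w] abs_Im_le_cmod[of w] by linarith+
  then have Im: "(Im w)\<^sup>2 \<le> 1" and y: "\<bar>y\<bar> \<ge> \<bar>of_int k\<bar> - \<bar>u\<bar> - 1"
    by (auto simp: abs_square_le_1 y_def)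
  have "0 \<le> (\<bar>y\<bar> - 1 / 2)\<^sup>2" by simp
  then have "y\<^sup>2 \<ge> \<bar>y\<bar> - 1 / 4" by (simp add: power2_eq_square algebra_simps abs_if split: if_splits)
  then have "\<bar>of_int k\<bar> - (\<bar>u\<bar> + 9 / 4) \<le> y\<^sup>2 - (Im w)\<^sup>2"
    using Im y by linarith
  then have "pi * s * (\<bar>of_int k\<bar> - (\<bar>u\<bar> + 9 / 4)) \<le> pi * s * (y\<^sup>2 - (Im w)\<^sup>2)"
    using s by (intro mult_left_mono) auto
  then have "exp (- (pi * s * (y\<^sup>2 - (Im w)\<^sup>2))) \<le> exp (pi * s * (\<bar>u\<bar> + 9 / 4) + - (pi * s * \<bar>of_int k\<bar>))"
    by (simp add: algebra_simps)
  moreover have "norm (exp (- (of_real (pi * s) * (w + of_int k + of_real u)\<^sup>2))) = exp (- (pi * s * (y\<^sup>2 - (Im w)\<^sup>2)))"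
    unfolding norm_exp_eq_Re uminus_complex.simps times_complex.simps Re_complex_of_real
      Im_complex_of_real Re by simp
  ultimately show ?thesis by (simp only: exp_add)
qed

lemma integral_symmetric_tendsto_lebesgue:
  fixes g :: "real \<Rightarrow> complex"
  assumes g: "integrable lborel g"
  shows "(\<lambda>N. integral {- real N - 1/2..real N + 1/2} g) \<longlonglongrightarrow> integral\<^sup>L lborel g"
proof -
  have eq: "integral {- real N - 1/2..real N + 1/2} g =
      integral\<^sup>L lborel (\<lambda>x. indicator {- real N - 1/2..real N + 1/2} x *\<^sub>R g x)" for N
  proof -
    have "set_integrable lborel {- real N - 1/2..real N + 1/2} g"
      unfolding set_integrable_def using g by (intro integrable_mult_indicator) auto
    then show ?thesis
      by (subst set_borel_integral_eq_integral(2)[symmetric]) (auto simp: set_lebesgue_integral_def)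
  qed
  show ?thesis unfolding eq
  proof (rule integral_dominated_convergence)
    show "g \<in> borel_measurable lborel" "integrable lborel (\<lambda>x. norm (g x))"
      using g by auto
    show "(\<lambda>x. indicator {- real N - 1/2..real N + 1/2} x *\<^sub>R g x) \<in> borel_measurable lborel" for N
      using g by auto
    show "AE x in lborel. norm (indicator {- real N - 1/2..real N + 1/2} x *\<^sub>R g x) \<le> norm (g x)" for N
      by (auto simp: indicator_def)
    show "AE x in lborel. (\<lambda>N. indicator {- real N - 1/2..real N + 1/2} x *\<^sub>R g x) \<longlonglongrightarrow> g x"
    proof (rule AE_I2, rule tendsto_eventually)
      fix x :: real
      show "\<forall>\<^sub>F N in sequentially. indicator {- real N - 1/2..real N + 1/2} x *\<^sub>R g x = g x"
        using eventually_ge_at_top[of "nat \<lceil>\<bar>x\<bar>\<rceil>"]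
      proof eventually_elim
        case (elim N)
        then have "\<bar>x\<bar> \<le> real N" by linarith
        then show ?case by (auto simp: indicator_def abs_le_iff)
      qed
    qed
  qed
qed

text \<open>
  The sum \<open>f\<close> of all integer translates of the Gaussian is a locally uniform limit of holomorphic
  functions. Its Fourier coefficients over the period \<open>[-1/2, 1/2]\<close> unfold to integrals over the
  real line, since the partial sum over \<open>-N, \<dots>, N\<close> turns the period into \<open>[-N - 1/2, N + 1/2]\<close>.
\<close>

lemma poisson_gaussian:
  fixes s u :: real
  assumes s: "s > 0"
    and lhs: "((\<lambda>k. exp (- (of_real (pi * s) * (of_int k + of_real u)\<^sup>2))) has_sum L) UNIV"
    and rhs: "((\<lambda>n. exp (2 * of_real pi * \<i> * of_int n * of_real u) *
                exp (- (of_real pi * of_int n ^ 2 / of_real s)) :: complex) has_sum R) UNIV"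
  shows "L = R / of_real (sqrt s)"
proof -
  define g where "g w = exp (- (of_real (pi * s) * (w + of_real u :: complex)\<^sup>2))" for w
  define F where "F N w = (\<Sum>k\<in>{- int N..int N}. g (w + of_int k))" for N and w :: complex
  define M where "M k = exp (pi * s * (\<bar>u\<bar> + 9 / 4)) * exp (- (pi * s * \<bar>of_int k\<bar>))" for k :: int
  define h where "h n w = (if n = 0 then g w else g (w + of_nat n) + g (w - of_nat n))" for n :: nat and w
  have F_h: "F N w = (\<Sum>n<Suc N. h n w)" for N w
  proof (induction N)
    case (Suc N)
    then show ?case unfolding F_def sum_int_symmetric_Suc by (simp add: h_def algebra_simps)
  qed (simp add: F_def h_def)
  have bound: "norm (g (w + of_int k)) \<le> M k" if "norm w < 1" for w k
    using gaussian_translate_bound[OF s that, of k u] by (simp add: g_def M_def)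
  have "uniform_limit (ball 0 1) (\<lambda>N w. \<Sum>n<N. h n w) (\<lambda>w. \<Sum>n. h n w) sequentially"
  proof (rule Weierstrass_m_test[where M = "\<lambda>n. 2 * M (int n)"])
    fix n :: nat and w :: complex
    assume w: "w \<in> ball 0 1"
    have "norm (g (w + of_nat n)) \<le> M (int n)" "norm (g (w - of_nat n)) \<le> M (int n)" "0 \<le> M (int n)"
      using bound[of w "int n"] bound[of w "- int n"] w by (auto simp: M_def)
    then show "norm (h n w) \<le> 2 * M (int n)"
      by (auto simp: h_def intro: order_trans[OF norm_triangle_ineq])
  next
    have "exp (- (pi * s * \<bar>of_int (int n)\<bar>)) = exp (- (pi * s)) ^ n" for n
      by (simp add: exp_of_nat_mult[symmetric])
    then show "summable (\<lambda>n. 2 * M (int n))"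
      unfolding M_def using s by (auto intro!: summable_mult summable_geometric)
  qed
  then obtain f where f: "uniform_limit (ball 0 1) (\<lambda>N w. \<Sum>n<N. h n w) f sequentially" by blast
  have "uniform_limit (ball 0 1) (\<lambda>N w. \<Sum>n<Suc N. h n w) f sequentially"
    by (rule filterlim_compose[OF f filterlim_Suc])
  then have F: "uniform_limit (ball 0 1) F f sequentially"
    by (simp only: F_h[abs_def])
  have F_hol: "F N holomorphic_on A" for N A
    unfolding F_def g_def by (intro holomorphic_intros)
  have f_hol: "f holomorphic_on ball 0 1"
  proof (rule holomorphic_uniform_sequence[of _ F])
    fix x :: complex assume "x \<in> ball 0 1"
    then obtain d where d: "0 < d" "cball x d \<subseteq> ball 0 1"
      by (meson open_ball open_contains_cball)
    then show "\<exists>d>0. cball x d \<subseteq> ball 0 1 \<and> uniform_limit (cball x d) F f sequentially"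
      using uniform_limit_on_subset[OF F] by blast
  qed (auto intro: F_hol)
  have f0: "f 0 = L"
  proof (rule LIMSEQ_unique)
    show "(\<lambda>N. F N 0) \<longlonglongrightarrow> f 0"
      using F by (rule tendsto_uniform_limitI) simp
    show "(\<lambda>N. F N 0) \<longlonglongrightarrow> L"
      using has_sum_symmetric_partial_sums[OF lhs] by (simp add: F_def g_def)
  qed
  let ?I = "{-(1/2)..1/2::real}"
  have coeff: "integral ?I (\<lambda>x. f (of_real x) * exp (- (2 * of_real pi * \<i> * of_int n * of_real x)))
      = exp (2 * of_real pi * \<i> * of_int n * of_real u) *
          exp (- (of_real pi * of_int n ^ 2 / of_real s)) / of_real (sqrt s)" for n
  proof -
    define e where "e x = exp (- (2 * of_real pi * \<i> * of_int n * of_real x))" for x :: real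
    have e_shift: "e (x + of_int k) = e x" for x k
    proof -
      have "e (x + of_int k) = e x * exp (2 * of_int (- n * k) * of_real pi * \<i>)"
        unfolding e_def exp_add[symmetric] by (rule arg_cong[of _ _ exp]) (simp add: algebra_simps)
      then show ?thesis using exp_integer_2pi[of "of_int (- n * k)"] by simp
    qed
    have cont: "continuous_on A (\<lambda>x. g (of_real x) * e x)" for A
      unfolding g_def e_def by (intro continuous_intros)
    have shift: "integral ?I (\<lambda>x. g (of_real x + of_int k) * e x)
        = integral {of_int k - 1/2..of_int k + 1/2} (\<lambda>x. g (of_real x) * e x)" for k
      using integral_shift_Icc_real[of "- (1/2)" "1/2" "\<lambda>x. g (of_real x) * e x" "of_int k"]
      by (simp add: o_def add.commute e_shift algebra_simps)
    have partial: "integral ?I (\<lambda>x. F N (of_real x) * e x)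
        = integral {- real N - 1/2..real N + 1/2} (\<lambda>x. g (of_real x) * e x)" for N
    proof -
      have "integral ?I (\<lambda>x. F N (of_real x) * e x)
         = (\<Sum>k\<in>{- int N..int N}. integral ?I (\<lambda>x. g (of_real x + of_int k) * e x))"
        unfolding F_def sum_distrib_right g_def e_def
        by (intro integral_sum integrable_continuous_interval continuous_intros) simp
      also have "\<dots> = integral {- real N - 1/2..real N + 1/2} (\<lambda>x. g (of_real x) * e x)"
      proof (induction N)
        case 0
        then show ?case unfolding shift by simp
      next
        case (Suc N)
        let ?J = "\<lambda>a b. integral {a..b} (\<lambda>x. g (of_real x) * e x)"
        have J: "?J a b + ?J b c = ?J a c" if "a \<le> b" "b \<le> c" for a b c
          using that by (intro Henstock_Kurzweil_Integration.integral_combine integrable_continuous_interval cont)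
        show ?case
          unfolding sum_int_symmetric_Suc Suc unfolding shift
          using J[of "- real N - 1/2" "real N + 1/2" "real N + 1 + 1/2"]
            J[of "- real N - 1 - 1/2" "- real N - 1/2" "real N + 1 + 1/2"]
          by (simp add: algebra_simps)
      qed
      finally show ?thesis .
    qed
    have "(\<lambda>N. integral ?I (\<lambda>x. F N (of_real x) * e x)) \<longlonglongrightarrow> integral ?I (\<lambda>x. f (of_real x) * e x)"
    proof -
      have "uniform_limit ?I (\<lambda>N x. F N (of_real x) * e x) (\<lambda>x. f (of_real x) * e x) sequentially"
      proof (rule uniform_lim_mult)
        show "uniform_limit ?I (\<lambda>N x. F N (of_real x)) (\<lambda>x. f (of_real x)) sequentially"
        proof (rule uniform_limitI)
          fix d :: real assume "d > 0"
          from uniform_limitD[OF F this]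
          show "\<forall>\<^sub>F N in sequentially. \<forall>x\<in>?I. dist (F N (of_real x)) (f (of_real x)) < d"
            by eventually_elim (auto simp: abs_if)
        qed
        show "bounded ((\<lambda>x. f (of_real x)) ` ?I)"
          by (intro compact_imp_bounded compact_continuous_image
              continuous_on_compose2[OF holomorphic_on_imp_continuous_on[OF f_hol]] continuous_intros)
             (auto simp: abs_if)
        show "bounded (e ` ?I)" unfolding bounded_iff e_def by auto
      qed (rule uniform_limit_const)
      then obtain I J where IJ: "\<And>N. ((\<lambda>x. F N (of_real x) * e x) has_integral I N) ?I"
          "((\<lambda>x. f (of_real x) * e x) has_integral J) ?I" "I \<longlonglongrightarrow> J"
      proof (rule uniform_limit_integral)
        show "continuous_on ?I (\<lambda>x. F N (of_real x) * e x)" for N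
          unfolding F_def g_def e_def by (intro continuous_intros)
      qed auto
      have "integral ?I (\<lambda>x. F N (of_real x) * e x) = I N" for N
        using IJ(1) by (rule integral_unique)
      moreover have "integral ?I (\<lambda>x. f (of_real x) * e x) = J"
        using IJ(2) by (rule integral_unique)
      ultimately show ?thesis using IJ(3) by (simp only:)
    qed
    moreover have "(\<lambda>N. integral ?I (\<lambda>x. F N (of_real x) * e x)) \<longlonglongrightarrow>
        integral\<^sup>L lborel (\<lambda>x. g (of_real x) * e x)"
      unfolding partial
      by (rule integral_symmetric_tendsto_lebesgue)
        (use gaussian_fourier_integrable[OF s, of u n] in \<open>simp add: g_def e_def\<close>)
    ultimately have "integral ?I (\<lambda>x. f (of_real x) * e x) = integral\<^sup>L lborel (\<lambda>x. g (of_real x) * e x)"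
      by (rule LIMSEQ_unique)
    then show ?thesis
      using gaussian_fourier_integral[OF s, of u n] by (simp add: g_def e_def)
  qed
  have "(\<lambda>N. \<Sum>n\<in>{- int N..int N}. exp (2 * of_real pi * \<i> * of_int n * of_real u) *
          exp (- (of_real pi * of_int n ^ 2 / of_real s)) / of_real (sqrt s)) \<longlonglongrightarrow> L"
    using fourier_partial_sums_tendsto[OF f_hol] unfolding coeff f0 .
  moreover have "(\<lambda>N. (\<Sum>n\<in>{- int N..int N}. exp (2 * of_real pi * \<i> * of_int n * of_real u) *
          exp (- (of_real pi * of_int n ^ 2 / of_real s))) / of_real (sqrt s)) \<longlonglongrightarrow> R / of_real (sqrt s)"
    using has_sum_symmetric_partial_sums[OF rhs] s by (intro tendsto_intros) auto
  ultimately show ?thesis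
    unfolding sum_divide_distrib by (rule LIMSEQ_unique)
qed

section \<open>Modular transformations of the theta constants\<close>

text \<open>
  Both are Poisson summation with \<open>s = 1/t\<close>. The shift \<open>u = 1/2\<close> produces the half-integral exponents
  of \<open>\<theta>\<^sub>2\<close> on one side and the signs of \<open>\<theta>\<^sub>4\<close> on the other.
\<close>

lemma theta3_theta2_imaginary_axis:
  fixes t :: real
  assumes t: "t > 0"
  shows "theta3 (- 1 / (\<i> * of_real t)) = of_real (sqrt t) * theta3 (\<i> * of_real t)"
    and "theta2 (- 1 / (\<i> * of_real t)) = of_real (sqrt t) * theta4 (\<i> * of_real t)"
proof -
  define \<tau> where "\<tau> = \<i> * of_real t"
  define \<sigma> where "\<sigma> = - 1 / \<tau>"
  have \<sigma>: "\<sigma> = \<i> / of_real t" using t by (simp add: \<sigma>_def \<tau>_def field_simps)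
  have Im: "0 < Im \<tau>" "0 < Im \<sigma>" using t by (auto simp: \<tau>_def \<sigma>)
  have s: "1 / t > 0" using t by simp
  have sq: "sqrt (1 / t) = 1 / sqrt t" by (simp add: real_sqrt_divide)
  show "theta3 \<sigma> = of_real (sqrt t) * theta3 \<tau>"
  proof -
    have "theta3 \<sigma> = theta3 \<tau> / of_real (sqrt (1 / t))"
    proof (rule poisson_gaussian[where u = 0, OF s])
      have "exp (of_real pi * \<i> * of_int k ^ 2 * \<sigma>) =
          exp (- (of_real (pi * (1 / t)) * (of_int k + of_real 0)\<^sup>2))" for k
        using t by (simp add: \<sigma> field_simps)
      then show "((\<lambda>k. exp (- (of_real (pi * (1 / t)) * (of_int k + of_real 0)\<^sup>2))) has_sum theta3 \<sigma>) UNIV"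
        using theta3_has_sum[OF Im(2)] by (simp add: theta3_nome[OF Im(2)])
      have "exp (of_real pi * \<i> * of_int k ^ 2 * \<tau>) =
          exp (2 * of_real pi * \<i> * of_int k * of_real 0) * exp (- (of_real pi * of_int k ^ 2 / of_real (1 / t)))" for k
        using t by (simp add: \<tau>_def field_simps)
      then show "((\<lambda>n. exp (2 * of_real pi * \<i> * of_int n * of_real 0) *
                exp (- (of_real pi * of_int n ^ 2 / of_real (1 / t)))) has_sum theta3 \<tau>) UNIV"
        using theta3_has_sum[OF Im(1)] by (simp add: theta3_nome[OF Im(1)])
    qed
    then show ?thesis by (simp add: sq)
  qed
  show "theta2 \<sigma> = of_real (sqrt t) * theta4 \<tau>"
  proof -
    have "theta2 \<sigma> = theta4 \<tau> / of_real (sqrt (1 / t))"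
    proof (rule poisson_gaussian[where u = "1 / 2", OF s])
      have "exp (of_real pi * \<i> * (of_int k + 1 / 2) ^ 2 * \<sigma>) =
          exp (- (of_real (pi * (1 / t)) * (of_int k + of_real (1 / 2))\<^sup>2))" for k
        using t by (simp add: \<sigma> field_simps)
      then show "((\<lambda>k. exp (- (of_real (pi * (1 / t)) * (of_int k + of_real (1 / 2))\<^sup>2))) has_sum theta2 \<sigma>) UNIV"
        using theta2_has_sum[OF Im(2)] by (simp only: theta2_nome[OF Im(2)])
      have "(-1) powi k * exp (of_real pi * \<i> * of_int k ^ 2 * \<tau>) =
          exp (2 * of_real pi * \<i> * of_int k * of_real (1 / 2)) * exp (- (of_real pi * of_int k ^ 2 / of_real (1 / t)))" for k
      proof -
        have "exp (2 * of_real pi * \<i> * of_int k * of_real (1 / 2)) = exp (of_real pi * \<i>) powi k"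
          by (subst exp_power_int) (simp add: mult_ac)
        moreover have "of_real pi * \<i> * of_int k ^ 2 * \<tau> = - (of_real pi * of_int k ^ 2 / of_real (1 / t))"
          using t by (simp add: \<tau>_def field_simps)
        ultimately show ?thesis by simp
      qed
      then show "((\<lambda>n. exp (2 * of_real pi * \<i> * of_int n * of_real (1 / 2)) *
                exp (- (of_real pi * of_int n ^ 2 / of_real (1 / t)))) has_sum theta4 \<tau>) UNIV"
        using theta4_has_sum[OF Im(1)] by (simp only: theta4_nome[OF Im(1)])
    qed
    then show ?thesis by (simp add: sq)
  qed
qed

lemma open_upper_half_plane: "open upper_half_plane"
  by (rule open_halfspace_Im_gt)

lemma connected_upper_half_plane: "connected upper_half_plane"
  by (intro convex_connected convex_halfspace_Im_gt)

lemma holomorphic_compose_mem: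
  assumes "f holomorphic_on T" "g holomorphic_on S" "\<And>x. x \<in> S \<Longrightarrow> g x \<in> T"
  shows "(\<lambda>x. f (g x)) holomorphic_on S"
  using holomorphic_on_compose_gen[of g S f T] assms by (auto simp: o_def image_subset_iff)

lemma nome_holomorphic_compose:
  assumes "f holomorphic_on ball 0 1"
  shows "(\<lambda>\<tau>. f (nome \<tau>)) holomorphic_on upper_half_plane"
  by (rule holomorphic_compose_mem[OF assms]) (auto intro!: holomorphic_intros)

lemma theta3_holomorphic: "theta3 holomorphic_on upper_half_plane"
  using nome_holomorphic_compose[OF phi_holomorphic]
  by (rule holomorphic_transform) (simp add: theta3_nome)

lemma phi_minus_holomorphic: "(\<lambda>x. phi (- x)) holomorphic_on ball 0 1"
  by (rule holomorphic_compose_mem[OF phi_holomorphic]) (auto intro!: holomorphic_intros)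

lemma theta4_holomorphic: "theta4 holomorphic_on upper_half_plane"
  using nome_holomorphic_compose[OF phi_minus_holomorphic]
  by (rule holomorphic_transform) (simp add: theta4_nome)

lemma theta2_holomorphic: "theta2 holomorphic_on upper_half_plane"
proof -
  have "(\<lambda>\<tau>. nome (\<tau> / 4) * (2 * psi (nome \<tau>))) holomorphic_on upper_half_plane"
    by (intro holomorphic_intros nome_holomorphic_compose psi_holomorphic) auto
  then show ?thesis
    by (rule holomorphic_transform) (simp add: theta2_nome)
qed

lemma Im_minus_inverse_pos: "0 < Im \<tau> \<Longrightarrow> 0 < Im (- 1 / \<tau>)"
  by (auto simp: Im_divide power2_eq_square intro!: divide_pos_pos add_nonneg_pos)

lemma holomorphic_minus_inverse_compose:
  assumes "f holomorphic_on upper_half_plane"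
  shows "(\<lambda>\<tau>. f (- 1 / \<tau>)) holomorphic_on upper_half_plane"
proof -
  have "(\<lambda>\<tau>. - 1 / \<tau>) holomorphic_on upper_half_plane"
    by (intro holomorphic_intros) auto
  then show ?thesis
    by (rule holomorphic_compose_mem[OF assms]) (use Im_minus_inverse_pos in simp)
qed

text \<open>
  Poisson summation with real parameters yields the transformation formulas on the imaginary axis;
  this extends them to the half-plane.
\<close>

lemma identity_from_imaginary_axis:
  assumes f: "f holomorphic_on upper_half_plane"
    and zero: "\<And>t::real. t > 0 \<Longrightarrow> f (\<i> * of_real t) = 0"
    and \<tau>: "0 < Im \<tau>"
  shows "f \<tau> = 0"
proof (rule analytic_continuation[of f upper_half_plane "(\<lambda>t::real. \<i> * of_real t) ` {0<..}" \<i>])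
  show "\<i> islimpt (\<lambda>t::real. \<i> * of_real t) ` {0<..}"
    unfolding islimpt_sequential
  proof (intro exI[of _ "\<lambda>n. \<i> * of_real (1 + 1 / real (Suc n))"] conjI allI)
    show "\<i> * of_real (1 + 1 / real (Suc n)) \<in> (\<lambda>t::real. \<i> * of_real t) ` {0<..} - {\<i>}" for n
    proof -
      have "\<i> * of_real (1 + 1 / real (Suc n)) \<noteq> \<i>" by (simp add: complex_eq_iff)
      moreover have "1 + 1 / real (Suc n) > 0" by (simp add: add_pos_nonneg)
      ultimately show ?thesis by blast
    qed
    have "(\<lambda>n. \<i> * of_real (1 + inverse (real (Suc n)))) \<longlonglongrightarrow> \<i> * of_real (1 + 0)"
      by (intro tendsto_intros LIMSEQ_inverse_real_of_nat)
    then show "(\<lambda>n. \<i> * of_real (1 + 1 / real (Suc n))) \<longlonglongrightarrow> \<i>"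
      by (simp add: inverse_eq_divide)
  qed
qed (use assms open_upper_half_plane connected_upper_half_plane in auto)

text \<open>
  The automorphy factor of weight 1/2. The principal root is holomorphic on the upper half-plane
  because \<open>-i\<tau>\<close> has positive real part there.
\<close>

definition theta_factor :: "complex \<Rightarrow> complex" where
  "theta_factor \<tau> = csqrt (- \<i> * \<tau>)"

lemma theta_factor_square: "theta_factor \<tau> ^ 2 = - \<i> * \<tau>"
  by (simp add: theta_factor_def)

lemma theta_factor_nonzero: "0 < Im \<tau> \<Longrightarrow> theta_factor \<tau> \<noteq> 0"
  by (auto simp: theta_factor_def)

lemma theta_factor_holomorphic: "theta_factor holomorphic_on upper_half_plane"
  unfolding theta_factor_def
  by (intro holomorphic_intros) (auto simp: complex_nonpos_Reals_iff)

lemma theta_factor_triple: "theta_factor (3 * \<tau>) = of_real (sqrt 3) * theta_factor \<tau>"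
proof -
  have "of_real (sqrt 3) ^ 2 = (3 :: complex)"
    by (simp flip: of_real_power)
  then have "csqrt (3 * (- \<i> * \<tau>)) = of_real (sqrt 3) * csqrt (- \<i> * \<tau>)"
    using csqrt_principal[of "- \<i> * \<tau>"]
    by (intro csqrt_unique) (auto simp: power_mult_distrib simp del: csqrt.simps)
  then show ?thesis by (simp add: theta_factor_def mult_ac)
qed

lemma
  assumes \<tau>: "0 < Im \<tau>"
  shows theta3_minus_inverse: "theta3 (- 1 / \<tau>) = theta_factor \<tau> * theta3 \<tau>"
    and theta2_minus_inverse: "theta2 (- 1 / \<tau>) = theta_factor \<tau> * theta4 \<tau>"
proof -
  have theta_factor_axis: "theta_factor (\<i> * of_real t) = of_real (sqrt t)" if "t > 0" for t
    using that unfolding theta_factor_def by (simp add: mult.assoc[symmetric])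
  have "theta3 (- 1 / \<tau>) - theta_factor \<tau> * theta3 \<tau> = 0"
    by (rule identity_from_imaginary_axis[of "\<lambda>\<tau>. theta3 (- 1 / \<tau>) - theta_factor \<tau> * theta3 \<tau>", OF _ _ \<tau>])
      (intro holomorphic_intros holomorphic_minus_inverse_compose theta3_holomorphic theta_factor_holomorphic,
       simp only: theta3_theta2_imaginary_axis(1) theta_factor_axis diff_self)
  then show "theta3 (- 1 / \<tau>) = theta_factor \<tau> * theta3 \<tau>" by simp
  have "theta2 (- 1 / \<tau>) - theta_factor \<tau> * theta4 \<tau> = 0"
    by (rule identity_from_imaginary_axis[of "\<lambda>\<tau>. theta2 (- 1 / \<tau>) - theta_factor \<tau> * theta4 \<tau>", OF _ _ \<tau>])
      (intro holomorphic_intros holomorphic_minus_inverse_compose theta2_holomorphic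
          theta4_holomorphic theta_factor_holomorphic,
       simp only: theta3_theta2_imaginary_axis(2) theta_factor_axis diff_self)
  then show "theta2 (- 1 / \<tau>) = theta_factor \<tau> * theta4 \<tau>" by simp
qed

text \<open>
  The transformation of \<open>\<theta>\<^sub>2\<close>, applied at \<open>-1/\<tau>\<close>; the two automorphy factors are mutually inverse.
\<close>

lemma theta4_minus_inverse:
  assumes \<tau>: "0 < Im \<tau>"
  shows "theta4 (- 1 / \<tau>) = theta_factor \<tau> * theta2 \<tau>"
proof -
  have Re: "Re (- \<i> * \<tau>) > 0" "Re (\<i> / \<tau>) > 0" using \<tau>
    by (auto simp: Re_divide power2_eq_square intro!: divide_pos_pos add_nonneg_pos)
  have nz: "\<tau> \<noteq> 0" using \<tau> by auto
  have "theta_factor (- 1 / \<tau>) = csqrt (inverse (- \<i> * \<tau>))"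
  proof -
    have "- \<i> * (- 1 / \<tau>) = inverse (- \<i> * \<tau>)" using nz by (simp add: field_simps)
    then show ?thesis unfolding theta_factor_def by (simp only:)
  qed
  also have "\<dots> = inverse (theta_factor \<tau>)"
    unfolding theta_factor_def using Re
    by (subst csqrt_inverse) (auto simp: complex_nonpos_Reals_iff)
  finally have "theta_factor (- 1 / \<tau>) * theta_factor \<tau> = 1"
    using theta_factor_nonzero[OF \<tau>] by simp
  moreover have "theta2 \<tau> = theta_factor (- 1 / \<tau>) * theta4 (- 1 / \<tau>)"
    using theta2_minus_inverse[OF Im_minus_inverse_pos[OF \<tau>]] by simp
  ultimately show ?thesis by (simp add: mult_ac)
qed

lemma theta3_nonzero: "0 < Im \<tau> \<Longrightarrow> theta3 \<tau> \<noteq> 0"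
  by (simp add: theta3_nome phi_nonzero)

lemma theta4_nonzero: "0 < Im \<tau> \<Longrightarrow> theta4 \<tau> \<noteq> 0"
  by (simp add: theta4_nome phi_nonzero)

lemma theta2_nonzero: "0 < Im \<tau> \<Longrightarrow> theta2 \<tau> \<noteq> 0"
  using theta4_minus_inverse[of \<tau>] theta4_nonzero[OF Im_minus_inverse_pos[of \<tau>]] by auto

lemma nome_plus_one [simp]: "nome (\<tau> + 1) = - nome \<tau>"
  by (simp add: ring_distribs exp_add)

lemma theta3_plus_one: "0 < Im \<tau> \<Longrightarrow> theta3 (\<tau> + 1) = theta4 \<tau>"
  by (simp add: theta3_nome theta4_nome del: exp_of_real)

lemma theta4_plus_one: "0 < Im \<tau> \<Longrightarrow> theta4 (\<tau> + 1) = theta3 \<tau>"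
  by (simp add: theta3_nome theta4_nome)

lemma psi_minus: "psi (- x) = psi x"
  by (simp add: psi_def)

lemma theta2_plus_one: "0 < Im \<tau> \<Longrightarrow> theta2 (\<tau> + 1) = nome (1 / 4) * theta2 \<tau>"
  by (simp add: theta2_nome psi_minus add_divide_distrib ring_distribs exp_add)

text \<open>
  The factor of \<open>\<theta>\<^sub>2\<close> under \<open>\<tau> \<mapsto> \<tau> + 1\<close> is a primitive eighth root of unity.
\<close>

lemma nome_quarter_power: "nome (1 / 4) ^ 2 = \<i>" "nome (1 / 4) ^ 4 = -1"
proof -
  have "nome (1 / 4) ^ 2 = cis (pi / 2)"
    unfolding nome_power cis_conv_exp by (rule arg_cong[of _ _ exp]) simp
  then show *: "nome (1 / 4) ^ 2 = \<i>" by simp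
  have "nome (1 / 4) ^ 4 = (nome (1 / 4) ^ 2) ^ 2"
    unfolding power_mult[symmetric] by simp
  then show "nome (1 / 4) ^ 4 = -1" unfolding * by simp
qed

section \<open>The Fricke group and its vanishing criterion\<close>

text \<open>
  The Fricke involution of level 3. It exchanges the theta constants at \<open>\<tau>\<close> with those at \<open>3\<tau>\<close>,
  since \<open>3 \<sqdot> (-1/(3\<tau>)) = -1/\<tau>\<close>.
\<close>

definition fricke :: "complex \<Rightarrow> complex" where
  "fricke \<tau> = - 1 / (3 * \<tau>)"

lemma Im_fricke: "Im (fricke \<tau>) = Im \<tau> / (3 * (norm \<tau>)\<^sup>2)"
proof -
  have "Im (fricke \<tau>) = (3 * Im \<tau>) / (3 * (3 * ((Re \<tau>)\<^sup>2 + (Im \<tau>)\<^sup>2)))"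
    by (simp add: fricke_def Im_divide power_mult_distrib)
  moreover have "3 * x / (3 * (3 * y)) = x / (3 * y)" for x y :: real
    by (rule mult_divide_mult_cancel_left) simp
  ultimately show ?thesis
    unfolding cmod_power2 by (simp only:)
qed

lemma Im_fricke_pos: "0 < Im \<tau> \<Longrightarrow> 0 < Im (fricke \<tau>)"
  unfolding Im_fricke by (intro divide_pos_pos mult_pos_pos zero_less_power) auto

text \<open>
  Reduction theory: a property that is invariant under the two generators holds everywhere if it
  holds on the half-strip \<open>\<bar>Re \<tau>\<bar> \<le> 1/2\<close>, \<open>Im \<tau> \<ge> 1/6\<close>. The half-strip is slightly larger than a
  fundamental domain, which makes the reduction terminate by a crude estimate: if \<open>\<bar>Re \<tau>\<bar> \<le> 1/2\<close>
  and \<open>Im \<tau> < 1/6\<close>, then \<open>3\<bar>\<tau>\<bar>\<^sup>2 \<le> 3(1/4 + 1/36) = 5/6\<close>, so the involution raises the imaginary part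
  by a factor of at least 6/5.
\<close>

lemma fricke_group_induct [consumes 1, case_names strip translate fricke]:
  assumes "0 < Im \<tau>"
    and strip: "\<And>\<tau>. 1 / 6 \<le> Im \<tau> \<Longrightarrow> \<bar>Re \<tau>\<bar> \<le> 1 / 2 \<Longrightarrow> P \<tau>"
    and translate: "\<And>\<tau>. 0 < Im \<tau> \<Longrightarrow> P (\<tau> + 1) \<longleftrightarrow> P \<tau>"
    and fricke: "\<And>\<tau>. 0 < Im \<tau> \<Longrightarrow> P (fricke \<tau>) \<longleftrightarrow> P \<tau>"
  shows "P \<tau>"
proof -
  have nat: "P (\<tau> + of_nat n) \<longleftrightarrow> P \<tau>" if "0 < Im \<tau>" for n \<tau>
  proof (induction n)
    case (Suc n)
    have "P (\<tau> + of_nat n + 1) \<longleftrightarrow> P (\<tau> + of_nat n)"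
      by (rule translate) (use that in simp)
    then show ?case using Suc by (simp add: add_ac)
  qed simp
  have int: "P (\<tau> + of_int n) \<longleftrightarrow> P \<tau>" if "0 < Im \<tau>" for n \<tau>
  proof (cases "n \<ge> 0")
    case True
    then show ?thesis using nat[OF that, of "nat n"] by (simp add: of_nat_nat)
  next
    case False
    then have eq: "\<tau> + of_int n + of_nat (nat (- n)) = \<tau>" by (simp add: of_nat_nat)
    show ?thesis using nat[of "\<tau> + of_int n" "nat (- n)", unfolded eq] that by simp
  qed
  have "P \<tau>" if "0 < Im \<tau>" "1 / 6 * (5 / 6) ^ k \<le> Im \<tau>" for k \<tau>
    using that
  proof (induction k arbitrary: \<tau>)
    case (0 \<tau>)
    define \<sigma> where "\<sigma> = \<tau> + of_int (- round (Re \<tau>))"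
    have "P \<sigma>"
      by (rule strip) (use 0 of_int_round_abs_le[of "Re \<tau>"] in \<open>auto simp: \<sigma>_def abs_minus_commute\<close>)
    then show ?case using int[OF \<open>0 < Im \<tau>\<close>] by (simp only: \<sigma>_def)
  next
    case (Suc k \<tau>)
    define \<sigma> where "\<sigma> = \<tau> + of_int (- round (Re \<tau>))"
    have \<sigma>: "Im \<sigma> = Im \<tau>" "\<bar>Re \<sigma>\<bar> \<le> 1 / 2"
      using of_int_round_abs_le[of "Re \<tau>"] by (auto simp: \<sigma>_def abs_minus_commute)
    have "P \<sigma>"
    proof (cases "1 / 6 \<le> Im \<sigma>")
      case True
      then show ?thesis using \<sigma> strip by blast
    next
      case False
      have pos: "0 < Im \<sigma>" using Suc \<sigma> by simp
      have "(Re \<sigma>)\<^sup>2 \<le> (1 / 2)\<^sup>2" using \<sigma>(2) by (intro power2_le_iff_abs_le[THEN iffD2]) auto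
      moreover have "(Im \<sigma>)\<^sup>2 \<le> (1 / 6)\<^sup>2" using False pos by (intro power_mono) auto
      ultimately have n: "3 * (norm \<sigma>)\<^sup>2 \<le> 5 / 6"
        unfolding cmod_power2 by (simp add: power_divide)
      have "0 < 3 * (norm \<sigma>)\<^sup>2" using pos by auto
      then have "Im \<sigma> / (5 / 6) \<le> Im (fricke \<sigma>)"
        unfolding Im_fricke using n pos by (intro divide_left_mono) auto
      then have "1 / 6 * (5 / 6) ^ k \<le> Im (fricke \<sigma>)"
        using Suc.prems \<sigma>(1) by simp
      then have "P (fricke \<sigma>)" by (intro Suc.IH Im_fricke_pos pos)
      then show ?thesis using fricke[OF pos] by simp
    qed
    then show ?case using int[OF \<open>0 < Im \<tau>\<close>] by (simp only: \<sigma>_def)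
  qed
  moreover obtain k where "(5 / 6 :: real) ^ k < Im \<tau>"
    using real_arch_pow_inv[of "Im \<tau>" "5 / 6"] assms(1) by auto
  moreover have "1 / 6 * (5 / 6 :: real) ^ k \<le> (5 / 6) ^ k" by simp
  ultimately show ?thesis using assms(1) by (meson less_imp_le order_trans)
qed

lemma
  assumes \<tau>: "0 < Im \<tau>"
  shows theta2_triple_plus_one: "theta2 (3 * (\<tau> + 1)) = nome (1 / 4) ^ 3 * theta2 (3 * \<tau>)"
    and theta3_triple_plus_one: "theta3 (3 * (\<tau> + 1)) = theta4 (3 * \<tau>)"
    and theta4_triple_plus_one: "theta4 (3 * (\<tau> + 1)) = theta3 (3 * \<tau>)"
proof -
  have eq: "3 * (\<tau> + 1) = 3 * \<tau> + 1 + 1 + 1" by simp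
  have pos: "0 < Im (3 * \<tau>)" "0 < Im (3 * \<tau> + 1)" "0 < Im (3 * \<tau> + 1 + 1)" using \<tau> by auto
  show "theta2 (3 * (\<tau> + 1)) = nome (1 / 4) ^ 3 * theta2 (3 * \<tau>)"
    "theta3 (3 * (\<tau> + 1)) = theta4 (3 * \<tau>)" "theta4 (3 * (\<tau> + 1)) = theta3 (3 * \<tau>)"
    unfolding eq using pos
    by (simp_all only: theta2_plus_one theta3_plus_one theta4_plus_one power3_eq_cube mult.assoc)
qed

lemmas theta_translate = theta2_plus_one theta3_plus_one theta4_plus_one
  theta2_triple_plus_one theta3_triple_plus_one theta4_triple_plus_one

lemma
  assumes \<tau>: "0 < Im \<tau>"
  shows theta2_fricke: "theta2 (fricke \<tau>) = of_real (sqrt 3) * theta_factor \<tau> * theta4 (3 * \<tau>)"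
    and theta3_fricke: "theta3 (fricke \<tau>) = of_real (sqrt 3) * theta_factor \<tau> * theta3 (3 * \<tau>)"
    and theta4_fricke: "theta4 (fricke \<tau>) = of_real (sqrt 3) * theta_factor \<tau> * theta2 (3 * \<tau>)"
    and theta2_triple_fricke: "theta2 (3 * fricke \<tau>) = theta_factor \<tau> * theta4 \<tau>"
    and theta3_triple_fricke: "theta3 (3 * fricke \<tau>) = theta_factor \<tau> * theta3 \<tau>"
    and theta4_triple_fricke: "theta4 (3 * fricke \<tau>) = theta_factor \<tau> * theta2 \<tau>"
proof -
  have 3: "0 < Im (3 * \<tau>)" using \<tau> by simp
  have "3 * fricke \<tau> = - 1 / \<tau>" by (simp add: fricke_def)
  then show "theta2 (3 * fricke \<tau>) = theta_factor \<tau> * theta4 \<tau>"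
    "theta3 (3 * fricke \<tau>) = theta_factor \<tau> * theta3 \<tau>" "theta4 (3 * fricke \<tau>) = theta_factor \<tau> * theta2 \<tau>"
    by (simp_all only: theta2_minus_inverse[OF \<tau>] theta3_minus_inverse[OF \<tau>] theta4_minus_inverse[OF \<tau>])
  show "theta2 (fricke \<tau>) = of_real (sqrt 3) * theta_factor \<tau> * theta4 (3 * \<tau>)"
    "theta3 (fricke \<tau>) = of_real (sqrt 3) * theta_factor \<tau> * theta3 (3 * \<tau>)"
    "theta4 (fricke \<tau>) = of_real (sqrt 3) * theta_factor \<tau> * theta2 (3 * \<tau>)"
    unfolding fricke_def
    by (simp_all only: theta2_minus_inverse[OF 3] theta3_minus_inverse[OF 3] theta4_minus_inverse[OF 3] theta_factor_triple)
qed

lemmas theta_fricke = theta2_fricke theta3_fricke theta4_fricke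
  theta2_triple_fricke theta3_triple_fricke theta4_triple_fricke

lemma triple_holomorphic:
  assumes "f holomorphic_on upper_half_plane"
  shows "(\<lambda>\<tau>. f (3 * \<tau>)) holomorphic_on upper_half_plane"
  by (rule holomorphic_compose_mem[OF assms]) (auto intro!: holomorphic_intros)

lemmas theta_holomorphic = theta2_holomorphic theta3_holomorphic theta4_holomorphic
  triple_holomorphic[OF theta2_holomorphic] triple_holomorphic[OF theta3_holomorphic]
  triple_holomorphic[OF theta4_holomorphic]

lemma
  assumes \<tau>: "0 < Im \<tau>"
  shows theta2_triple_nome: "theta2 (3 * \<tau>) = nome (3 * \<tau> / 4) * (2 * psi (nome \<tau> ^ 3))"
    and theta3_triple_nome: "theta3 (3 * \<tau>) = phi (nome \<tau> ^ 3)"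
    and theta4_triple_nome: "theta4 (3 * \<tau>) = phi (- (nome \<tau> ^ 3))"
  using \<tau> by (simp_all add: theta2_nome theta3_nome theta4_nome nome_power)

lemmas theta_nome = theta2_nome theta3_nome theta4_nome
  theta2_triple_nome theta3_triple_nome theta4_triple_nome

lemma theta_nonzero:
  assumes \<tau>: "0 < Im \<tau>"
  shows "theta2 \<tau> \<noteq> 0" "theta3 \<tau> \<noteq> 0" "theta4 \<tau> \<noteq> 0"
    "theta2 (3 * \<tau>) \<noteq> 0" "theta3 (3 * \<tau>) \<noteq> 0" "theta4 (3 * \<tau>) \<noteq> 0"
  using \<tau> by (simp_all add: theta2_nonzero theta3_nonzero theta4_nonzero)

lemma holomorphic_cube_compose:
  assumes "f holomorphic_on ball 0 1"
  shows "(\<lambda>x. f (x ^ 3)) holomorphic_on ball 0 1"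
  by (rule holomorphic_compose_mem[OF assms])
     (auto intro!: holomorphic_intros simp: norm_power power_less_one_iff)

lemmas nome_series_holomorphic = phi_holomorphic psi_holomorphic phi_minus_holomorphic
  holomorphic_cube_compose[OF phi_holomorphic] holomorphic_cube_compose[OF psi_holomorphic]
  holomorphic_cube_compose[OF phi_minus_holomorphic]

lemma isCont_0: "f holomorphic_on ball 0 1 \<Longrightarrow> isCont f 0"
  by (metis centre_in_ball continuous_on_eq_continuous_at holomorphic_on_imp_continuous_on
      open_ball zero_less_one)

lemma nome_split: "nome (\<tau> / 4) * nome (3 * \<tau> / 4) = nome \<tau>"
  unfolding exp_add[symmetric] by (rule arg_cong[of _ _ exp]) (simp add: field_simps)

text \<open>
  A form of weight 3 without zeros in the half-plane and with a simple zero in \<open>x\<close> at the cusp. It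
  serves as the denominator that brings other forms to weight 0.
\<close>

definition theta_product :: "complex \<Rightarrow> complex" where
  "theta_product \<tau> = theta2 \<tau> * theta3 \<tau> * theta4 \<tau> * (theta2 (3 * \<tau>) * theta3 (3 * \<tau>) * theta4 (3 * \<tau>))"

lemma theta_product_nonzero: "0 < Im \<tau> \<Longrightarrow> theta_product \<tau> \<noteq> 0"
  by (simp add: theta_product_def theta_nonzero)

lemma theta_product_holomorphic: "theta_product holomorphic_on upper_half_plane"
  unfolding theta_product_def[abs_def] by (intro holomorphic_intros theta_holomorphic)

lemma norm_theta_product_plus_one: "0 < Im \<tau> \<Longrightarrow> norm (theta_product (\<tau> + 1)) = norm (theta_product \<tau>)"
  unfolding theta_product_def theta_translate by (simp add: norm_mult norm_power mult_ac)

lemma norm_theta_factor_square: "norm (theta_factor \<tau>) ^ 2 = norm \<tau>"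
  by (simp add: norm_power[symmetric] theta_factor_square norm_mult)

lemma norm_theta_product_fricke:
  assumes \<tau>: "0 < Im \<tau>"
  shows "norm (theta_product (fricke \<tau>)) = (sqrt 3 * norm \<tau>) ^ 3 * norm (theta_product \<tau>)"
proof -
  have "theta_product (fricke \<tau>) = of_real (sqrt 3) ^ 3 * (theta_factor \<tau> ^ 2) ^ 3 * theta_product \<tau>"
    unfolding theta_product_def theta_fricke[OF \<tau>] by (simp add: power2_eq_square power3_eq_cube mult_ac)
  then show ?thesis
    by (simp only: norm_mult norm_power norm_theta_factor_square) (simp add: power_mult_distrib)
qed

lemma theta_product_nome:
  obtains d where "isCont d 0" "d 0 \<noteq> 0" "\<And>\<tau>. 0 < Im \<tau> \<Longrightarrow> theta_product \<tau> = nome \<tau> * d (nome \<tau>)"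
proof
  let ?d = "\<lambda>x. (2 * psi x) * phi x * phi (- x) * ((2 * psi (x ^ 3)) * phi (x ^ 3) * phi (- (x ^ 3)))"
  show "isCont ?d 0"
    by (intro isCont_0 holomorphic_intros nome_series_holomorphic)
  show "?d 0 \<noteq> 0" by simp
  show "theta_product \<tau> = nome \<tau> * ?d (nome \<tau>)" if "0 < Im \<tau>" for \<tau>
  proof -
    have "theta_product \<tau> = (nome (\<tau> / 4) * nome (3 * \<tau> / 4)) * ?d (nome \<tau>)"
      unfolding theta_product_def theta_nome[OF that] by (simp only: mult_ac)
    then show ?thesis unfolding nome_split .
  qed
qed

lemma nome_eventually:
  assumes "eventually P (nhds 0)"
  obtains Y where "1 / 6 \<le> Y" "\<And>\<tau>. Y \<le> Im \<tau> \<Longrightarrow> P (nome \<tau>)"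
proof -
  obtain r where r: "r > 0" "\<And>x. dist x 0 < r \<Longrightarrow> P x"
    using assms unfolding eventually_nhds_metric by blast
  show ?thesis
  proof (rule that[of "max (1 / 6) (1 - ln r / pi)"])
    fix \<tau> assume "max (1 / 6) (1 - ln r / pi) \<le> Im \<tau>"
    then have "- ln r / pi < Im \<tau>" by simp
    then have "- pi * Im \<tau> < ln r" by (simp add: field_simps)
    then have "exp (- pi * Im \<tau>) < r" using r(1) by (metis exp_less_cancel_iff exp_ln)
    then have "dist (nome \<tau>) 0 < r" unfolding dist_norm diff_zero norm_nome .
    then show "P (nome \<tau>)" by (rule r(2))
  qed simp
qed

text \<open>
  The valence bound for \<open>G\<close> in the form needed here. The quotient \<open>F\<close> of \<open>f\<^sup>3\<close> by the \<open>k\<close>-th power of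
  \<open>theta_product\<close> has modulus invariant under \<open>G\<close> and vanishes at the cusp to order \<open>3m - k > 0\<close>. If
  it were nonzero somewhere, its modulus would attain its maximum over the half-plane in a compact
  part of the half-strip, so that \<open>F\<close> would be constant and could not decay. The hypotheses are stated
  for moduli in order to cover products of functions that \<open>G\<close> permutes up to factors of modulus 1.
\<close>

lemma fricke_weight_vanishing:
  assumes hol: "f holomorphic_on upper_half_plane"
    and translate: "\<And>\<tau>. 0 < Im \<tau> \<Longrightarrow> norm (f (\<tau> + 1)) = norm (f \<tau>)"
    and fricke: "\<And>\<tau>. 0 < Im \<tau> \<Longrightarrow> norm (f (fricke \<tau>)) = (sqrt 3 * norm \<tau>) ^ k * norm (f \<tau>)"
    and cusp: "\<And>\<tau>. 0 < Im \<tau> \<Longrightarrow> f \<tau> = nome \<tau> ^ m * h (nome \<tau>)" "isCont h 0"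
    and order: "k < 3 * m"
    and \<tau>0: "0 < Im \<tau>\<^sub>0"
  shows "f \<tau>\<^sub>0 = 0"
proof (rule ccontr)
  assume nz: "f \<tau>\<^sub>0 \<noteq> 0"
  define F where "F \<tau> = f \<tau> ^ 3 / theta_product \<tau> ^ k" for \<tau>
  obtain d where d: "isCont d 0" "d 0 \<noteq> 0"
    "\<And>\<tau>. 0 < Im \<tau> \<Longrightarrow> theta_product \<tau> = nome \<tau> * d (nome \<tau>)"
    using theta_product_nome by blast
  define K where "K x = x ^ (3 * m - k) * h x ^ 3 / d x ^ k" for x
  have F_hol: "F holomorphic_on upper_half_plane"
    unfolding F_def using hol theta_product_holomorphic theta_product_nonzero
    by (intro holomorphic_intros) auto
  have F_K: "F \<tau> = K (nome \<tau>)" if "0 < Im \<tau>" for \<tau>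
  proof -
    have "nome \<tau> ^ (3 * m) = nome \<tau> ^ k * nome \<tau> ^ (3 * m - k)"
      using order by (simp flip: power_add)
    then show ?thesis
      unfolding F_def K_def cusp(1)[OF that] d(3)[OF that] power_mult_distrib power_mult[symmetric]
      by (simp add: mult.commute[of m])
  qed
  define M where "M = norm (F \<tau>\<^sub>0)"
  have M: "M > 0" unfolding M_def F_def using nz theta_product_nonzero[OF \<tau>0] by simp
  have "isCont K 0" unfolding K_def using cusp(2) d by (intro continuous_intros) auto
  moreover have "K 0 = 0" using order by (simp add: K_def)
  ultimately have "((\<lambda>x. norm (K x)) \<longlongrightarrow> 0) (nhds 0)"
    by (metis continuous_at norm_zero tendsto_at_iff_tendsto_nhds tendsto_norm)
  then have "\<forall>\<^sub>F x in nhds 0. norm (K x) < M"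
    using M by (rule order_tendstoD(2))
  then obtain Y where Y: "1 / 6 \<le> Y" "\<And>\<tau>. Y \<le> Im \<tau> \<Longrightarrow> norm (K (nome \<tau>)) < M"
    by (rule nome_eventually) blast
  have high: "norm (F \<tau>) < M" if "Y \<le> Im \<tau>" for \<tau>
    using Y(2)[OF that] F_K[of \<tau>] that Y(1) by force
  define R where "R = cbox (Complex (- 1 / 2) (1 / 6)) (Complex (1 / 2) Y)"
  have R: "\<tau> \<in> R \<longleftrightarrow> \<bar>Re \<tau>\<bar> \<le> 1 / 2 \<and> 1 / 6 \<le> Im \<tau> \<and> Im \<tau> \<le> Y" for \<tau>
    by (auto simp: R_def in_cbox_complex_iff abs_le_iff)
  have "continuous_on R (\<lambda>\<tau>. norm (F \<tau>))"
    by (intro continuous_intros holomorphic_on_imp_continuous_on holomorphic_on_subset[OF F_hol])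
       (auto simp: R)
  moreover have "compact R" "R \<noteq> {}"
    using R[of "Complex 0 (1 / 6)"] Y(1) by (auto simp: R_def)
  ultimately obtain \<sigma> where \<sigma>: "\<sigma> \<in> R" "\<And>\<tau>. \<tau> \<in> R \<Longrightarrow> norm (F \<tau>) \<le> norm (F \<sigma>)"
    using continuous_attains_sup[of R "\<lambda>\<tau>. norm (F \<tau>)"] by blast
  have inv1: "norm (F (\<tau> + 1)) = norm (F \<tau>)" if "0 < Im \<tau>" for \<tau>
    unfolding F_def norm_divide norm_power translate[OF that] norm_theta_product_plus_one[OF that] ..
  have inv2: "norm (F (fricke \<tau>)) = norm (F \<tau>)" if "0 < Im \<tau>" for \<tau>
  proof -
    have "\<tau> \<noteq> 0" using that by auto
    then show ?thesis
      unfolding F_def norm_divide norm_power fricke[OF that] norm_theta_product_fricke[OF that]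
        power_mult_distrib power_mult[symmetric] mult.commute[of k 3]
      by simp
  qed
  have bound: "norm (F \<tau>) < M \<or> norm (F \<tau>) \<le> norm (F \<sigma>)" if "0 < Im \<tau>" for \<tau>
    using that
  proof (induction \<tau> rule: fricke_group_induct)
    case (strip \<tau>)
    then show ?case using high[of \<tau>] \<sigma>(2)[of \<tau>] R[of \<tau>] by linarith
  qed (simp_all only: inv1 inv2)
  have "M \<le> norm (F \<sigma>)" using bound[OF \<tau>0] by (simp add: M_def)
  then have max: "norm (F \<tau>) \<le> norm (F \<sigma>)" if "0 < Im \<tau>" for \<tau>
    using bound[OF that] by linarith
  have "F constant_on upper_half_plane"
    by (rule maximum_modulus_principle[OF F_hol open_upper_half_plane connected_upper_half_plane
          open_upper_half_plane, of \<sigma>]) (use max \<sigma>(1) R in auto)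
  moreover have "Y > 0" using Y(1) by simp
  ultimately have "F \<tau>\<^sub>0 = F (Complex 0 Y)"
    unfolding constant_on_def using \<tau>0 by auto
  then show False using high[of "Complex 0 Y"] by (simp add: M_def)
qed

text \<open>
  Holomorphic functions on the half-plane form an integral domain, by the identity theorem.
\<close>

lemma holomorphic_product_zero:
  assumes f: "f holomorphic_on upper_half_plane" and g: "g holomorphic_on upper_half_plane"
    and fg: "\<And>\<tau>. 0 < Im \<tau> \<Longrightarrow> f \<tau> * g \<tau> = 0"
  shows "(\<forall>\<tau>. 0 < Im \<tau> \<longrightarrow> f \<tau> = 0) \<or> (\<forall>\<tau>. 0 < Im \<tau> \<longrightarrow> g \<tau> = 0)"
proof (rule disjCI)
  assume "\<not> (\<forall>\<tau>. 0 < Im \<tau> \<longrightarrow> g \<tau> = 0)"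
  then obtain \<sigma> where \<sigma>: "0 < Im \<sigma>" "g \<sigma> \<noteq> 0" by blast
  define U where "U = {\<tau> \<in> upper_half_plane. g \<tau> \<noteq> 0}"
  have U: "open U"
    using continuous_open_preimage[OF holomorphic_on_imp_continuous_on[OF g] open_upper_half_plane, of "- {0}"]
    by (auto simp: U_def vimage_def Int_def)
  have "f \<tau> = 0" if \<tau>: "0 < Im \<tau>" for \<tau>
  proof (rule analytic_continuation_open[of U upper_half_plane f "\<lambda>_. 0"])
    show "U \<noteq> {}" "U \<subseteq> upper_half_plane" using \<sigma> by (auto simp: U_def)
    show "f z = 0" if "z \<in> U" for z using that fg[of z] by (auto simp: U_def)
  qed (use U f \<tau> open_upper_half_plane connected_upper_half_plane in auto)
  then show "\<forall>\<tau>. 0 < Im \<tau> \<longrightarrow> f \<tau> = 0" by blast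
qed

lemma holomorphic_zero_factor:
  assumes F: "F holomorphic_on ball 0 1" "F 0 = 0"
  obtains h where "h holomorphic_on ball 0 1" "h 0 = deriv F 0" "\<And>x. x \<in> ball 0 1 \<Longrightarrow> F x = x * h x"
proof
  show "(\<lambda>x. if x = 0 then deriv F 0 else (F x - F 0) / (x - 0)) holomorphic_on ball 0 1"
    using F by (intro pole_lemma_open) auto
qed (use F in auto)

lemma
  assumes \<tau>: "0 < Im \<tau>"
  shows theta2_square_translate: "theta2 (\<tau> + 1) ^ 2 = \<i> * theta2 \<tau> ^ 2"
    and theta2_triple_square_translate: "theta2 (3 * (\<tau> + 1)) ^ 2 = - \<i> * theta2 (3 * \<tau>) ^ 2"
    and theta2_product_translate:
      "theta2 (\<tau> + 1) * theta2 (3 * (\<tau> + 1)) = - (theta2 \<tau> * theta2 (3 * \<tau>))"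
proof -
  define n where "n = nome (1 / 4)"
  have n: "n ^ 2 = \<i>" "n ^ 4 = -1" unfolding n_def by (rule nome_quarter_power)+
  have n6: "(n ^ 3) ^ 2 = - \<i>"
  proof -
    have "(n ^ 3) ^ 2 = (n ^ 2) ^ 3" by (simp flip: power_mult)
    then show ?thesis by (simp add: n power3_eq_cube)
  qed
  show "theta2 (\<tau> + 1) ^ 2 = \<i> * theta2 \<tau> ^ 2"
    unfolding theta_translate[OF \<tau>] n_def[symmetric] power_mult_distrib n ..
  show "theta2 (3 * (\<tau> + 1)) ^ 2 = - \<i> * theta2 (3 * \<tau>) ^ 2"
    unfolding theta_translate[OF \<tau>] n_def[symmetric] power_mult_distrib n6 ..
  have "n * n ^ 3 = -1" using n by (simp add: numeral_eq_Suc)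
  then show "theta2 (\<tau> + 1) * theta2 (3 * (\<tau> + 1)) = - (theta2 \<tau> * theta2 (3 * \<tau>))"
    unfolding theta_translate[OF \<tau>] n_def[symmetric]
    by (metis mult.assoc mult.left_commute mult_minus1)
qed

section \<open>Identities of degree 3\<close>

lemma theta_fricke_square:
  assumes \<tau>: "0 < Im \<tau>"
  shows "theta2 (fricke \<tau>) ^ 2 = 3 * (- \<i> * \<tau>) * theta4 (3 * \<tau>) ^ 2"
    "theta3 (fricke \<tau>) ^ 2 = 3 * (- \<i> * \<tau>) * theta3 (3 * \<tau>) ^ 2"
    "theta4 (fricke \<tau>) ^ 2 = 3 * (- \<i> * \<tau>) * theta2 (3 * \<tau>) ^ 2"
    "theta2 (3 * fricke \<tau>) ^ 2 = (- \<i> * \<tau>) * theta4 \<tau> ^ 2"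
    "theta3 (3 * fricke \<tau>) ^ 2 = (- \<i> * \<tau>) * theta3 \<tau> ^ 2"
    "theta4 (3 * fricke \<tau>) ^ 2 = (- \<i> * \<tau>) * theta2 \<tau> ^ 2"
proof -
  have "of_real (sqrt 3) ^ 2 = (3 :: complex)" by (simp flip: of_real_power)
  then show "theta2 (fricke \<tau>) ^ 2 = 3 * (- \<i> * \<tau>) * theta4 (3 * \<tau>) ^ 2"
    "theta3 (fricke \<tau>) ^ 2 = 3 * (- \<i> * \<tau>) * theta3 (3 * \<tau>) ^ 2"
    "theta4 (fricke \<tau>) ^ 2 = 3 * (- \<i> * \<tau>) * theta2 (3 * \<tau>) ^ 2"
    "theta2 (3 * fricke \<tau>) ^ 2 = (- \<i> * \<tau>) * theta4 \<tau> ^ 2"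
    "theta3 (3 * fricke \<tau>) ^ 2 = (- \<i> * \<tau>) * theta3 \<tau> ^ 2"
    "theta4 (3 * fricke \<tau>) ^ 2 = (- \<i> * \<tau>) * theta2 \<tau> ^ 2"
    unfolding theta_fricke[OF \<tau>] power_mult_distrib theta_factor_square by simp_all
qed

lemma cusp_value_zero:
  assumes K: "isCont K 0" and zero: "\<And>\<tau>. 0 < Im \<tau> \<Longrightarrow> K (nome \<tau>) = (0 :: complex)"
  shows "K 0 = 0"
proof -
  have "(\<lambda>n. of_real (exp (- pi) ^ n) :: complex) \<longlonglongrightarrow> of_real 0"
    by (intro tendsto_of_real LIMSEQ_power_zero) simp
  then have "(\<lambda>n. nome (\<i> * of_nat n)) \<longlonglongrightarrow> 0"
    by (simp add: exp_of_nat_mult[symmetric] mult_ac exp_of_real[symmetric])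
  then have "(\<lambda>n. nome (\<i> * of_nat (Suc n))) \<longlonglongrightarrow> 0"
    by (rule LIMSEQ_Suc)
  with K have "(\<lambda>n. K (nome (\<i> * of_nat (Suc n)))) \<longlonglongrightarrow> K 0"
    by (rule isCont_tendsto_compose)
  moreover have "K (nome (\<i> * of_nat (Suc n))) = 0" for n
    by (rule zero) simp
  ultimately show ?thesis by (simp only: LIMSEQ_const_iff)
qed

text \<open>
  The cubic modular equation in its theta form. The difference of both sides has weight 1 and
  changes sign under translation, because \<open>cC\<close> does and \<open>aA, bB\<close> are exchanged; it vanishes at the
  cusp, and \<open>1 < 3 \<sqdot> 1\<close>.
\<close>

theorem theta_bilinear_degree_3:
  assumes "0 < Im \<tau>"
  shows "theta3 \<tau> * theta3 (3 * \<tau>) = theta4 \<tau> * theta4 (3 * \<tau>) + theta2 \<tau> * theta2 (3 * \<tau>)"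
proof -
  define f where "f \<tau> = theta3 \<tau> * theta3 (3 * \<tau>) - theta4 \<tau> * theta4 (3 * \<tau>) - theta2 \<tau> * theta2 (3 * \<tau>)" for \<tau>
  define G where "G x = phi x * phi (x ^ 3) - phi (- x) * phi (- (x ^ 3)) - x * ((2 * psi x) * (2 * psi (x ^ 3)))" for x
  have "G holomorphic_on ball 0 1"
    unfolding G_def by (intro holomorphic_intros nome_series_holomorphic)
  moreover have "G 0 = 0" by (simp add: G_def)
  ultimately obtain h where h: "h holomorphic_on ball 0 1" "\<And>x. x \<in> ball 0 1 \<Longrightarrow> G x = x * h x"
    using holomorphic_zero_factor by metis
  have "f \<tau> = 0"
  proof (rule fricke_weight_vanishing[where f = f and k = 1 and m = 1 and h = h])
    show "f holomorphic_on upper_half_plane"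
      unfolding f_def by (intro holomorphic_intros theta_holomorphic)
    show "norm (f (\<tau> + 1)) = norm (f \<tau>)" if "0 < Im \<tau>" for \<tau>
    proof -
      have "f (\<tau> + 1) = - f \<tau>"
        unfolding f_def theta2_product_translate[OF that] theta3_plus_one[OF that]
          theta4_plus_one[OF that] theta3_triple_plus_one[OF that] theta4_triple_plus_one[OF that]
        by simp
      then show ?thesis by simp
    qed
    show "norm (f (fricke \<tau>)) = (sqrt 3 * norm \<tau>) ^ 1 * norm (f \<tau>)" if "0 < Im \<tau>" for \<tau>
    proof -
      have "f (fricke \<tau>) = of_real (sqrt 3) * theta_factor \<tau> ^ 2 * f \<tau>"
        unfolding f_def theta_fricke[OF that] by (simp add: power2_eq_square algebra_simps)
      then show ?thesis by (simp add: theta_factor_square norm_mult)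
    qed
    show "f \<tau> = nome \<tau> ^ 1 * h (nome \<tau>)" if "0 < Im \<tau>" for \<tau>
    proof -
      have "f \<tau> = phi (nome \<tau>) * phi (nome \<tau> ^ 3) - phi (- nome \<tau>) * phi (- (nome \<tau> ^ 3)) -
          (nome (\<tau> / 4) * nome (3 * \<tau> / 4)) * ((2 * psi (nome \<tau>)) * (2 * psi (nome \<tau> ^ 3)))"
        unfolding f_def theta_nome[OF that] by (simp only: mult_ac)
      then have "f \<tau> = G (nome \<tau>)" unfolding nome_split G_def .
      then show ?thesis using h(2)[OF nome_in_ball[OF that]] by (simp only: power_one_right)
    qed
    show "isCont h 0" using h(1) by (rule isCont_0)
  qed (use assms in auto)
  then show ?thesis by (simp add: f_def algebra_simps)
qed

text \<open>
  The involution carries the difference \<open>D\<close> of both sides at \<open>\<tau>\<close> to a multiple of \<open>D\<close> at \<open>3\<tau>\<close>, so the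
  vanishing criterion is applied to the product \<open>D(\<tau>) D(3\<tau>)\<close> of weight 4.
\<close>

theorem jacobi_quartic:
  assumes \<tau>: "0 < Im \<tau>"
  shows "theta3 \<tau> ^ 4 = theta4 \<tau> ^ 4 + theta2 \<tau> ^ 4"
proof -
  define D where "D \<tau> = theta3 \<tau> ^ 4 - theta4 \<tau> ^ 4 - theta2 \<tau> ^ 4" for \<tau>
  have D_hol: "D holomorphic_on upper_half_plane" "(\<lambda>\<tau>. D (3 * \<tau>)) holomorphic_on upper_half_plane"
    unfolding D_def by (intro holomorphic_intros theta_holomorphic)+
  define G where "G x = phi x ^ 4 - phi (- x) ^ 4 - x * (2 * psi x) ^ 4" for x
  have "G holomorphic_on ball 0 1"
    unfolding G_def by (intro holomorphic_intros nome_series_holomorphic)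
  moreover have "G 0 = 0" by (simp add: G_def)
  ultimately obtain h where h: "h holomorphic_on ball 0 1" "\<And>x. x \<in> ball 0 1 \<Longrightarrow> G x = x * h x"
    using holomorphic_zero_factor by metis
  have D_h: "D \<tau> = nome \<tau> * h (nome \<tau>)" if "0 < Im \<tau>" for \<tau>
  proof -
    have "nome (\<tau> / 4) ^ 4 = nome \<tau>" unfolding nome_power by simp
    then have "D \<tau> = G (nome \<tau>)"
      unfolding D_def theta2_nome[OF that] theta3_nome[OF that] theta4_nome[OF that] G_def power_mult_distrib by (simp only:)
    then show ?thesis using h(2)[OF nome_in_ball[OF that]] by (simp only:)
  qed
  have D_translate: "D (\<tau> + 1) = - D \<tau>" if "0 < Im \<tau>" for \<tau>
    unfolding D_def theta2_plus_one[OF that] theta3_plus_one[OF that] theta4_plus_one[OF that]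
      power_mult_distrib nome_quarter_power by simp
  have "D \<tau> * D (3 * \<tau>) = 0" if \<tau>: "0 < Im \<tau>" for \<tau>
  proof (rule fricke_weight_vanishing[where f = "\<lambda>\<tau>. D \<tau> * D (3 * \<tau>)" and k = 4 and m = 2 and h = "\<lambda>x. x ^ 2 * (h x * h (x ^ 3))"])
    show "(\<lambda>\<tau>. D \<tau> * D (3 * \<tau>)) holomorphic_on upper_half_plane"
      using D_hol by (intro holomorphic_intros)
    show "norm (D (\<tau> + 1) * D (3 * (\<tau> + 1))) = norm (D \<tau> * D (3 * \<tau>))" if "0 < Im \<tau>" for \<tau>
    proof -
      have "3 * (\<tau> + 1) = 3 * \<tau> + 1 + 1 + 1" by simp
      moreover have "D (3 * \<tau> + 1 + 1 + 1) = - D (3 * \<tau>)"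
        using D_translate[of "3 * \<tau>"] D_translate[of "3 * \<tau> + 1"] D_translate[of "3 * \<tau> + 1 + 1"] that
        by simp
      ultimately show ?thesis by (simp only: D_translate[OF that] norm_mult norm_minus_cancel)
    qed
    show "norm (D (fricke \<tau>) * D (3 * fricke \<tau>)) = (sqrt 3 * norm \<tau>) ^ 4 * norm (D \<tau> * D (3 * \<tau>))"
      if "0 < Im \<tau>" for \<tau>
    proof -
      have "D (fricke \<tau>) * D (3 * fricke \<tau>) = 9 * \<tau> ^ 4 * (D \<tau> * D (3 * \<tau>))"
        unfolding D_def power4_eq_xxxx power2_eq_square[symmetric] mult.assoc
        unfolding mult.assoc[symmetric] power2_eq_square[symmetric]
        using theta_fricke_square[OF that] by (simp add: power4_eq_xxxx power2_eq_square algebra_simps)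
      moreover have "(sqrt 3) ^ 4 = 9" by (simp add: power4_eq_xxxx)
      ultimately show ?thesis by (simp add: norm_mult norm_power power_mult_distrib)
    qed
    show "D \<tau> * D (3 * \<tau>) = nome \<tau> ^ 2 * (nome \<tau> ^ 2 * (h (nome \<tau>) * h (nome \<tau> ^ 3)))" if "0 < Im \<tau>" for \<tau>
    proof -
      have "D (3 * \<tau>) = nome \<tau> ^ 3 * h (nome \<tau> ^ 3)"
        unfolding nome_power using D_h[of "3 * \<tau>"] that by simp
      then show ?thesis unfolding D_h[OF that] by (simp only: power2_eq_square power3_eq_cube mult_ac)
    qed
    show "isCont (\<lambda>x. x ^ 2 * (h x * h (x ^ 3))) 0"
      using h(1) by (intro isCont_0 holomorphic_intros holomorphic_cube_compose)
  qed (use \<tau> in auto)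
  then have "(\<forall>\<tau>. 0 < Im \<tau> \<longrightarrow> D \<tau> = 0) \<or> (\<forall>\<tau>. 0 < Im \<tau> \<longrightarrow> D (3 * \<tau>) = 0)"
    by (rule holomorphic_product_zero[OF D_hol])
  then have "D \<tau> = 0"
  proof
    assume "\<forall>\<tau>. 0 < Im \<tau> \<longrightarrow> D (3 * \<tau>) = 0"
    from this[rule_format, of "\<tau> / 3"] show ?thesis using \<tau> by simp
  qed (use \<tau> in auto)
  then show ?thesis by (simp add: D_def algebra_simps)
qed

text \<open>
  The expressions \<open>f1\<close> and \<open>f2\<close>, the differences of both sides, and \<open>f3\<close>, the translate of \<open>f2\<close>, are
  permuted by the generators up to elementary factors: translation fixes \<open>f1\<close> and exchanges \<open>f2, f3\<close>, the involution exchanges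
  \<open>f1, f2\<close> and fixes \<open>f3\<close>. Hence their product has weight 6. Each factor is small at the cusp, so the
  product is zero. One factor then vanishes identically, and with it all three.
\<close>

lemma
  assumes "0 < Im \<tau>"
  shows theta34_degree_3: "theta4 (3 * \<tau>) ^ 2 * (3 * theta3 (3 * \<tau>) ^ 2 - theta3 \<tau> ^ 2)
            = theta4 \<tau> ^ 2 * (theta3 (3 * \<tau>) ^ 2 + theta3 \<tau> ^ 2)"
    and theta23_degree_3: "theta2 \<tau> ^ 2 * (theta3 \<tau> ^ 2 - theta3 (3 * \<tau>) ^ 2)
            = theta2 (3 * \<tau>) ^ 2 * (theta3 \<tau> ^ 2 + 3 * theta3 (3 * \<tau>) ^ 2)"
proof -
  define f1 where "f1 \<tau> = 3 * theta3 (3 * \<tau>) ^ 2 * theta4 (3 * \<tau>) ^ 2 - theta3 \<tau> ^ 2 * theta4 (3 * \<tau>) ^ 2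
      - theta3 (3 * \<tau>) ^ 2 * theta4 \<tau> ^ 2 - theta3 \<tau> ^ 2 * theta4 \<tau> ^ 2" for \<tau>
  define f2 where "f2 \<tau> = theta2 \<tau> ^ 2 * (theta3 \<tau> ^ 2 - theta3 (3 * \<tau>) ^ 2)
      - theta2 (3 * \<tau>) ^ 2 * (theta3 \<tau> ^ 2 + 3 * theta3 (3 * \<tau>) ^ 2)" for \<tau>
  define f3 where "f3 \<tau> = theta2 \<tau> ^ 2 * (theta4 \<tau> ^ 2 - theta4 (3 * \<tau>) ^ 2)
      + theta2 (3 * \<tau>) ^ 2 * (theta4 \<tau> ^ 2 + 3 * theta4 (3 * \<tau>) ^ 2)" for \<tau>
  have hol: "f1 holomorphic_on upper_half_plane" "f2 holomorphic_on upper_half_plane"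
      "f3 holomorphic_on upper_half_plane"
    unfolding f1_def f2_def f3_def by (intro holomorphic_intros theta_holomorphic)+
  have translate: "f1 (\<tau> + 1) = f1 \<tau>" "f2 (\<tau> + 1) = \<i> * f3 \<tau>" "f3 (\<tau> + 1) = \<i> * f2 \<tau>"
    if "0 < Im \<tau>" for \<tau>
    unfolding f1_def f2_def f3_def theta2_square_translate[OF that] theta2_triple_square_translate[OF that]
      theta3_plus_one[OF that] theta4_plus_one[OF that] theta3_triple_plus_one[OF that]
      theta4_triple_plus_one[OF that] by (simp_all add: algebra_simps)
  have fricke: "f1 (fricke \<tau>) = - 3 * \<tau> ^ 2 * f2 \<tau>" "f2 (fricke \<tau>) = - 3 * \<tau> ^ 2 * f1 \<tau>"
      "f3 (fricke \<tau>) = - 3 * \<tau> ^ 2 * f3 \<tau>"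
    if "0 < Im \<tau>" for \<tau>
    unfolding f1_def f2_def f3_def theta_fricke_square[OF that]
    by (simp_all add: power2_eq_square algebra_simps)
  define G1 where "G1 x = 3 * phi (x ^ 3) ^ 2 * phi (- (x ^ 3)) ^ 2 - phi x ^ 2 * phi (- (x ^ 3)) ^ 2
      - phi (x ^ 3) ^ 2 * phi (- x) ^ 2 - phi x ^ 2 * phi (- x) ^ 2" for x
  define G2 where "G2 x = (2 * psi x) ^ 2 * (phi x ^ 2 - phi (x ^ 3) ^ 2)
      - x * (2 * psi (x ^ 3)) ^ 2 * (phi x ^ 2 + 3 * phi (x ^ 3) ^ 2)" for x
  define G3 where "G3 x = (2 * psi x) ^ 2 * (phi (- x) ^ 2 - phi (- (x ^ 3)) ^ 2)
      + x * (2 * psi (x ^ 3)) ^ 2 * (phi (- x) ^ 2 + 3 * phi (- (x ^ 3)) ^ 2)" for x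
  have "G1 holomorphic_on ball 0 1" "G2 holomorphic_on ball 0 1" "G3 holomorphic_on ball 0 1"
    unfolding G1_def G2_def G3_def by (intro holomorphic_intros nome_series_holomorphic)+
  moreover have "G1 0 = 0" "G2 0 = 0" "G3 0 = 0" by (simp_all add: G1_def G2_def G3_def)
  ultimately obtain h1 h2 h3 where
      h: "h1 holomorphic_on ball 0 1" "h2 holomorphic_on ball 0 1" "h3 holomorphic_on ball 0 1"
    and Gh: "\<And>x. x \<in> ball 0 1 \<Longrightarrow> G1 x = x * h1 x" "\<And>x. x \<in> ball 0 1 \<Longrightarrow> G2 x = x * h2 x"
      "\<And>x. x \<in> ball 0 1 \<Longrightarrow> G3 x = x * h3 x"
    using holomorphic_zero_factor[of G1] holomorphic_zero_factor[of G2] holomorphic_zero_factor[of G3] by metis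
  have "f1 \<tau> * (f2 \<tau> * f3 \<tau>) = 0" if \<tau>: "0 < Im \<tau>" for \<tau>
  proof (rule fricke_weight_vanishing[where f = "\<lambda>\<tau>. f1 \<tau> * (f2 \<tau> * f3 \<tau>)" and k = 6 and m = 4 and h = "\<lambda>x. h1 x * h2 x * h3 x"])
    show "(\<lambda>\<tau>. f1 \<tau> * (f2 \<tau> * f3 \<tau>)) holomorphic_on upper_half_plane"
      using hol by (intro holomorphic_intros)
    show "norm (f1 (\<tau> + 1) * (f2 (\<tau> + 1) * f3 (\<tau> + 1))) = norm (f1 \<tau> * (f2 \<tau> * f3 \<tau>))" if "0 < Im \<tau>" for \<tau>
      unfolding translate[OF that] by (simp add: norm_mult)
    show "norm (f1 (fricke \<tau>) * (f2 (fricke \<tau>) * f3 (fricke \<tau>))) = (sqrt 3 * norm \<tau>) ^ 6 * norm (f1 \<tau> * (f2 \<tau> * f3 \<tau>))"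
      if "0 < Im \<tau>" for \<tau>
    proof -
      have "(sqrt 3) ^ 6 = ((sqrt 3) ^ 2) ^ 3" by (simp only: power_mult[symmetric]) simp
      then have "(sqrt 3) ^ 6 = 27" by simp
      then show ?thesis
        unfolding fricke[OF that] norm_mult norm_power power_mult_distrib by (simp add: norm_power power2_eq_square numeral_eq_Suc)
    qed
    show "f1 \<tau> * (f2 \<tau> * f3 \<tau>) = nome \<tau> ^ 4 * (h1 (nome \<tau>) * h2 (nome \<tau>) * h3 (nome \<tau>))" if "0 < Im \<tau>" for \<tau>
    proof -
      define p where "p = nome (\<tau> / 4) ^ 2"
      have p: "p ^ 2 = nome \<tau>" unfolding p_def nome_power by simp
      have p3: "nome (3 * \<tau> / 4) ^ 2 = p * nome \<tau>"
        unfolding p_def nome_power exp_add[symmetric] by (rule arg_cong[of _ _ exp]) (simp add: algebra_simps)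
      note G = Gh[OF nome_in_ball[OF that]]
      have "f1 \<tau> = nome \<tau> * h1 (nome \<tau>)"
        unfolding G[symmetric] f1_def G1_def theta_nome[OF that] ..
      moreover have "f2 \<tau> = p * (nome \<tau> * h2 (nome \<tau>))" "f3 \<tau> = p * (nome \<tau> * h3 (nome \<tau>))"
        unfolding G[symmetric] f2_def G2_def f3_def G3_def theta_nome[OF that]
          power_mult_distrib[of "nome (\<tau> / 4)"] power_mult_distrib[of "nome (3 * \<tau> / 4)"] p_def[symmetric] p3
        by (simp_all add: algebra_simps)
      moreover have "nome \<tau> ^ 4 = p ^ 2 * nome \<tau> ^ 3" unfolding p by (simp only: power_Suc[symmetric]) simp
      ultimately show ?thesis by (simp only: power2_eq_square power3_eq_cube mult_ac)
    qed
    show "isCont (\<lambda>x. h1 x * h2 x * h3 x) 0"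
      using h by (intro isCont_0 holomorphic_intros)
  qed (use \<tau> in auto)
  then have "(\<forall>\<tau>. 0 < Im \<tau> \<longrightarrow> f1 \<tau> = 0) \<or> (\<forall>\<tau>. 0 < Im \<tau> \<longrightarrow> f2 \<tau> * f3 \<tau> = 0)"
    using hol by (intro holomorphic_product_zero holomorphic_intros)
  then have "(\<forall>\<tau>. 0 < Im \<tau> \<longrightarrow> f1 \<tau> = 0) \<or> (\<forall>\<tau>. 0 < Im \<tau> \<longrightarrow> f2 \<tau> = 0) \<or> (\<forall>\<tau>. 0 < Im \<tau> \<longrightarrow> f3 \<tau> = 0)"
    using holomorphic_product_zero[OF hol(2,3)] by blast
  moreover have "f2 \<tau> = 0" if "\<And>\<tau>. 0 < Im \<tau> \<Longrightarrow> f3 \<tau> = 0" "0 < Im \<tau>" for \<tau>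
    using translate(3)[OF that(2)] that(1)[of "\<tau> + 1"] that(2) by simp
  moreover have "f1 \<tau> = 0" if "\<And>\<tau>. 0 < Im \<tau> \<Longrightarrow> f2 \<tau> = 0" "0 < Im \<tau>" for \<tau>
    using fricke(2)[OF that(2)] that(1)[OF Im_fricke_pos[OF that(2)]] that(2) by auto
  moreover have "f2 \<tau> = 0" if "\<And>\<tau>. 0 < Im \<tau> \<Longrightarrow> f1 \<tau> = 0" "0 < Im \<tau>" for \<tau>
    using fricke(1)[OF that(2)] that(1)[OF Im_fricke_pos[OF that(2)]] that(2) by auto
  ultimately have "f1 \<tau> = 0" "f2 \<tau> = 0"
    using assms by blast+
  then show "theta4 (3 * \<tau>) ^ 2 * (3 * theta3 (3 * \<tau>) ^ 2 - theta3 \<tau> ^ 2)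
            = theta4 \<tau> ^ 2 * (theta3 (3 * \<tau>) ^ 2 + theta3 \<tau> ^ 2)"
    and "theta2 \<tau> ^ 2 * (theta3 \<tau> ^ 2 - theta3 (3 * \<tau>) ^ 2)
            = theta2 (3 * \<tau>) ^ 2 * (theta3 \<tau> ^ 2 + 3 * theta3 (3 * \<tau>) ^ 2)"
    by (simp_all add: f1_def f2_def algebra_simps)
qed

text \<open>
  If one of these vanished, the quadratic relations would force a theta constant to vanish. In terms
  of \<open>z\<close> this says that \<open>z\<close> avoids \<open>-1, 1, 3, -3\<close>.
\<close>

lemma theta_degree_3_nonzero:
  assumes \<tau>: "0 < Im \<tau>"
  shows "theta3 (3 * \<tau>) ^ 2 + theta3 \<tau> ^ 2 \<noteq> 0" "3 * theta3 (3 * \<tau>) ^ 2 - theta3 \<tau> ^ 2 \<noteq> 0"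
    "theta3 \<tau> ^ 2 - theta3 (3 * \<tau>) ^ 2 \<noteq> 0" "theta3 \<tau> ^ 2 + 3 * theta3 (3 * \<tau>) ^ 2 \<noteq> 0"
proof -
  define a b c A B C where "a = theta3 \<tau> ^ 2" "b = theta4 \<tau> ^ 2" "c = theta2 \<tau> ^ 2"
    "A = theta3 (3 * \<tau>) ^ 2" "B = theta4 (3 * \<tau>) ^ 2" "C = theta2 (3 * \<tau>) ^ 2"
  note defs = this
  have nz: "a \<noteq> 0" "b \<noteq> 0" "c \<noteq> 0" "A \<noteq> 0" "B \<noteq> 0" "C \<noteq> 0"
    unfolding defs using theta_nonzero[OF \<tau>] by simp_all
  have 1: "B * (3 * A - a) = b * (A + a)" unfolding defs by (rule theta34_degree_3[OF \<tau>])
  have 2: "c * (a - A) = C * (a + 3 * A)" unfolding defs by (rule theta23_degree_3[OF \<tau>])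
  have "A + a \<noteq> 0"
  proof
    assume "A + a = 0"
    then have "a = - A" by (simp add: eq_neg_iff_add_eq_0 add.commute)
    with 1 nz show False by simp
  qed
  moreover have "3 * A - a \<noteq> 0"
  proof
    assume "3 * A - a = 0"
    then have "a = 3 * A" by simp
    with 1 nz show False by simp
  qed
  moreover have "a - A \<noteq> 0"
  proof
    assume "a - A = 0"
    then have "a = A" by simp
    with 2 nz show False by simp
  qed
  moreover have "a + 3 * A \<noteq> 0"
  proof
    assume "a + 3 * A = 0"
    then have "a = - 3 * A" by (simp add: eq_neg_iff_add_eq_0)
    with 2 nz show False by simp
  qed
  ultimately show "theta3 (3 * \<tau>) ^ 2 + theta3 \<tau> ^ 2 \<noteq> 0" "3 * theta3 (3 * \<tau>) ^ 2 - theta3 \<tau> ^ 2 \<noteq> 0"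
    "theta3 \<tau> ^ 2 - theta3 (3 * \<tau>) ^ 2 \<noteq> 0" "theta3 \<tau> ^ 2 + 3 * theta3 (3 * \<tau>) ^ 2 \<noteq> 0"
    unfolding defs by blast+
qed

text \<open>
  For given \<open>a\<close> and \<open>A\<close> the hypotheses amount to a quadratic equation for \<open>u = bB\<close>: the last two
  express \<open>b\<^sup>4\<close> and \<open>c\<^sup>4\<close> through \<open>u\<^sup>2\<close> and \<open>(cC)\<^sup>2 = (aA - u)\<^sup>2\<close>, and \<open>a\<^sup>4 = b\<^sup>4 + c\<^sup>4\<close> relates these. Its
  roots are rational in \<open>a\<close> and \<open>A\<close>, and the conclusion states its factorization.
\<close>

lemma degree_3_quadratic:
  fixes a b c A B C :: complex
  assumes bilinear: "a * A = b * B + c * C" and quartic: "a ^ 4 = b ^ 4 + c ^ 4"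
    and 1: "B ^ 2 * (3 * A ^ 2 - a ^ 2) = b ^ 2 * (A ^ 2 + a ^ 2)"
    and 2: "c ^ 2 * (a ^ 2 - A ^ 2) = C ^ 2 * (a ^ 2 + 3 * A ^ 2)"
    and a: "a \<noteq> 0"
  shows "(4 * a * A * b * B - (A ^ 2 + a ^ 2) * (3 * A ^ 2 - a ^ 2)) * (2 * A * b * B - a * (a ^ 2 + A ^ 2)) = 0"
proof -
  define u where "u = b * B"
  have w: "c * C = a * A - u" using bilinear by (simp add: u_def)
  have b4: "b ^ 4 * (A ^ 2 + a ^ 2) = u ^ 2 * (3 * A ^ 2 - a ^ 2)"
  proof -
    have "b ^ 4 * (A ^ 2 + a ^ 2) = b ^ 2 * (b ^ 2 * (A ^ 2 + a ^ 2))" by (simp add: power4_eq_xxxx power2_eq_square)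
    also have "\<dots> = b ^ 2 * (B ^ 2 * (3 * A ^ 2 - a ^ 2))" by (simp only: 1)
    finally show ?thesis by (simp add: u_def power_mult_distrib)
  qed
  have c4: "c ^ 4 * (a ^ 2 - A ^ 2) = (a * A - u) ^ 2 * (a ^ 2 + 3 * A ^ 2)"
  proof -
    have "c ^ 4 * (a ^ 2 - A ^ 2) = c ^ 2 * (c ^ 2 * (a ^ 2 - A ^ 2))" by (simp add: power4_eq_xxxx power2_eq_square)
    also have "\<dots> = c ^ 2 * (C ^ 2 * (a ^ 2 + 3 * A ^ 2))" by (simp only: 2)
    finally show ?thesis by (simp add: w[symmetric] power_mult_distrib)
  qed
  have "a ^ 4 * (A ^ 2 + a ^ 2) * (a ^ 2 - A ^ 2)
      = (b ^ 4 * (A ^ 2 + a ^ 2)) * (a ^ 2 - A ^ 2) + (c ^ 4 * (a ^ 2 - A ^ 2)) * (A ^ 2 + a ^ 2)"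
    unfolding quartic by (simp add: algebra_simps)
  also have "\<dots> = (u ^ 2 * (3 * A ^ 2 - a ^ 2)) * (a ^ 2 - A ^ 2) + ((a * A - u) ^ 2 * (a ^ 2 + 3 * A ^ 2)) * (A ^ 2 + a ^ 2)"
    by (simp only: b4 c4)
  finally have "a * ((4 * a * A * u - (A ^ 2 + a ^ 2) * (3 * A ^ 2 - a ^ 2)) * (2 * A * u - a * (a ^ 2 + A ^ 2))) = 0"
    by algebra
  then show ?thesis using a by (simp add: u_def mult.assoc)
qed

text \<open>
  By analyticity \<open>bB\<close> is the same root of the quadratic throughout the half-plane. The other root is
  excluded at the cusp after an application of the involution: the equation \<open>g = 0\<close> turns into
  \<open>2acC = A(3A\<^sup>2 + a\<^sup>2)\<close>, whose sides tend to 0 and 4.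
\<close>

theorem theta34_product_degree_3:
  assumes \<tau>: "0 < Im \<tau>"
  shows "4 * theta3 \<tau> * theta3 (3 * \<tau>) * theta4 \<tau> * theta4 (3 * \<tau>)
       = (theta3 (3 * \<tau>) ^ 2 + theta3 \<tau> ^ 2) * (3 * theta3 (3 * \<tau>) ^ 2 - theta3 \<tau> ^ 2)"
proof -
  define f where "f \<tau> = 4 * theta3 \<tau> * theta3 (3 * \<tau>) * theta4 \<tau> * theta4 (3 * \<tau>)
       - (theta3 (3 * \<tau>) ^ 2 + theta3 \<tau> ^ 2) * (3 * theta3 (3 * \<tau>) ^ 2 - theta3 \<tau> ^ 2)" for \<tau>
  define g where "g \<tau> = 2 * theta3 (3 * \<tau>) * theta4 \<tau> * theta4 (3 * \<tau>)
       - theta3 \<tau> * (theta3 \<tau> ^ 2 + theta3 (3 * \<tau>) ^ 2)" for \<tau>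
  have "f \<tau> * g \<tau> = 0" if "0 < Im \<tau>" for \<tau>
    unfolding f_def g_def
    by (rule degree_3_quadratic theta_bilinear_degree_3 jacobi_quartic theta34_degree_3 theta23_degree_3
        theta_nonzero that)+
  then have "(\<forall>\<tau>. 0 < Im \<tau> \<longrightarrow> f \<tau> = 0) \<or> (\<forall>\<tau>. 0 < Im \<tau> \<longrightarrow> g \<tau> = 0)"
    by (intro holomorphic_product_zero) (auto simp: f_def g_def intro!: holomorphic_intros theta_holomorphic)
  moreover have "\<not> (\<forall>\<tau>. 0 < Im \<tau> \<longrightarrow> g \<tau> = 0)"
  proof
    assume g: "\<forall>\<tau>. 0 < Im \<tau> \<longrightarrow> g \<tau> = 0"
    define K where "K x = 2 * phi x * (x * ((2 * psi x) * (2 * psi (x ^ 3))))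
      - phi (x ^ 3) * (3 * phi (x ^ 3) ^ 2 + phi x ^ 2)" for x
    have "K 0 = 0"
    proof (rule cusp_value_zero)
      show "isCont K 0"
        unfolding K_def by (intro isCont_0 holomorphic_intros nome_series_holomorphic)
      show "K (nome \<tau>) = 0" if \<tau>: "0 < Im \<tau>" for \<tau>
      proof -
        have s3: "of_real (sqrt 3) ^ 2 = (3 :: complex)" by (simp flip: of_real_power)
        have "g (fricke \<tau>) = of_real (sqrt 3) * theta_factor \<tau> ^ 3 *
            (2 * theta3 \<tau> * (theta2 \<tau> * theta2 (3 * \<tau>)) - theta3 (3 * \<tau>) * (3 * theta3 (3 * \<tau>) ^ 2 + theta3 \<tau> ^ 2))"
          unfolding g_def theta_fricke[OF \<tau>] power_mult_distrib s3
          by (simp add: power2_eq_square power3_eq_cube algebra_simps)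
        moreover have "g (fricke \<tau>) = 0" using g Im_fricke_pos[OF \<tau>] by blast
        ultimately have "2 * theta3 \<tau> * (theta2 \<tau> * theta2 (3 * \<tau>)) - theta3 (3 * \<tau>) * (3 * theta3 (3 * \<tau>) ^ 2 + theta3 \<tau> ^ 2) = 0"
          using theta_factor_nonzero[OF \<tau>] by simp
        moreover have "theta2 \<tau> * theta2 (3 * \<tau>) = (nome (\<tau> / 4) * nome (3 * \<tau> / 4)) * ((2 * psi (nome \<tau>)) * (2 * psi (nome \<tau> ^ 3)))"
          unfolding theta_nome[OF \<tau>] by (simp only: mult_ac)
        ultimately show ?thesis
          unfolding nome_split K_def theta3_nome[OF \<tau>] theta3_triple_nome[OF \<tau>] by (simp only:)
      qed
    qed
    then show False by (simp add: K_def)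
  qed
  ultimately have "f \<tau> = 0" using \<tau> by blast
  then show ?thesis by (simp add: f_def)
qed

text \<open>
  The right-hand sides of this identity and of the preceding one add up to \<open>4a\<^sup>2A\<^sup>2\<close>, and \<open>aA = bB + cC\<close>.
\<close>

theorem theta23_product_degree_3:
  assumes \<tau>: "0 < Im \<tau>"
  shows "4 * theta3 \<tau> * theta3 (3 * \<tau>) * theta2 \<tau> * theta2 (3 * \<tau>)
       = (theta3 \<tau> ^ 2 + 3 * theta3 (3 * \<tau>) ^ 2) * (theta3 \<tau> ^ 2 - theta3 (3 * \<tau>) ^ 2)"
  using theta34_product_degree_3[OF \<tau>] theta_bilinear_degree_3[OF \<tau>] by algebra

text \<open>
  Squaring the first relation gives \<open>b\<^sup>2B\<^sup>2\<close>, and the second one trades \<open>B\<^sup>2\<close> for \<open>b\<^sup>2\<close>.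
\<close>

lemma quartic_from_product:
  fixes a b A B :: complex
  assumes "4 * a * A * b * B = P * Q" "B ^ 2 * Q = b ^ 2 * P" "P \<noteq> 0"
  shows "16 * a ^ 2 * A ^ 2 * b ^ 4 = P * Q ^ 3"
proof -
  have "P * (16 * a ^ 2 * A ^ 2 * b ^ 4) = P * (P * Q ^ 3)"
    using assms(1,2) by algebra
  then show ?thesis using assms(3) by simp
qed

lemma theta_quartic_degree_3:
  assumes \<tau>: "0 < Im \<tau>"
  shows "16 * theta3 \<tau> ^ 2 * theta3 (3 * \<tau>) ^ 2 * theta4 \<tau> ^ 4
      = (theta3 (3 * \<tau>) ^ 2 + theta3 \<tau> ^ 2) * (3 * theta3 (3 * \<tau>) ^ 2 - theta3 \<tau> ^ 2) ^ 3"
    and "16 * theta3 \<tau> ^ 2 * theta3 (3 * \<tau>) ^ 2 * theta4 (3 * \<tau>) ^ 4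
      = (3 * theta3 (3 * \<tau>) ^ 2 - theta3 \<tau> ^ 2) * (theta3 (3 * \<tau>) ^ 2 + theta3 \<tau> ^ 2) ^ 3"
    and "16 * theta3 \<tau> ^ 2 * theta3 (3 * \<tau>) ^ 2 * theta2 \<tau> ^ 4
      = (theta3 \<tau> ^ 2 - theta3 (3 * \<tau>) ^ 2) * (theta3 \<tau> ^ 2 + 3 * theta3 (3 * \<tau>) ^ 2) ^ 3"
proof -
  show "16 * theta3 \<tau> ^ 2 * theta3 (3 * \<tau>) ^ 2 * theta4 \<tau> ^ 4
      = (theta3 (3 * \<tau>) ^ 2 + theta3 \<tau> ^ 2) * (3 * theta3 (3 * \<tau>) ^ 2 - theta3 \<tau> ^ 2) ^ 3"
    by (rule quartic_from_product[OF theta34_product_degree_3[OF \<tau>] theta34_degree_3[OF \<tau>]])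
       (rule theta_degree_3_nonzero[OF \<tau>])
  show "16 * theta3 \<tau> ^ 2 * theta3 (3 * \<tau>) ^ 2 * theta4 (3 * \<tau>) ^ 4
      = (3 * theta3 (3 * \<tau>) ^ 2 - theta3 \<tau> ^ 2) * (theta3 (3 * \<tau>) ^ 2 + theta3 \<tau> ^ 2) ^ 3"
    by (rule quartic_from_product[where B = "theta4 \<tau>"])
       (use theta34_product_degree_3[OF \<tau>] theta34_degree_3[OF \<tau>] theta_degree_3_nonzero[OF \<tau>]
        in \<open>simp_all only: mult_ac not_False_eq_True\<close>)
  show "16 * theta3 \<tau> ^ 2 * theta3 (3 * \<tau>) ^ 2 * theta2 \<tau> ^ 4
      = (theta3 \<tau> ^ 2 - theta3 (3 * \<tau>) ^ 2) * (theta3 \<tau> ^ 2 + 3 * theta3 (3 * \<tau>) ^ 2) ^ 3"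
    by (rule quartic_from_product[where B = "theta2 (3 * \<tau>)"])
       (use theta23_product_degree_3[OF \<tau>] theta23_degree_3[OF \<tau>] theta_degree_3_nonzero[OF \<tau>]
        in \<open>simp_all only: mult_ac not_False_eq_True\<close>)
qed

section \<open>The derivative of the quotient of theta constants\<close>

definition logderiv :: "(complex \<Rightarrow> complex) \<Rightarrow> complex \<Rightarrow> complex" where
  "logderiv f \<tau> = deriv f \<tau> / f \<tau>"

lemma has_derivative_upper_half_plane:
  "f holomorphic_on upper_half_plane \<Longrightarrow> 0 < Im \<tau> \<Longrightarrow> (f has_field_derivative deriv f \<tau>) (at \<tau>)"
  using holomorphic_derivI[OF _ open_upper_half_plane] by simp

lemma logderiv_translate:
  assumes f: "f holomorphic_on upper_half_plane" and g: "g holomorphic_on upper_half_plane"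
    and fg: "\<And>\<tau>. 0 < Im \<tau> \<Longrightarrow> f (\<tau> + 1) = k * g \<tau>" and k: "k \<noteq> 0" and \<tau>: "0 < Im \<tau>"
  shows "logderiv f (\<tau> + 1) = logderiv g \<tau>"
proof -
  have "(f has_field_derivative deriv f (\<tau> + 1)) (at (\<tau> + 1))"
    using f by (rule has_derivative_upper_half_plane) (use \<tau> in simp)
  then have "((\<lambda>\<tau>. f (\<tau> + 1)) has_field_derivative deriv f (\<tau> + 1)) (at \<tau>)"
    by (simp add: DERIV_shift)
  moreover have "((\<lambda>\<tau>. k * g \<tau>) has_field_derivative k * deriv g \<tau>) (at \<tau>)"
    by (intro DERIV_cmult has_derivative_upper_half_plane g \<tau>)
  then have "((\<lambda>\<tau>. f (\<tau> + 1)) has_field_derivative k * deriv g \<tau>) (at \<tau>)"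
    by (rule has_field_derivative_transform_within_open[OF _ open_upper_half_plane]) (use \<tau> fg in auto)
  ultimately have "deriv f (\<tau> + 1) = k * deriv g \<tau>" by (rule DERIV_unique)
  then show ?thesis using k by (simp add: logderiv_def fg[OF \<tau>])
qed

lemma fricke_has_derivative:
  assumes \<tau>: "0 < Im \<tau>"
  shows "(fricke has_field_derivative 1 / (3 * \<tau> ^ 2)) (at \<tau>)"
proof -
  have "\<tau> \<noteq> 0" using \<tau> by auto
  then show ?thesis unfolding fricke_def
    by (auto intro!: derivative_eq_intros simp: power2_eq_square)
qed

lemma logderiv_fricke:
  assumes f: "f holomorphic_on upper_half_plane" and g: "g holomorphic_on upper_half_plane"
    and fg: "\<And>\<tau>. 0 < Im \<tau> \<Longrightarrow> f (fricke \<tau>) * g \<tau> = k" and k: "k \<noteq> 0" and \<tau>: "0 < Im \<tau>"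
  shows "logderiv f (fricke \<tau>) = - 3 * \<tau> ^ 2 * logderiv g \<tau>"
proof -
  have "\<tau> \<noteq> 0" using \<tau> by auto
  have nz: "f (fricke \<tau>) \<noteq> 0" "g \<tau> \<noteq> 0" using fg[OF \<tau>] k by auto
  have "((\<lambda>\<tau>. f (fricke \<tau>)) has_field_derivative deriv f (fricke \<tau>) * (1 / (3 * \<tau> ^ 2))) (at \<tau>)"
    by (rule DERIV_chain2[OF has_derivative_upper_half_plane[OF f Im_fricke_pos[OF \<tau>]] fricke_has_derivative[OF \<tau>]])
  then have "((\<lambda>\<tau>. f (fricke \<tau>) * g \<tau>) has_field_derivative
      deriv f (fricke \<tau>) * (1 / (3 * \<tau> ^ 2)) * g \<tau> + deriv g \<tau> * f (fricke \<tau>)) (at \<tau>)"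
    by (rule DERIV_mult) (rule has_derivative_upper_half_plane[OF g \<tau>])
  moreover have "((\<lambda>\<tau>. k) has_field_derivative 0) (at \<tau>)" by simp
  then have "((\<lambda>\<tau>. f (fricke \<tau>) * g \<tau>) has_field_derivative 0) (at \<tau>)"
    by (rule has_field_derivative_transform_within_open[OF _ open_upper_half_plane]) (use \<tau> fg in auto)
  ultimately have "deriv f (fricke \<tau>) * (1 / (3 * \<tau> ^ 2)) * g \<tau> + deriv g \<tau> * f (fricke \<tau>) = 0"
    by (rule DERIV_unique)
  then have "deriv f (fricke \<tau>) * g \<tau> = - 3 * \<tau> ^ 2 * deriv g \<tau> * f (fricke \<tau>)"
    using \<open>\<tau> \<noteq> 0\<close> by (simp add: field_simps eq_neg_iff_add_eq_0)
  then show ?thesis using nz by (simp add: logderiv_def field_simps)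
qed

lemma nome_has_derivative: "(nome has_field_derivative of_real pi * \<i> * nome \<tau>) (at \<tau>)"
  by (auto intro!: derivative_eq_intros)

text \<open>
  The exponential factor accounts for a fractional order at the cusp, as for quotients of \<open>\<theta>\<^sub>2\<close>.
\<close>

lemma logderiv_nome:
  assumes Q: "Q holomorphic_on ball 0 1" and r: "\<And>\<tau>. 0 < Im \<tau> \<Longrightarrow> f \<tau> = exp (r * \<tau>) * Q (nome \<tau>)"
    and \<tau>: "0 < Im \<tau>" and nz: "Q (nome \<tau>) \<noteq> 0"
  shows "logderiv f \<tau> = r + nome \<tau> * (of_real pi * \<i> * deriv Q (nome \<tau>) / Q (nome \<tau>))"
proof -
  have Q': "(Q has_field_derivative deriv Q (nome \<tau>)) (at (nome \<tau>))"
    by (rule holomorphic_derivI[OF Q open_ball nome_in_ball[OF \<tau>]])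
  have "((\<lambda>\<tau>. exp (r * \<tau>) * Q (nome \<tau>)) has_field_derivative
      exp (r * \<tau>) * r * Q (nome \<tau>) + exp (r * \<tau>) * (deriv Q (nome \<tau>) * (of_real pi * \<i> * nome \<tau>))) (at \<tau>)"
    by (rule derivative_eq_intros DERIV_chain2[OF Q' nome_has_derivative] refl | simp)+
  then have "(f has_field_derivative
      exp (r * \<tau>) * r * Q (nome \<tau>) + exp (r * \<tau>) * (deriv Q (nome \<tau>) * (of_real pi * \<i> * nome \<tau>))) (at \<tau>)"
    by (rule has_field_derivative_transform_within_open[OF _ open_upper_half_plane]) (use \<tau> r in auto)
  then have "deriv f \<tau> = exp (r * \<tau>) * r * Q (nome \<tau>) + exp (r * \<tau>) * (deriv Q (nome \<tau>) * (of_real pi * \<i> * nome \<tau>))"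
    by (rule DERIV_imp_deriv)
  then show ?thesis using nz unfolding logderiv_def r[OF \<tau>] by (simp add: field_simps)
qed

lemma nome_surj:
  assumes "x \<noteq> 0" "norm x < 1"
  obtains \<tau> where "0 < Im \<tau>" "nome \<tau> = x"
proof
  let ?\<tau> = "Ln x / (of_real pi * \<i>)"
  show "nome ?\<tau> = x" using assms by simp
  show "0 < Im ?\<tau>" using assms by (simp add: Im_divide power2_eq_square field_simps)
qed

lemma psi_nonzero:
  assumes "norm x < 1"
  shows "psi x \<noteq> 0"
proof (cases "x = 0")
  case False
  then obtain \<tau> where "0 < Im \<tau>" "nome \<tau> = x" using assms nome_surj by blast
  then show ?thesis using theta2_nonzero[of \<tau>] theta2_nome[of \<tau>] by auto
qed simp

text \<open>
  The logarithmic derivatives of \<open>A/a\<close>, \<open>B/b\<close>, \<open>C/c\<close> are permuted by \<open>G\<close> with weight 2 up to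
  sign, and so are the products \<open>bBcC\<close>, \<open>aAcC\<close>, \<open>aAbB\<close>. The differences \<open>E1, E2, E3\<close> with suitable multiples of
  the products vanish at the cusp, hence their product of weight 6 is zero. Any one of them being
  identically zero makes \<open>E1\<close> zero by the action of \<open>G\<close>.
\<close>

theorem logderiv_theta3_ratio:
  assumes "0 < Im \<tau>"
  shows "logderiv (\<lambda>\<tau>. theta3 (3 * \<tau>) / theta3 \<tau>) \<tau>
       = - (of_real pi * \<i> / 2) * (theta4 \<tau> * theta4 (3 * \<tau>)) * (theta2 \<tau> * theta2 (3 * \<tau>))"
proof -
  let ?c = "of_real pi * \<i> / 2 :: complex"
  define q1 where "q1 \<tau> = theta3 (3 * \<tau>) / theta3 \<tau>" for \<tau>
  define q2 where "q2 \<tau> = theta4 (3 * \<tau>) / theta4 \<tau>" for \<tau>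
  define q3 where "q3 \<tau> = theta2 (3 * \<tau>) / theta2 \<tau>" for \<tau>
  have q_hol: "q1 holomorphic_on upper_half_plane" "q2 holomorphic_on upper_half_plane"
      "q3 holomorphic_on upper_half_plane"
    unfolding q1_def q2_def q3_def
    by (intro holomorphic_intros theta_holomorphic; simp add: theta_nonzero)+
  have q_nz: "q1 \<tau> \<noteq> 0" "q2 \<tau> \<noteq> 0" "q3 \<tau> \<noteq> 0" if "0 < Im \<tau>" for \<tau>
    unfolding q1_def q2_def q3_def using theta_nonzero[OF that] by simp_all
  have L_hol: "logderiv q1 holomorphic_on upper_half_plane" "logderiv q2 holomorphic_on upper_half_plane"
      "logderiv q3 holomorphic_on upper_half_plane"
    unfolding logderiv_def[abs_def]
    by (intro holomorphic_intros q_hol open_upper_half_plane; simp add: q_nz)+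
  have q_translate: "q1 (\<tau> + 1) = 1 * q2 \<tau>" "q2 (\<tau> + 1) = 1 * q1 \<tau>"
      "q3 (\<tau> + 1) = nome (1 / 4) ^ 2 * q3 \<tau>" if "0 < Im \<tau>" for \<tau>
    unfolding q1_def q2_def q3_def theta_translate[OF that]
    by (simp_all add: power2_eq_square power3_eq_cube)
  have q_fricke: "q1 (fricke \<tau>) * q1 \<tau> = 1 / of_real (sqrt 3)" "q2 (fricke \<tau>) * q3 \<tau> = 1 / of_real (sqrt 3)"
      "q3 (fricke \<tau>) * q2 \<tau> = 1 / of_real (sqrt 3)" if "0 < Im \<tau>" for \<tau>
    unfolding q1_def q2_def q3_def theta_fricke[OF that]
    using theta_nonzero[OF that] theta_factor_nonzero[OF that] by (simp_all add: field_simps)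
  have L_translate: "logderiv q1 (\<tau> + 1) = logderiv q2 \<tau>" "logderiv q2 (\<tau> + 1) = logderiv q1 \<tau>"
      "logderiv q3 (\<tau> + 1) = logderiv q3 \<tau>" if "0 < Im \<tau>" for \<tau>
    subgoal by (rule logderiv_translate[where k = 1]) (use q_hol q_translate that in auto)
    subgoal by (rule logderiv_translate[where k = 1]) (use q_hol q_translate that in auto)
    subgoal by (rule logderiv_translate[where k = "nome (1 / 4) ^ 2"]) (use q_hol q_translate that in auto)
    done
  have L_fricke: "logderiv q1 (fricke \<tau>) = - 3 * \<tau> ^ 2 * logderiv q1 \<tau>"
      "logderiv q2 (fricke \<tau>) = - 3 * \<tau> ^ 2 * logderiv q3 \<tau>"
      "logderiv q3 (fricke \<tau>) = - 3 * \<tau> ^ 2 * logderiv q2 \<tau>" if "0 < Im \<tau>" for \<tau>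
    by (rule logderiv_fricke[where k = "1 / of_real (sqrt 3)"]; use q_hol q_fricke that in auto)+
  define E1 where "E1 \<tau> = logderiv q1 \<tau> + ?c * (theta4 \<tau> * theta4 (3 * \<tau>)) * (theta2 \<tau> * theta2 (3 * \<tau>))" for \<tau>
  define E2 where "E2 \<tau> = logderiv q2 \<tau> - ?c * (theta3 \<tau> * theta3 (3 * \<tau>)) * (theta2 \<tau> * theta2 (3 * \<tau>))" for \<tau>
  define E3 where "E3 \<tau> = logderiv q3 \<tau> - ?c * (theta3 \<tau> * theta3 (3 * \<tau>)) * (theta4 \<tau> * theta4 (3 * \<tau>))" for \<tau>
  have hol: "E1 holomorphic_on upper_half_plane" "E2 holomorphic_on upper_half_plane"
      "E3 holomorphic_on upper_half_plane"
    unfolding E1_def E2_def E3_def by (intro holomorphic_intros L_hol theta_holomorphic)+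
  have translate: "E1 (\<tau> + 1) = E2 \<tau>" "E2 (\<tau> + 1) = E1 \<tau>" "E3 (\<tau> + 1) = E3 \<tau>" if "0 < Im \<tau>" for \<tau>
    unfolding E1_def E2_def E3_def L_translate[OF that] theta2_product_translate[OF that]
      theta3_plus_one[OF that] theta4_plus_one[OF that] theta3_triple_plus_one[OF that]
      theta4_triple_plus_one[OF that] by (simp_all add: mult_ac)
  have products: "theta3 (fricke \<tau>) * theta3 (3 * fricke \<tau>) = of_real (sqrt 3) * (- \<i> * \<tau>) * (theta3 \<tau> * theta3 (3 * \<tau>))"
      "theta4 (fricke \<tau>) * theta4 (3 * fricke \<tau>) = of_real (sqrt 3) * (- \<i> * \<tau>) * (theta2 \<tau> * theta2 (3 * \<tau>))"
      "theta2 (fricke \<tau>) * theta2 (3 * fricke \<tau>) = of_real (sqrt 3) * (- \<i> * \<tau>) * (theta4 \<tau> * theta4 (3 * \<tau>))"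
    if "0 < Im \<tau>" for \<tau>
    unfolding theta_fricke[OF that] theta_factor_square[symmetric] by (simp_all add: power2_eq_square)
  have s3: "of_real (sqrt 3) * (of_real (sqrt 3) * x) = (3 * x :: complex)" for x
    by (simp flip: of_real_mult mult.assoc)
  have fricke: "E1 (fricke \<tau>) = - 3 * \<tau> ^ 2 * E1 \<tau>" "E2 (fricke \<tau>) = - 3 * \<tau> ^ 2 * E3 \<tau>"
      "E3 (fricke \<tau>) = - 3 * \<tau> ^ 2 * E2 \<tau>" if "0 < Im \<tau>" for \<tau>
    unfolding E1_def E2_def E3_def L_fricke[OF that] products[OF that]
    by (simp_all add: power2_eq_square algebra_simps s3)
  define Q1 where "Q1 x = phi (x ^ 3) / phi x" for x
  define Q2 where "Q2 x = phi (- (x ^ 3)) / phi (- x)" for x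
  define Q3 where "Q3 x = psi (x ^ 3) / psi x" for x
  have Q_hol: "Q1 holomorphic_on ball 0 1" "Q2 holomorphic_on ball 0 1" "Q3 holomorphic_on ball 0 1"
    unfolding Q1_def Q2_def Q3_def
    by (intro holomorphic_intros nome_series_holomorphic; simp add: phi_nonzero psi_nonzero)+
  have Q_nz: "Q1 x \<noteq> 0" "Q2 x \<noteq> 0" "Q3 x \<noteq> 0" if "x \<in> ball 0 1" for x
    unfolding Q1_def Q2_def Q3_def using that
    by (auto simp: phi_nonzero psi_nonzero norm_power power_less_one_iff)
  define G where "G Q x = of_real pi * \<i> * deriv Q x / Q x" for Q :: "complex \<Rightarrow> complex" and x
  have L_nome: "logderiv q1 \<tau> = nome \<tau> * G Q1 (nome \<tau>)" "logderiv q2 \<tau> = nome \<tau> * G Q2 (nome \<tau>)"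
      "logderiv q3 \<tau> = ?c + nome \<tau> * G Q3 (nome \<tau>)" if "0 < Im \<tau>" for \<tau>
  proof -
    note nz = Q_nz[OF nome_in_ball[OF that]]
    have "q1 \<tau> = exp (0 * \<tau>) * Q1 (nome \<tau>)" "q2 \<tau> = exp (0 * \<tau>) * Q2 (nome \<tau>)" if "0 < Im \<tau>" for \<tau>
      unfolding q1_def q2_def Q1_def Q2_def theta_nome[OF that] by simp_all
    note 12 = logderiv_nome[OF Q_hol(1) this(1) that nz(1)] logderiv_nome[OF Q_hol(2) this(2) that nz(2)]
    have "q3 \<tau> = exp (?c * \<tau>) * Q3 (nome \<tau>)" if "0 < Im \<tau>" for \<tau>
    proof -
      \<comment> \<open>\<open>C/c\<close> has a zero of order 1/2 in \<open>x\<close>, the source of the constant term of its logarithmic derivative\<close>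
      have "exp (?c * \<tau>) * nome (\<tau> / 4) = nome (3 * \<tau> / 4)"
        unfolding exp_add[symmetric] by (rule arg_cong[of _ _ exp]) (simp add: field_simps)
      then have "nome (3 * \<tau> / 4) / nome (\<tau> / 4) = exp (?c * \<tau>)"
        by (metis exp_not_eq_zero nonzero_mult_div_cancel_right)
      moreover have "q3 \<tau> = nome (3 * \<tau> / 4) / nome (\<tau> / 4) * Q3 (nome \<tau>)"
      proof -
        have "X * (2 * u) / (Y * (2 * w)) = X / Y * (u / w)" for X Y u w :: complex by simp
        then show ?thesis unfolding q3_def Q3_def theta_nome[OF that] .
      qed
      ultimately show ?thesis by (simp only:)
    qed
    note 3 = logderiv_nome[OF Q_hol(3) this that nz(3)]
    show "logderiv q1 \<tau> = nome \<tau> * G Q1 (nome \<tau>)" "logderiv q2 \<tau> = nome \<tau> * G Q2 (nome \<tau>)"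
      "logderiv q3 \<tau> = ?c + nome \<tau> * G Q3 (nome \<tau>)"
      unfolding G_def using 12 3 by (simp_all only: add_0_left times_divide_eq_right)
  qed
  have G_hol: "G Q1 holomorphic_on ball 0 1" "G Q2 holomorphic_on ball 0 1" "G Q3 holomorphic_on ball 0 1"
    unfolding G_def by (intro holomorphic_intros Q_hol open_ball Q_nz; assumption)+
  define P3 where "P3 x = ?c * (1 - (phi x * phi (x ^ 3)) * (phi (- x) * phi (- (x ^ 3))))" for x
  have "P3 holomorphic_on ball 0 1"
    unfolding P3_def by (intro holomorphic_intros nome_series_holomorphic)
  moreover have "P3 0 = 0" by (simp add: P3_def)
  ultimately obtain p3 where p3: "p3 holomorphic_on ball 0 1" "\<And>x. x \<in> ball 0 1 \<Longrightarrow> P3 x = x * p3 x"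
    using holomorphic_zero_factor by metis
  define h1 where "h1 x = G Q1 x + ?c * (phi (- x) * phi (- (x ^ 3))) * ((2 * psi x) * (2 * psi (x ^ 3)))" for x
  define h2 where "h2 x = G Q2 x - ?c * (phi x * phi (x ^ 3)) * ((2 * psi x) * (2 * psi (x ^ 3)))" for x
  define h3 where "h3 x = G Q3 x + p3 x" for x
  have h: "h1 holomorphic_on ball 0 1" "h2 holomorphic_on ball 0 1" "h3 holomorphic_on ball 0 1"
    unfolding h1_def h2_def h3_def by (intro holomorphic_intros nome_series_holomorphic G_hol p3)+
  have cusp: "E1 \<tau> = nome \<tau> * h1 (nome \<tau>)" "E2 \<tau> = nome \<tau> * h2 (nome \<tau>)" "E3 \<tau> = nome \<tau> * h3 (nome \<tau>)"
    if "0 < Im \<tau>" for \<tau>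
  proof -
    define x where "x = nome \<tau>"
    have c: "theta2 \<tau> * theta2 (3 * \<tau>) = x * ((2 * psi x) * (2 * psi (x ^ 3)))"
    proof -
      have "theta2 \<tau> * theta2 (3 * \<tau>) = (nome (\<tau> / 4) * nome (3 * \<tau> / 4)) * ((2 * psi (nome \<tau>)) * (2 * psi (nome \<tau> ^ 3)))"
        unfolding theta_nome[OF that] by (simp only: mult_ac)
      then show ?thesis unfolding nome_split x_def .
    qed
    have P3: "x * p3 x = P3 x" using p3(2) nome_in_ball[OF that] by (simp only: x_def)
    note rest = theta3_nome[OF that] theta4_nome[OF that] theta3_triple_nome[OF that] theta4_triple_nome[OF that]
    show "E1 \<tau> = nome \<tau> * h1 (nome \<tau>)" "E2 \<tau> = nome \<tau> * h2 (nome \<tau>)" "E3 \<tau> = nome \<tau> * h3 (nome \<tau>)"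
      unfolding E1_def E2_def E3_def L_nome[OF that] c h1_def h2_def h3_def rest x_def[symmetric]
        distrib_left[of x] right_diff_distrib[of x] P3
      by (simp_all add: P3_def algebra_simps)
  qed
  have "E1 \<tau> * (E2 \<tau> * E3 \<tau>) = 0" if \<tau>: "0 < Im \<tau>" for \<tau>
  proof (rule fricke_weight_vanishing[where f = "\<lambda>\<tau>. E1 \<tau> * (E2 \<tau> * E3 \<tau>)" and k = 6 and m = 3
        and h = "\<lambda>x. h1 x * (h2 x * h3 x)"])
    show "(\<lambda>\<tau>. E1 \<tau> * (E2 \<tau> * E3 \<tau>)) holomorphic_on upper_half_plane"
      using hol by (intro holomorphic_intros)
    show "norm (E1 (\<tau> + 1) * (E2 (\<tau> + 1) * E3 (\<tau> + 1))) = norm (E1 \<tau> * (E2 \<tau> * E3 \<tau>))" if "0 < Im \<tau>" for \<tau>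
      unfolding translate[OF that] by (simp add: norm_mult)
    show "norm (E1 (fricke \<tau>) * (E2 (fricke \<tau>) * E3 (fricke \<tau>))) = (sqrt 3 * norm \<tau>) ^ 6 * norm (E1 \<tau> * (E2 \<tau> * E3 \<tau>))"
      if "0 < Im \<tau>" for \<tau>
    proof -
      have "(sqrt 3) ^ 6 = ((sqrt 3) ^ 2) ^ 3" by (simp only: power_mult[symmetric]) simp
      then have "(sqrt 3) ^ 6 = 27" by simp
      then show ?thesis
        unfolding fricke[OF that] norm_mult norm_power power_mult_distrib
        by (simp add: norm_power power2_eq_square numeral_eq_Suc)
    qed
    show "E1 \<tau> * (E2 \<tau> * E3 \<tau>) = nome \<tau> ^ 3 * (h1 (nome \<tau>) * (h2 (nome \<tau>) * h3 (nome \<tau>)))" if "0 < Im \<tau>" for \<tau>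
      unfolding cusp[OF that] by (simp only: power3_eq_cube mult_ac)
    show "isCont (\<lambda>x. h1 x * (h2 x * h3 x)) 0"
      using h by (intro isCont_0 holomorphic_intros)
  qed (use \<tau> in auto)
  then have "(\<forall>\<tau>. 0 < Im \<tau> \<longrightarrow> E1 \<tau> = 0) \<or> (\<forall>\<tau>. 0 < Im \<tau> \<longrightarrow> E2 \<tau> * E3 \<tau> = 0)"
    using hol by (intro holomorphic_product_zero holomorphic_intros)
  then have "(\<forall>\<tau>. 0 < Im \<tau> \<longrightarrow> E1 \<tau> = 0) \<or> (\<forall>\<tau>. 0 < Im \<tau> \<longrightarrow> E2 \<tau> = 0) \<or> (\<forall>\<tau>. 0 < Im \<tau> \<longrightarrow> E3 \<tau> = 0)"
    using holomorphic_product_zero[OF hol(2,3)] by blast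
  moreover have "E2 \<tau> = 0" if "\<And>\<tau>. 0 < Im \<tau> \<Longrightarrow> E3 \<tau> = 0" "0 < Im \<tau>" for \<tau>
    using fricke(3)[OF that(2)] that(1)[OF Im_fricke_pos[OF that(2)]] that(2) by auto
  moreover have "E1 \<tau> = 0" if "\<And>\<tau>. 0 < Im \<tau> \<Longrightarrow> E2 \<tau> = 0" "0 < Im \<tau>" for \<tau>
    using translate(2)[OF that(2)] that(1)[of "\<tau> + 1"] that(2) by simp
  ultimately have "E1 \<tau> = 0"
    using assms by blast
  then show ?thesis
    unfolding E1_def q1_def[abs_def] by (simp add: eq_neg_iff_add_eq_0)
qed

section \<open>The Schwarzian derivative\<close>

definition schwarzian :: "(complex \<Rightarrow> complex) \<Rightarrow> complex \<Rightarrow> complex" where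
  "schwarzian f w = (deriv ^^ 3) f w / deriv f w - 3 / 2 * ((deriv ^^ 2) f w / deriv f w) ^ 2"

lemma higher_deriv_simps: "(deriv ^^ 2) f = deriv (deriv f)" "(deriv ^^ 3) f = deriv (deriv (deriv f))"
  by (simp_all add: numeral_2_eq_2 numeral_3_eq_3)

lemma schwarzian_cong:
  assumes "f holomorphic_on S" "open S" "w \<in> S" "\<And>x. x \<in> S \<Longrightarrow> g x = f x"
  shows "schwarzian g w = schwarzian f w"
proof -
  have "g holomorphic_on S"
    using assms(1) by (rule holomorphic_transform) (simp add: assms(4))
  then have "(deriv ^^ n) g w = (deriv ^^ n) f w" for n
    by (rule higher_deriv_transform_within_open) (use assms in auto)
  from this[of 1] this[of 2] this[of 3] show ?thesis by (simp add: schwarzian_def)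
qed

lemma schwarzian_from_derivs:
  assumes S: "open S" "w \<in> S"
    and 1: "\<And>x. x \<in> S \<Longrightarrow> (f has_field_derivative f1 x) (at x)"
    and 2: "\<And>x. x \<in> S \<Longrightarrow> (f1 has_field_derivative f2 x) (at x)"
    and 3: "(f2 has_field_derivative f3) (at w)"
  shows "schwarzian f w = f3 / f1 w - 3 / 2 * (f2 w / f1 w) ^ 2"
proof -
  have d1: "deriv f x = f1 x" if "x \<in> S" for x
    using 1[OF that] by (rule DERIV_imp_deriv)
  have d2: "deriv (deriv f) x = f2 x" if "x \<in> S" for x
  proof (rule DERIV_imp_deriv)
    show "(deriv f has_field_derivative f2 x) (at x)"
      by (rule has_field_derivative_transform_within_open[OF 2[OF that] S(1) that]) (simp add: d1)
  qed
  have d3: "deriv (deriv (deriv f)) w = f3"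
  proof (rule DERIV_imp_deriv)
    show "(deriv (deriv f) has_field_derivative f3) (at w)"
      by (rule has_field_derivative_transform_within_open[OF 3 S]) (simp add: d2)
  qed
  show ?thesis unfolding schwarzian_def higher_deriv_simps d3 d2[OF S(2)] d1[OF S(2)] ..
qed

text \<open>
  The cocycle property of the Schwarzian derivative. It is used in three ways: to move Moebius maps
  past \<open>z\<close>, to obtain weight 4 for substitutions in \<open>\<tau>\<close>, and to pass to the coordinate \<open>x\<close>.
\<close>

lemma schwarzian_compose:
  assumes f: "f holomorphic_on S" "open S" and g: "g holomorphic_on T" "open T"
    and sub: "\<And>x. x \<in> T \<Longrightarrow> g x \<in> S" and w: "w \<in> T"
    and nz: "deriv g w \<noteq> 0" "deriv f (g w) \<noteq> 0"
  shows "schwarzian (\<lambda>x. f (g x)) w = schwarzian f (g w) * deriv g w ^ 2 + schwarzian g w"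
proof -
  note hf = f(1) holomorphic_deriv[OF f] holomorphic_deriv[OF holomorphic_deriv[OF f] f(2)]
  note hg = g(1) holomorphic_deriv[OF g] holomorphic_deriv[OF holomorphic_deriv[OF g] g(2)]
  have df: "((\<lambda>x. f (g x)) has_field_derivative deriv f (g x) * deriv g x) (at x)"
    "((\<lambda>x. deriv f (g x)) has_field_derivative deriv (deriv f) (g x) * deriv g x) (at x)"
    "((\<lambda>x. deriv (deriv f) (g x)) has_field_derivative deriv (deriv (deriv f)) (g x) * deriv g x) (at x)"
    if "x \<in> T" for x
    by (rule DERIV_chain2 holomorphic_derivI[OF hf(1) f(2) sub[OF that]] holomorphic_derivI[OF hf(2) f(2) sub[OF that]]
          holomorphic_derivI[OF hf(3) f(2) sub[OF that]] holomorphic_derivI[OF hg(1) g(2) that])+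
  have dg: "(deriv g has_field_derivative deriv (deriv g) x) (at x)"
    "(deriv (deriv g) has_field_derivative deriv (deriv (deriv g)) x) (at x)" if "x \<in> T" for x
    by (rule holomorphic_derivI[OF hg(2) g(2) that] holomorphic_derivI[OF hg(3) g(2) that])+
  have "schwarzian (\<lambda>x. f (g x)) w =
      (deriv (deriv (deriv f)) (g w) * deriv g w ^ 3 + 3 * deriv (deriv f) (g w) * deriv g w * deriv (deriv g) w
        + deriv f (g w) * deriv (deriv (deriv g)) w) / (deriv f (g w) * deriv g w)
      - 3 / 2 * ((deriv (deriv f) (g w) * deriv g w ^ 2 + deriv f (g w) * deriv (deriv g) w) / (deriv f (g w) * deriv g w)) ^ 2"
  proof (rule schwarzian_from_derivs[OF g(2) w])
    fix x assume x: "x \<in> T"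
    show "((\<lambda>x. f (g x)) has_field_derivative deriv f (g x) * deriv g x) (at x)" by (rule df(1)[OF x])
    show "((\<lambda>x. deriv f (g x) * deriv g x) has_field_derivative
        deriv (deriv f) (g x) * deriv g x ^ 2 + deriv f (g x) * deriv (deriv g) x) (at x)"
      by (rule derivative_eq_intros df(2)[OF x] dg(1)[OF x] refl)+ (simp add: power2_eq_square)
  next
    show "((\<lambda>x. deriv (deriv f) (g x) * deriv g x ^ 2 + deriv f (g x) * deriv (deriv g) x) has_field_derivative
      deriv (deriv (deriv f)) (g w) * deriv g w ^ 3 + 3 * deriv (deriv f) (g w) * deriv g w * deriv (deriv g) w
        + deriv f (g w) * deriv (deriv (deriv g)) w) (at w)"
      by (rule derivative_eq_intros df[OF w] dg[OF w] refl)+ (simp add: power2_eq_square power3_eq_cube algebra_simps)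
  qed
  also have "\<dots> = schwarzian f (g w) * deriv g w ^ 2 + schwarzian g w"
  proof -
    have "(r * x ^ 3 + 3 * q * x * y + p * z) / (p * x) - 3 / 2 * ((q * x ^ 2 + p * y) / (p * x)) ^ 2
      = (r / p - 3 / 2 * (q / p) ^ 2) * x ^ 2 + (z / x - 3 / 2 * (y / x) ^ 2)"
      if "p \<noteq> 0" "x \<noteq> 0" for p q r x y z :: complex
    proof -
      have eqs: "(r * x ^ 3 + 3 * q * x * y + p * z) / (p * x) = r / p * x ^ 2 + 3 * (q / p) * (y / x) * x + z / x"
        "(q * x ^ 2 + p * y) / (p * x) = q / p * x + y / x"
        using that by (simp_all add: add_divide_distrib power2_eq_square power3_eq_cube)
      have "(U * x ^ 2 + 3 * V * Y * x + Z) - 3 / 2 * (V * x + Y) ^ 2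
          = (U - 3 / 2 * V ^ 2) * x ^ 2 + (Z - 3 / 2 * Y ^ 2)" for U V Y Z :: complex
        by (simp add: power2_eq_square algebra_simps)
      then show ?thesis unfolding eqs .
    qed
    from this[OF nz(2,1)] show ?thesis unfolding schwarzian_def higher_deriv_simps .
  qed
  finally show ?thesis .
qed

lemma moebius_derivative:
  fixes \<alpha> \<beta> \<gamma> \<delta> w :: complex
  assumes "\<gamma> * w + \<delta> \<noteq> 0"
  shows "((\<lambda>w. (\<alpha> * w + \<beta>) / (\<gamma> * w + \<delta>)) has_field_derivative (\<alpha> * \<delta> - \<beta> * \<gamma>) / (\<gamma> * w + \<delta>) ^ 2) (at w)"
  by (rule derivative_eq_intros refl assms)+ (simp add: power2_eq_square algebra_simps)

lemma inverse_power_derivative: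
  fixes f :: "complex \<Rightarrow> complex"
  assumes "(f has_field_derivative d) (at x)" "f x \<noteq> 0"
  shows "((\<lambda>x. c / f x ^ 2) has_field_derivative - 2 * d * c / f x ^ 3) (at x)"
    and "((\<lambda>x. c / f x ^ 3) has_field_derivative - 3 * d * c / f x ^ 4) (at x)"
  using assms by (auto intro!: derivative_eq_intros
      simp: divide_simps power2_eq_square power3_eq_cube power4_eq_xxxx)

lemma schwarzian_moebius:
  fixes \<alpha> \<beta> \<gamma> \<delta> w :: complex
  assumes nz: "\<gamma> * w + \<delta> \<noteq> 0" and det: "\<alpha> * \<delta> - \<beta> * \<gamma> \<noteq> 0"
  shows "schwarzian (\<lambda>w. (\<alpha> * w + \<beta>) / (\<gamma> * w + \<delta>)) w = 0"
proof -
  let ?D = "\<alpha> * \<delta> - \<beta> * \<gamma>"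
  define S where "S = {w. \<gamma> * w + \<delta> \<noteq> 0}"
  have S: "open S" unfolding S_def by (intro open_Collect_neq continuous_intros)
  have affine: "((\<lambda>w. \<gamma> * w + \<delta>) has_field_derivative \<gamma>) (at x)" for x
    by (auto intro!: derivative_eq_intros)
  have "schwarzian (\<lambda>w. (\<alpha> * w + \<beta>) / (\<gamma> * w + \<delta>)) w =
      (6 * \<gamma> ^ 2 * ?D / (\<gamma> * w + \<delta>) ^ 4) / (?D / (\<gamma> * w + \<delta>) ^ 2)
      - 3 / 2 * ((- 2 * \<gamma> * ?D / (\<gamma> * w + \<delta>) ^ 3) / (?D / (\<gamma> * w + \<delta>) ^ 2)) ^ 2"
  proof (rule schwarzian_from_derivs[OF S])
    show "w \<in> S" using nz by (simp add: S_def)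
    fix x assume "x \<in> S"
    then have x: "\<gamma> * x + \<delta> \<noteq> 0" by (simp add: S_def)
    show "((\<lambda>w. (\<alpha> * w + \<beta>) / (\<gamma> * w + \<delta>)) has_field_derivative ?D / (\<gamma> * x + \<delta>) ^ 2) (at x)"
      using x by (rule moebius_derivative)
    show "((\<lambda>w. ?D / (\<gamma> * w + \<delta>) ^ 2) has_field_derivative - 2 * \<gamma> * ?D / (\<gamma> * x + \<delta>) ^ 3) (at x)"
      using inverse_power_derivative(1)[OF affine x, of ?D] by simp
  next
    show "((\<lambda>w. - 2 * \<gamma> * ?D / (\<gamma> * w + \<delta>) ^ 3) has_field_derivative 6 * \<gamma> ^ 2 * ?D / (\<gamma> * w + \<delta>) ^ 4) (at w)"
      using inverse_power_derivative(2)[OF affine nz, of "- 2 * \<gamma> * ?D"]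
      by (rule DERIV_cong) (simp add: power2_eq_square)
  qed
  also have "\<dots> = 0"
  proof -
    have "(6 * \<gamma> ^ 2 * D / s ^ 4) / (D / s ^ 2) - 3 / 2 * ((- 2 * \<gamma> * D / s ^ 3) / (D / s ^ 2)) ^ 2 = 0"
      if "s \<noteq> 0" "D \<noteq> 0" for s D
      using that by (simp add: field_simps power2_eq_square power3_eq_cube power4_eq_xxxx)
    then show ?thesis using nz det by blast
  qed
  finally show ?thesis .
qed

lemma schwarzian_moebius_compose:
  fixes \<alpha> \<beta> \<gamma> \<delta> :: complex
  assumes g: "g holomorphic_on T" "open T" and w: "w \<in> T"
    and nz: "\<And>x. x \<in> T \<Longrightarrow> \<gamma> * g x + \<delta> \<noteq> 0" and det: "\<alpha> * \<delta> - \<beta> * \<gamma> \<noteq> 0"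
    and g': "deriv g w \<noteq> 0"
  shows "schwarzian (\<lambda>x. (\<alpha> * g x + \<beta>) / (\<gamma> * g x + \<delta>)) w = schwarzian g w"
proof -
  define S where "S = {w. \<gamma> * w + \<delta> \<noteq> 0}"
  have S: "open S" unfolding S_def by (intro open_Collect_neq continuous_intros)
  have gS: "g x \<in> S" if "x \<in> T" for x using nz[OF that] by (simp add: S_def)
  have "schwarzian (\<lambda>x. (\<alpha> * g x + \<beta>) / (\<gamma> * g x + \<delta>)) w =
      schwarzian (\<lambda>w. (\<alpha> * w + \<beta>) / (\<gamma> * w + \<delta>)) (g w) * deriv g w ^ 2 + schwarzian g w"
  proof (rule schwarzian_compose[OF _ S g gS w g'])
    show "(\<lambda>w. (\<alpha> * w + \<beta>) / (\<gamma> * w + \<delta>)) holomorphic_on S"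
      unfolding S_def by (intro holomorphic_intros) auto
    show "deriv (\<lambda>w. (\<alpha> * w + \<beta>) / (\<gamma> * w + \<delta>)) (g w) \<noteq> 0"
      using DERIV_imp_deriv[OF moebius_derivative[OF nz[OF w], of \<alpha> \<beta>]] nz[OF w] det by simp
  qed
  then show ?thesis using schwarzian_moebius[OF nz[OF w] det] by simp
qed

lemma schwarzian_exp:
  assumes r: "r \<noteq> 0"
  shows "schwarzian (\<lambda>w. exp (r * w)) w = - (r ^ 2) / 2"
proof -
  have "schwarzian (\<lambda>w. exp (r * w)) w
      = r ^ 3 * exp (r * w) / (r * exp (r * w)) - 3 / 2 * (r ^ 2 * exp (r * w) / (r * exp (r * w))) ^ 2"
    by (rule schwarzian_from_derivs[of UNIV])
       (auto intro!: derivative_eq_intros simp: power2_eq_square power3_eq_cube)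
  also have "\<dots> = - (r ^ 2) / 2"
    using r by (simp add: field_simps power2_eq_square power3_eq_cube)
  finally show ?thesis .
qed

section \<open>The function z\<close>

definition zfun :: "complex \<Rightarrow> complex" where
  "zfun \<tau> = 3 * (theta3 (3 * \<tau>) ^ 2 / theta3 \<tau> ^ 2)"

lemma zfun_holomorphic: "zfun holomorphic_on upper_half_plane"
  unfolding zfun_def[abs_def] by (intro holomorphic_intros theta_holomorphic) (simp add: theta_nonzero)

lemma zfun_cusp_free:
  assumes \<tau>: "0 < Im \<tau>"
  shows "zfun \<tau> \<noteq> 0" "zfun \<tau> \<noteq> 1" "zfun \<tau> \<noteq> - 1" "zfun \<tau> \<noteq> 3" "zfun \<tau> \<noteq> - 3"
proof -
  define a A where "a = theta3 \<tau> ^ 2" "A = theta3 (3 * \<tau>) ^ 2"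
  note defs = this
  have z: "zfun \<tau> = 3 * (A / a)" by (simp add: zfun_def defs)
  have nz: "a \<noteq> 0" "A \<noteq> 0" "A + a \<noteq> 0" "3 * A - a \<noteq> 0" "a - A \<noteq> 0" "a + 3 * A \<noteq> 0"
    using theta_nonzero[OF \<tau>] theta_degree_3_nonzero[OF \<tau>] unfolding defs by simp_all
  have eq: "3 * A = x * a" if "zfun \<tau> = x" for x
    using that nz(1) unfolding z by (auto simp: field_simps)
  show "zfun \<tau> \<noteq> 0" using eq[of 0] nz by auto
  show "zfun \<tau> \<noteq> 1" using eq[of 1] nz by auto
  show "zfun \<tau> \<noteq> - 1" using eq[of "- 1"] nz by auto
  show "zfun \<tau> \<noteq> 3" using eq[of 3] nz by auto
  show "zfun \<tau> \<noteq> - 3"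
  proof
    assume "zfun \<tau> = - 3"
    then have "3 * (A + a) = 0" using eq[of "- 3"] by (simp only: distrib_left) simp
    then show False using nz(3) by (simp only: mult_eq_0_iff) simp
  qed
qed

lemma zfun_translate:
  assumes \<tau>: "0 < Im \<tau>"
  shows "zfun (\<tau> + 1) = (zfun \<tau> + 3) / (zfun \<tau> - 1)"
proof -
  define a A b B where "a = theta3 \<tau> ^ 2" "A = theta3 (3 * \<tau>) ^ 2" "b = theta4 \<tau> ^ 2" "B = theta4 (3 * \<tau>) ^ 2"
  note defs = this
  have nz: "a \<noteq> 0" "b \<noteq> 0" "3 * A - a \<noteq> 0"
    using theta_nonzero[OF \<tau>] theta_degree_3_nonzero[OF \<tau>] unfolding defs by simp_all
  have "B * (3 * A - a) = b * (A + a)" unfolding defs by (rule theta34_degree_3[OF \<tau>])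
  then have "B / b = (A + a) / (3 * A - a)" using nz by (simp add: field_simps)
  then have "3 * (B / b) = 3 * (A + a) / (3 * A - a)" by simp
  also have "\<dots> = (3 * (A / a) + 3) / (3 * (A / a) - 1)" using nz by (simp add: field_simps)
  finally show ?thesis unfolding zfun_def theta_translate[OF \<tau>] defs .
qed

lemma zfun_fricke:
  assumes \<tau>: "0 < Im \<tau>"
  shows "zfun (fricke \<tau>) = 3 / zfun \<tau>"
proof -
  have "\<tau> \<noteq> 0" using \<tau> by auto
  then show ?thesis
    unfolding zfun_def theta_fricke_square[OF \<tau>] by simp
qed

text \<open>
  The product of the two degree 3 product formulas; it makes the derivative of \<open>z\<close> a function of
  \<open>a\<^sup>2\<close> and \<open>A\<^sup>2\<close>.
\<close>

lemma theta24_product: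
  assumes \<tau>: "0 < Im \<tau>"
  shows "theta4 \<tau> * theta4 (3 * \<tau>) * (theta2 \<tau> * theta2 (3 * \<tau>))
    = (theta3 \<tau> ^ 4 - theta3 (3 * \<tau>) ^ 4) * (9 * theta3 (3 * \<tau>) ^ 4 - theta3 \<tau> ^ 4)
       / (16 * theta3 \<tau> ^ 2 * theta3 (3 * \<tau>) ^ 2)"
proof -
  have "16 * theta3 \<tau> ^ 2 * theta3 (3 * \<tau>) ^ 2 * (theta4 \<tau> * theta4 (3 * \<tau>) * (theta2 \<tau> * theta2 (3 * \<tau>)))
    = (theta3 \<tau> ^ 4 - theta3 (3 * \<tau>) ^ 4) * (9 * theta3 (3 * \<tau>) ^ 4 - theta3 \<tau> ^ 4)"
    (is "?l = ?r")
  proof -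
    define a b c A B C where "a = theta3 \<tau>" "b = theta4 \<tau>" "c = theta2 \<tau>"
      "A = theta3 (3 * \<tau>)" "B = theta4 (3 * \<tau>)" "C = theta2 (3 * \<tau>)"
    note defs = this
    have "?l = (4 * a * A * b * B) * (4 * a * A * c * C)"
      unfolding defs by (simp add: power2_eq_square)
    also have "\<dots> = ((A ^ 2 + a ^ 2) * (3 * A ^ 2 - a ^ 2)) * ((a ^ 2 + 3 * A ^ 2) * (a ^ 2 - A ^ 2))"
      unfolding defs theta34_product_degree_3[OF \<tau>] theta23_product_degree_3[OF \<tau>] ..
    also have "\<dots> = (a ^ 4 - A ^ 4) * (9 * A ^ 4 - a ^ 4)"
      by (simp add: power4_eq_xxxx power2_eq_square algebra_simps)
    finally show ?thesis unfolding defs .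
  qed
  moreover have "16 * theta3 \<tau> ^ 2 * theta3 (3 * \<tau>) ^ 2 \<noteq> 0" using theta_nonzero[OF \<tau>] by simp
  ultimately show ?thesis by (subst nonzero_eq_divide_eq) (simp_all only: mult.commute not_False_eq_True)
qed

theorem zfun_has_derivative:
  assumes \<tau>: "0 < Im \<tau>"
  shows "deriv zfun \<tau> = - (of_real pi * \<i>) * zfun \<tau> * (theta4 \<tau> * theta4 (3 * \<tau>) * (theta2 \<tau> * theta2 (3 * \<tau>)))"
proof -
  define q where "q \<tau> = theta3 (3 * \<tau>) / theta3 \<tau>" for \<tau>
  have q: "q holomorphic_on upper_half_plane"
    unfolding q_def by (intro holomorphic_intros theta_holomorphic) (simp add: theta_nonzero)
  have z: "zfun = (\<lambda>\<tau>. 3 * q \<tau> ^ 2)"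
    by (auto simp: zfun_def q_def power_divide)
  have nz: "q \<tau> \<noteq> 0" using theta_nonzero[OF \<tau>] by (simp add: q_def)
  have "(zfun has_field_derivative 3 * (2 * q \<tau> * deriv q \<tau>)) (at \<tau>)"
    unfolding z by (auto intro!: derivative_eq_intros has_derivative_upper_half_plane[OF q \<tau>])
  then have "deriv zfun \<tau> = 3 * (2 * q \<tau> * deriv q \<tau>)" by (rule DERIV_imp_deriv)
  also have "\<dots> = 2 * zfun \<tau> * logderiv q \<tau>"
    using nz unfolding z logderiv_def by (simp add: power2_eq_square)
  also have "logderiv q \<tau> = - (of_real pi * \<i> / 2) * (theta4 \<tau> * theta4 (3 * \<tau>)) * (theta2 \<tau> * theta2 (3 * \<tau>))"
    using logderiv_theta3_ratio[OF \<tau>] by (simp add: q_def[abs_def])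
  finally show ?thesis by simp
qed

lemma zfun_deriv_nonzero: "0 < Im \<tau> \<Longrightarrow> deriv zfun \<tau> \<noteq> 0"
  using theta_nonzero zfun_cusp_free(1) by (simp add: zfun_has_derivative)

text \<open>
  If a substitution \<open>g\<close> in \<open>\<tau>\<close> acts on \<open>z\<close> as a Moebius map, the Schwarzian derivative of \<open>z\<close> behaves
  under \<open>g\<close> like a quadratic differential, because neither map contributes a Schwarzian of its own.
\<close>

lemma schwarzian_zfun_moebius:
  assumes \<tau>: "0 < Im \<tau>" and det: "\<alpha> * \<delta> - \<beta> * \<gamma> \<noteq> 0"
    and nz: "\<And>\<tau>. 0 < Im \<tau> \<Longrightarrow> \<gamma> * zfun \<tau> + \<delta> \<noteq> 0"
    and eq: "\<And>\<tau>. 0 < Im \<tau> \<Longrightarrow> zfun (g \<tau>) = (\<alpha> * zfun \<tau> + \<beta>) / (\<gamma> * zfun \<tau> + \<delta>)"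
    and g: "g holomorphic_on upper_half_plane" "\<And>\<tau>. 0 < Im \<tau> \<Longrightarrow> 0 < Im (g \<tau>)"
    and g': "deriv g \<tau> \<noteq> 0" "schwarzian g \<tau> = 0"
  shows "schwarzian zfun (g \<tau>) * deriv g \<tau> ^ 2 = schwarzian zfun \<tau>"
proof -
  have mem: "\<tau> \<in> upper_half_plane" using \<tau> by simp
  have "schwarzian (\<lambda>\<tau>. zfun (g \<tau>)) \<tau> = schwarzian zfun (g \<tau>) * deriv g \<tau> ^ 2 + schwarzian g \<tau>"
  proof (rule schwarzian_compose[OF zfun_holomorphic open_upper_half_plane g(1) open_upper_half_plane _ mem g'(1)])
    show "g x \<in> upper_half_plane" if "x \<in> upper_half_plane" for x
      using g(2) that by simp
    show "deriv zfun (g \<tau>) \<noteq> 0" by (rule zfun_deriv_nonzero[OF g(2)[OF \<tau>]])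
  qed
  moreover have "schwarzian (\<lambda>\<tau>. zfun (g \<tau>)) \<tau> = schwarzian (\<lambda>\<tau>. (\<alpha> * zfun \<tau> + \<beta>) / (\<gamma> * zfun \<tau> + \<delta>)) \<tau>"
  proof (rule schwarzian_cong[OF _ open_upper_half_plane mem])
    show "(\<lambda>\<tau>. (\<alpha> * zfun \<tau> + \<beta>) / (\<gamma> * zfun \<tau> + \<delta>)) holomorphic_on upper_half_plane"
      by (intro holomorphic_intros zfun_holomorphic) (simp add: nz)
    show "zfun (g x) = (\<alpha> * zfun x + \<beta>) / (\<gamma> * zfun x + \<delta>)" if "x \<in> upper_half_plane" for x
      using that by (intro eq) simp
  qed
  moreover have "schwarzian (\<lambda>\<tau>. (\<alpha> * zfun \<tau> + \<beta>) / (\<gamma> * zfun \<tau> + \<delta>)) \<tau> = schwarzian zfun \<tau>"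
    by (rule schwarzian_moebius_compose[OF zfun_holomorphic open_upper_half_plane mem _ det zfun_deriv_nonzero[OF \<tau>]])
       (simp add: nz)
  ultimately show ?thesis using g'(2) by simp
qed

lemma schwarzian_zfun_translate:
  assumes \<tau>: "0 < Im \<tau>"
  shows "schwarzian zfun (\<tau> + 1) = schwarzian zfun \<tau>"
proof -
  have d: "deriv (\<lambda>\<tau>. \<tau> + 1 :: complex) \<tau> = 1"
    by (rule DERIV_imp_deriv) (auto intro!: derivative_eq_intros)
  have "schwarzian zfun (\<tau> + 1) * deriv (\<lambda>\<tau>. \<tau> + 1) \<tau> ^ 2 = schwarzian zfun \<tau>"
  proof (rule schwarzian_zfun_moebius[OF \<tau>, where \<alpha> = 1 and \<beta> = 3 and \<gamma> = 1 and \<delta> = "- 1"])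
    show "schwarzian (\<lambda>\<tau>. \<tau> + 1) \<tau> = 0"
      using schwarzian_moebius[of 0 \<tau> 1 1 1] by simp
    show "zfun (\<tau> + 1) = (1 * zfun \<tau> + 3) / (1 * zfun \<tau> + - 1)" if "0 < Im \<tau>" for \<tau>
      using zfun_translate[OF that] by simp
    show "1 * zfun \<tau> + - 1 \<noteq> 0" if "0 < Im \<tau>" for \<tau>
      using zfun_cusp_free(2)[OF that] by simp
  qed (auto simp: d intro!: holomorphic_intros)
  then show ?thesis by (simp add: d)
qed

lemma schwarzian_zfun_fricke:
  assumes \<tau>: "0 < Im \<tau>"
  shows "schwarzian zfun (fricke \<tau>) = 9 * \<tau> ^ 4 * schwarzian zfun \<tau>"
proof -
  have nz: "\<tau> \<noteq> 0" using \<tau> by auto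
  have d: "deriv fricke \<tau> = 1 / (3 * \<tau> ^ 2)"
    using fricke_has_derivative[OF \<tau>] by (rule DERIV_imp_deriv)
  have "schwarzian zfun (fricke \<tau>) * deriv fricke \<tau> ^ 2 = schwarzian zfun \<tau>"
  proof (rule schwarzian_zfun_moebius[OF \<tau>, where \<alpha> = 0 and \<beta> = 3 and \<gamma> = 1 and \<delta> = 0])
    show "schwarzian fricke \<tau> = 0"
      using schwarzian_moebius[of 3 \<tau> 0 0 "- 1"] nz by (simp add: fricke_def[abs_def])
    show "zfun (fricke \<tau>) = (0 * zfun \<tau> + 3) / (1 * zfun \<tau> + 0)" if "0 < Im \<tau>" for \<tau>
      using zfun_fricke[OF that] by simp
    show "1 * zfun \<tau> + 0 \<noteq> 0" if "0 < Im \<tau>" for \<tau>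
      using zfun_cusp_free(1)[OF that] by simp
    show "fricke holomorphic_on upper_half_plane"
      unfolding fricke_def[abs_def] by (intro holomorphic_intros) auto
  qed (use nz d Im_fricke_pos in simp_all)
  then have "schwarzian zfun \<tau> = schwarzian zfun (fricke \<tau>) / (9 * \<tau> ^ 4)"
    by (simp add: d power_divide power_mult_distrib power_mult[symmetric])
  then show ?thesis using nz by simp
qed

section \<open>The Schwarzian derivative of z\<close>

lemma phi_cube_deriv_0: "((\<lambda>x. phi (x ^ 3)) has_field_derivative 0) (at 0)"
proof -
  have "((\<lambda>x::complex. x ^ 3) has_field_derivative 0) (at 0)"
    by (rule derivative_eq_intros refl | simp)+
  moreover have "(phi has_field_derivative 2) (at (0 ^ 3))"
    using phi_deriv_0 by simp
  ultimately have "((\<lambda>x. phi (x ^ 3)) has_field_derivative 2 * 0) (at 0)"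
    by (rule DERIV_chain2[rotated])
  then show ?thesis by simp
qed

text \<open>
  The square of \<open>(3A\<^sup>4 + a\<^sup>4)/(4aA)\<close>, a form of weight 1 for \<open>G\<close>. Its square in turn, of weight 4, is the
  candidate for the Schwarzian derivative of \<open>z\<close> that the numerator \<open>(z\<^sup>2 + 3)\<^sup>4\<close> of the Fuchsian equation
  suggests.
\<close>

definition form2 :: "complex \<Rightarrow> complex" where
  "form2 \<tau> = (3 * (theta3 (3 * \<tau>) ^ 2) ^ 2 + (theta3 \<tau> ^ 2) ^ 2) ^ 2 / (16 * theta3 \<tau> ^ 2 * theta3 (3 * \<tau>) ^ 2)"

text \<open>
  With \<open>P = A\<^sup>2 + a\<^sup>2\<close> and \<open>Q = 3A\<^sup>2 - a\<^sup>2\<close> one has \<open>3P\<^sup>2 + Q\<^sup>2 = 4(3A\<^sup>4 + a\<^sup>4)\<close>, and the formulas for \<open>b\<^sup>4\<close>, \<open>B\<^sup>4\<close>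
  and \<open>bB\<close> express everything through \<open>P\<close> and \<open>Q\<close>.
\<close>

lemma form2_translate:
  assumes \<tau>: "0 < Im \<tau>"
  shows "form2 (\<tau> + 1) = form2 \<tau>"
proof -
  define a A b B where "a = theta3 \<tau>" "A = theta3 (3 * \<tau>)" "b = theta4 \<tau>" "B = theta4 (3 * \<tau>)"
  note defs = this
  have nz: "a \<noteq> 0" "A \<noteq> 0" "b \<noteq> 0" "B \<noteq> 0"
    unfolding defs using theta_nonzero[OF \<tau>] by simp_all
  define P Q where "P = A ^ 2 + a ^ 2" "Q = 3 * A ^ 2 - a ^ 2"
  note PQ = this
  have q: "16 * a ^ 2 * A ^ 2 * b ^ 4 = P * Q ^ 3" "16 * a ^ 2 * A ^ 2 * B ^ 4 = Q * P ^ 3"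
    and p: "4 * a * A * b * B = P * Q"
    unfolding PQ defs by (rule theta_quartic_degree_3[OF \<tau>] theta34_product_degree_3[OF \<tau>])+
  have "16 * a ^ 2 * A ^ 2 * (3 * B ^ 4 + b ^ 4) = P * Q * (3 * P ^ 2 + Q ^ 2)"
    using q by (simp add: distrib_left power2_eq_square power3_eq_cube mult_ac)
  also have "3 * P ^ 2 + Q ^ 2 = 4 * (3 * A ^ 4 + a ^ 4)"
    unfolding PQ by (simp add: power2_eq_square power4_eq_xxxx algebra_simps)
  also have "P * Q * (4 * (3 * A ^ 4 + a ^ 4)) = 16 * a * A * (b * B * (3 * A ^ 4 + a ^ 4))"
    unfolding p[symmetric] by simp
  finally have "16 * a * A * (a * A * (3 * B ^ 4 + b ^ 4)) = 16 * a * A * (b * B * (3 * A ^ 4 + a ^ 4))"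
    by (simp add: power2_eq_square mult_ac)
  moreover have "16 * a * A \<noteq> 0" using nz by simp
  ultimately have "a * A * (3 * B ^ 4 + b ^ 4) = b * B * (3 * A ^ 4 + a ^ 4)"
    by (metis mult_left_cancel)
  then have "(a * A * (3 * B ^ 4 + b ^ 4)) ^ 2 = (b * B * (3 * A ^ 4 + a ^ 4)) ^ 2"
    by (rule arg_cong)
  then have "(3 * B ^ 4 + b ^ 4) ^ 2 * (16 * a ^ 2 * A ^ 2) = (3 * A ^ 4 + a ^ 4) ^ 2 * (16 * b ^ 2 * B ^ 2)"
    unfolding power_mult_distrib by (simp add: mult_ac)
  then have "(3 * B ^ 4 + b ^ 4) ^ 2 / (16 * b ^ 2 * B ^ 2) = (3 * A ^ 4 + a ^ 4) ^ 2 / (16 * a ^ 2 * A ^ 2)"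
    using nz by (subst frac_eq_eq) auto
  then show ?thesis
    unfolding form2_def theta_translate[OF \<tau>] defs by (simp flip: power_mult)
qed

lemma form2_fricke:
  assumes \<tau>: "0 < Im \<tau>"
  shows "form2 (fricke \<tau>) = - 3 * \<tau> ^ 2 * form2 \<tau>"
proof -
  define t where "t = - \<i> * \<tau>"
  have t: "t \<noteq> 0" "t ^ 2 = - (\<tau> ^ 2)" using \<tau> by (auto simp: t_def power_mult_distrib)
  have "(3 * (t * a) ^ 2 + (3 * t * A) ^ 2) ^ 2 / (16 * (3 * t * A) * (t * a))
      = 3 * t ^ 2 * ((3 * A ^ 2 + a ^ 2) ^ 2 / (16 * a * A))" for a A
  proof -
    define X where "X = (3 * A ^ 2 + a ^ 2) ^ 2"
    have "(3 * (t * a) ^ 2 + (3 * t * A) ^ 2) ^ 2 = (3 * t ^ 2) * ((3 * t ^ 2) * X)"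
      unfolding X_def by (simp add: power2_eq_square algebra_simps)
    moreover have "16 * (3 * t * A) * (t * a) = (3 * t ^ 2) * (16 * a * A)"
      by (simp add: power2_eq_square)
    ultimately have "(3 * (t * a) ^ 2 + (3 * t * A) ^ 2) ^ 2 / (16 * (3 * t * A) * (t * a))
        = (3 * t ^ 2) * ((3 * t ^ 2) * X) / ((3 * t ^ 2) * (16 * a * A))" by (simp only:)
    also have "\<dots> = (3 * t ^ 2) * X / (16 * a * A)"
      by (rule mult_divide_mult_cancel_left) (use t(1) in simp)
    finally show ?thesis unfolding X_def by simp
  qed
  from this[of "theta3 \<tau> ^ 2" "theta3 (3 * \<tau>) ^ 2"] show ?thesis
    unfolding form2_def theta_fricke_square[OF \<tau>] t_def[symmetric] t(2) by simp
qed

text \<open>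
  There is no term linear in \<open>x\<close>: a vanishing order of 2 is needed to apply the vanishing criterion
  in weight 4.
\<close>

lemma form2_nome:
  obtains h where "h holomorphic_on ball 0 1"
    "\<And>\<tau>. 0 < Im \<tau> \<Longrightarrow> form2 \<tau> ^ 2 = 1 + nome \<tau> ^ 2 * h (nome \<tau>)"
proof -
  define e where "e x = (3 * (phi (x ^ 3) ^ 2) ^ 2 + (phi x ^ 2) ^ 2) ^ 2 / (16 * phi x ^ 2 * phi (x ^ 3) ^ 2)" for x
  define G where "G x = e x ^ 2 - 1" for x
  have nz: "phi x \<noteq> 0" "phi (x ^ 3) \<noteq> 0" if "x \<in> ball 0 1" for x
    using that by (auto simp: phi_nonzero norm_power power_less_one_iff)
  have G_hol: "G holomorphic_on ball 0 1"
    unfolding G_def e_def by (intro holomorphic_intros nome_series_holomorphic) (simp add: nz)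
  have "(G has_field_derivative 0) (at 0)"
    unfolding G_def e_def
    by (rule derivative_eq_intros phi_cube_deriv_0 phi_deriv_0 refl | simp)+
  then have "deriv G 0 = 0" by (rule DERIV_imp_deriv)
  moreover have "G 0 = 0" by (simp add: G_def e_def)
  ultimately obtain h where h: "h holomorphic_on ball 0 1" "h 0 = 0" "\<And>x. x \<in> ball 0 1 \<Longrightarrow> G x = x * h x"
    using holomorphic_zero_factor[OF G_hol] by metis
  obtain k where k: "k holomorphic_on ball 0 1" "\<And>x. x \<in> ball 0 1 \<Longrightarrow> h x = x * k x"
    using holomorphic_zero_factor[OF h(1,2)] by metis
  show ?thesis
  proof (rule that[OF k(1)])
    fix \<tau> assume \<tau>: "0 < Im \<tau>"
    note x = nome_in_ball[OF \<tau>]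
    have "form2 \<tau> = e (nome \<tau>)"
      unfolding form2_def e_def theta_nome[OF \<tau>] ..
    then have "form2 \<tau> ^ 2 = 1 + G (nome \<tau>)" by (simp only: G_def) simp
    also have "G (nome \<tau>) = nome \<tau> ^ 2 * k (nome \<tau>)"
      unfolding h(3)[OF x] k(2)[OF x] by (simp only: power2_eq_square mult.assoc)
    finally show "form2 \<tau> ^ 2 = 1 + nome \<tau> ^ 2 * k (nome \<tau>)" .
  qed
qed

text \<open>
  By the cocycle property \<open>S(Z \<circ> x) = (S Z \<circ> x) x'\<^sup>2 + S x\<close>. Since \<open>z\<close> is a local coordinate at the
  cusp as a function of \<open>x\<close>, the first summand is \<open>O(x\<^sup>2)\<close>; the second is the constant \<open>\<pi>\<^sup>2/2\<close>.
\<close>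

lemma schwarzian_zfun_nome:
  obtains h where "h holomorphic_on ball 0 1"
    "\<And>\<tau>. 0 < Im \<tau> \<Longrightarrow> schwarzian zfun \<tau> = of_real pi ^ 2 / 2 + nome \<tau> ^ 2 * h (nome \<tau>)"
proof -
  define Z where "Z x = 3 * (phi (x ^ 3) ^ 2 / phi x ^ 2)" for x
  have nz: "phi x \<noteq> 0" if "x \<in> ball 0 1" for x
    using that by (simp add: phi_nonzero)
  have Z_hol: "Z holomorphic_on ball 0 1"
    unfolding Z_def by (intro holomorphic_intros nome_series_holomorphic) (simp add: nz)
  have zfun_Z: "zfun \<tau> = Z (nome \<tau>)" if "0 < Im \<tau>" for \<tau>
    unfolding zfun_def Z_def theta_nome[OF that] ..
  have d_nome: "deriv nome \<tau> = of_real pi * \<i> * nome \<tau>" for \<tau>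
    by (rule DERIV_imp_deriv) (rule nome_has_derivative)
  have Z': "deriv Z x \<noteq> 0" if x: "x \<in> ball 0 1" for x
  proof (cases "x = 0")
    case True
    have "(Z has_field_derivative - 12) (at 0)"
      unfolding Z_def by (rule derivative_eq_intros phi_cube_deriv_0 phi_deriv_0 refl | simp)+
    then show ?thesis using True DERIV_imp_deriv by fastforce
  next
    case False
    then obtain \<tau> where \<tau>: "0 < Im \<tau>" "nome \<tau> = x" using x nome_surj[of x] by auto
    have "((\<lambda>\<tau>. Z (nome \<tau>)) has_field_derivative deriv Z (nome \<tau>) * (of_real pi * \<i> * nome \<tau>)) (at \<tau>)"
      by (rule DERIV_chain2[OF holomorphic_derivI[OF Z_hol open_ball nome_in_ball[OF \<tau>(1)]] nome_has_derivative])
    then have "(zfun has_field_derivative deriv Z (nome \<tau>) * (of_real pi * \<i> * nome \<tau>)) (at \<tau>)"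
      by (rule has_field_derivative_transform_within_open[OF _ open_upper_half_plane]) (use \<tau> zfun_Z in auto)
    then have "deriv zfun \<tau> = deriv Z x * (of_real pi * \<i> * x)"
      unfolding \<tau>(2) by (rule DERIV_imp_deriv)
    then show ?thesis using zfun_deriv_nonzero[OF \<tau>(1)] by auto
  qed
  define h where "h x = - (of_real pi ^ 2) * schwarzian Z x" for x
  have "schwarzian Z holomorphic_on ball 0 1"
    unfolding schwarzian_def[abs_def]
    by (intro holomorphic_intros holomorphic_higher_deriv Z_hol open_ball) (simp_all add: Z')
  then have h_hol: "h holomorphic_on ball 0 1"
    unfolding h_def by (intro holomorphic_intros)
  show ?thesis
  proof (rule that[OF h_hol])
    fix \<tau> assume \<tau>: "0 < Im \<tau>"
    have mem: "\<tau> \<in> upper_half_plane" using \<tau> by simp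
    have "schwarzian zfun \<tau> = schwarzian (\<lambda>\<tau>. Z (nome \<tau>)) \<tau>"
      by (rule schwarzian_cong[OF nome_holomorphic_compose[OF Z_hol] open_upper_half_plane mem])
         (simp only: zfun_Z mem_Collect_eq)
    also have "\<dots> = schwarzian Z (nome \<tau>) * deriv nome \<tau> ^ 2 + schwarzian nome \<tau>"
    proof (rule schwarzian_compose[OF Z_hol open_ball _ open_upper_half_plane _ mem])
      show "nome holomorphic_on upper_half_plane" by (intro holomorphic_intros)
      show "nome x \<in> ball 0 1" if "x \<in> upper_half_plane" for x
        by (rule nome_in_ball) (use that in simp)
      show "deriv nome \<tau> \<noteq> 0" unfolding d_nome by simp
      show "deriv Z (nome \<tau>) \<noteq> 0" by (rule Z'[OF nome_in_ball[OF \<tau>]])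
    qed
    also have "schwarzian nome \<tau> = of_real pi ^ 2 / 2"
      using schwarzian_exp[of "of_real pi * \<i>" \<tau>] by (simp add: power_mult_distrib)
    also have "schwarzian Z (nome \<tau>) * deriv nome \<tau> ^ 2 = nome \<tau> ^ 2 * h (nome \<tau>)"
      unfolding d_nome h_def power_mult_distrib by simp
    finally show "schwarzian zfun \<tau> = of_real pi ^ 2 / 2 + nome \<tau> ^ 2 * h (nome \<tau>)"
      by (simp only: add.commute)
  qed
qed

text \<open>
  Both sides have weight 4 and agree up to \<open>O(x\<^sup>2)\<close> at the cusp; \<open>4 < 3 \<sqdot> 2\<close>.
\<close>

theorem schwarzian_zfun:
  assumes \<tau>: "0 < Im \<tau>"
  shows "schwarzian zfun \<tau> = of_real pi ^ 2 / 2 * form2 \<tau> ^ 2"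
proof -
  define Y where "Y \<tau> = schwarzian zfun \<tau> - of_real pi ^ 2 / 2 * form2 \<tau> ^ 2" for \<tau>
  obtain h where h: "h holomorphic_on ball 0 1"
    "\<And>\<tau>. 0 < Im \<tau> \<Longrightarrow> schwarzian zfun \<tau> = of_real pi ^ 2 / 2 + nome \<tau> ^ 2 * h (nome \<tau>)"
    using schwarzian_zfun_nome by blast
  obtain k where k: "k holomorphic_on ball 0 1"
    "\<And>\<tau>. 0 < Im \<tau> \<Longrightarrow> form2 \<tau> ^ 2 = 1 + nome \<tau> ^ 2 * k (nome \<tau>)"
    using form2_nome by blast
  have "Y \<tau> = 0"
  proof (rule fricke_weight_vanishing[where f = Y and k = 4 and m = 2
        and h = "\<lambda>x. h x - of_real pi ^ 2 / 2 * k x"])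
    have "schwarzian zfun holomorphic_on upper_half_plane"
      unfolding schwarzian_def[abs_def]
      by (intro holomorphic_intros holomorphic_higher_deriv zfun_holomorphic open_upper_half_plane)
         (simp_all add: zfun_deriv_nonzero)
    moreover have "form2 holomorphic_on upper_half_plane"
      unfolding form2_def[abs_def] by (intro holomorphic_intros theta_holomorphic) (simp add: theta_nonzero)
    ultimately show "Y holomorphic_on upper_half_plane"
      unfolding Y_def by (intro holomorphic_intros)
    show "norm (Y (\<tau> + 1)) = norm (Y \<tau>)" if "0 < Im \<tau>" for \<tau>
      unfolding Y_def schwarzian_zfun_translate[OF that] form2_translate[OF that] ..
    show "norm (Y (fricke \<tau>)) = (sqrt 3 * norm \<tau>) ^ 4 * norm (Y \<tau>)" if "0 < Im \<tau>" for \<tau>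
    proof -
      have "Y (fricke \<tau>) = 9 * \<tau> ^ 4 * Y \<tau>"
        unfolding Y_def schwarzian_zfun_fricke[OF that] form2_fricke[OF that]
        by (simp add: power_mult_distrib right_diff_distrib flip: power_mult)
      moreover have "(sqrt 3) ^ 4 = 9" by (simp add: power4_eq_xxxx)
      ultimately show ?thesis by (simp add: norm_mult norm_power power_mult_distrib)
    qed
    show "Y \<tau> = nome \<tau> ^ 2 * (h (nome \<tau>) - of_real pi ^ 2 / 2 * k (nome \<tau>))" if "0 < Im \<tau>" for \<tau>
      unfolding Y_def h(2)[OF that] k(2)[OF that] by (simp only: algebra_simps) simp
    show "isCont (\<lambda>x. h x - of_real pi ^ 2 / 2 * k x) 0"
      using h(1) k(1) by (intro isCont_0 holomorphic_intros)
  qed (use \<tau> in auto)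
  then show ?thesis by (simp add: Y_def)
qed

section \<open>The image of z\<close>

text \<open>
  The image is open by the open mapping theorem. It is closed because a bounded part of it is
  already attained on a compact part of the half-strip, as \<open>f\<close> tends to infinity at the cusp.
\<close>

theorem fricke_invariant_surjective:
  assumes hol: "f holomorphic_on upper_half_plane"
    and translate: "\<And>\<tau>. 0 < Im \<tau> \<Longrightarrow> f (\<tau> + 1) = f \<tau>"
    and fricke: "\<And>\<tau>. 0 < Im \<tau> \<Longrightarrow> f (fricke \<tau>) = f \<tau>"
    and cusp: "\<And>c::real. \<exists>Y. \<forall>\<tau>. Y \<le> Im \<tau> \<longrightarrow> c < norm (f \<tau>)"
  shows "f ` upper_half_plane = UNIV"
proof -
  let ?S = "f ` upper_half_plane"
  have "\<not> f constant_on upper_half_plane"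
  proof
    assume "f constant_on upper_half_plane"
    then obtain c where c: "f \<tau> = c" if "0 < Im \<tau>" for \<tau>
      unfolding constant_on_def by auto
    obtain Y where Y: "\<And>\<tau>. Y \<le> Im \<tau> \<Longrightarrow> norm c < norm (f \<tau>)" using cusp[of "norm c"] by blast
    show False using Y[of "Complex 0 (max 1 Y)"] c[of "Complex 0 (max 1 Y)"] by simp
  qed
  then have "open ?S"
    by (intro open_mapping_thm[OF hol open_upper_half_plane connected_upper_half_plane open_upper_half_plane]) auto
  moreover have "closed ?S"
    unfolding closed_limpt
  proof (intro allI impI)
    fix y assume y: "y islimpt ?S"
    obtain Y where Y: "\<And>\<tau>. Y \<le> Im \<tau> \<Longrightarrow> norm y + 1 < norm (f \<tau>)" using cusp by blast
    define R where "R = cbox (Complex (- 1 / 2) (1 / 6)) (Complex (1 / 2) Y)"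
    have R: "\<tau> \<in> R \<longleftrightarrow> \<bar>Re \<tau>\<bar> \<le> 1 / 2 \<and> 1 / 6 \<le> Im \<tau> \<and> Im \<tau> \<le> Y" for \<tau>
      by (auto simp: R_def in_cbox_complex_iff abs_le_iff)
    have R_sub: "R \<subseteq> upper_half_plane" by (auto simp: R)
    have "compact (f ` R)"
      by (intro compact_continuous_image holomorphic_on_imp_continuous_on holomorphic_on_subset[OF hol R_sub])
         (simp add: R_def)
    then have closed: "closed (f ` R)" by (rule compact_imp_closed)
    have strip: "\<exists>\<sigma>. 1 / 6 \<le> Im \<sigma> \<and> \<bar>Re \<sigma>\<bar> \<le> 1 / 2 \<and> f \<sigma> = f \<tau>" if "0 < Im \<tau>" for \<tau>
      using that
    proof (induction \<tau> rule: fricke_group_induct)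
      case (strip \<tau>)
      then show ?case by blast
    qed (simp_all only: translate fricke)
    have near: "s \<in> f ` R" if s: "s \<in> ?S" "dist s y < 1" for s
    proof -
      obtain \<sigma> where \<sigma>: "1 / 6 \<le> Im \<sigma>" "\<bar>Re \<sigma>\<bar> \<le> 1 / 2" "f \<sigma> = s"
        using s(1) strip by blast
      have "norm s < norm y + 1" using s(2) norm_triangle_ineq2[of s y] by (simp add: dist_norm)
      then have "Im \<sigma> \<le> Y" using Y[of \<sigma>] \<sigma>(3) by (meson less_asym linear)
      then show ?thesis using \<sigma> R by blast
    qed
    have "y islimpt (f ` R)"
      unfolding islimpt_approachable
    proof (intro allI impI)
      fix e :: real assume "e > 0"
      then have "min e 1 > 0" by simp
      then obtain s where s: "s \<in> ?S" "s \<noteq> y" "dist s y < min e 1"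
        using y unfolding islimpt_approachable by blast
      have "dist s y < 1" "dist s y < e" using s(3) by auto
      then show "\<exists>x'\<in>f ` R. x' \<noteq> y \<and> dist x' y < e"
        using near[OF s(1)] s(2) by blast
    qed
    then have "y \<in> f ` R" using closed by (auto simp: closed_limpt)
    then show "y \<in> ?S" using R_sub by blast
  qed
  moreover have "?S \<noteq> {}"
  proof -
    have "\<i> \<in> upper_half_plane" by simp
    then show ?thesis by blast
  qed
  ultimately show ?thesis using clopen[of ?S] by blast
qed

text \<open>
  This function is invariant under \<open>3/x\<close> and changes sign under \<open>(x + 3)/(x - 1)\<close>. Its square is an
  invariant of degree 12 of the dihedral group, with poles exactly at the branch points.
\<close>

definition dihedral_function :: "complex \<Rightarrow> complex" where
  "dihedral_function x = (x ^ 2 + 3) ^ 3 / (x * (x ^ 2 - 1) * (x ^ 2 - 9))"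

text \<open>
  The values that \<open>z\<close> omits: the finite branch points of the curve.
\<close>

definition cusps :: "complex set" where
  "cusps = {0, 1, - 1, 3, - 3}"

lemma not_cusp_iff: "x \<notin> cusps \<longleftrightarrow> x * (x ^ 2 - 1) * (x ^ 2 - 9) \<noteq> 0"
proof -
  have "x * (x ^ 2 - 1) * (x ^ 2 - 9) = x * (x - 1) * (x - (- 1)) * (x - 3) * (x - (- 3))"
    by (simp add: power2_eq_square algebra_simps)
  then show ?thesis unfolding cusps_def by (simp only: mult_eq_0_iff right_minus_eq) blast
qed

text \<open>
  With \<open>y = (x + 3)/(x - 1)\<close>, each of \<open>y\<^sup>2 + 3\<close>, \<open>y\<^sup>2 - 1\<close>, \<open>y\<^sup>2 - 9\<close> becomes a simple polynomial after
  multiplication by \<open>(x - 1)\<^sup>2\<close>.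
\<close>

lemma dihedral_function_translate:
  assumes x: "x \<notin> cusps"
  shows "dihedral_function ((x + 3) / (x - 1)) = - dihedral_function x"
proof -
  have nz: "x - 1 \<noteq> 0" using x by (auto simp: cusps_def)
  define y where "y = (x + 3) / (x - 1)"
  have y: "(x - 1) * y = x + 3" using nz by (simp add: y_def)
  have sq: "(x - 1) ^ 2 * y ^ 2 = (x + 3) ^ 2"
    using arg_cong[OF y, of "\<lambda>u. u ^ 2"] by (simp add: power_mult_distrib)
  have 1: "(x - 1) ^ 2 * (y ^ 2 + 3) = 4 * (x ^ 2 + 3)"
    using sq by (simp add: power2_eq_square algebra_simps)
  have 2: "(x - 1) ^ 2 * (y ^ 2 - 1) = 8 * (x + 1)"
    using sq by (simp add: power2_eq_square algebra_simps)
  have 3: "(x - 1) ^ 2 * (y ^ 2 - 9) = 8 * x * (3 - x)"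
    using sq by (simp add: power2_eq_square algebra_simps)
  have num: "(x - 1) ^ 6 * (y ^ 2 + 3) ^ 3 = 64 * (x ^ 2 + 3) ^ 3"
    using arg_cong[OF 1, of "\<lambda>u. u ^ 3"]
    unfolding power_mult_distrib power_mult[symmetric] by simp
  have den: "(x - 1) ^ 6 * (y * (y ^ 2 - 1) * (y ^ 2 - 9)) = - 64 * (x * (x ^ 2 - 1) * (x ^ 2 - 9))"
  proof -
    have "(x - 1) ^ 6 * (y * (y ^ 2 - 1) * (y ^ 2 - 9))
        = (x - 1) * ((x - 1) * y) * ((x - 1) ^ 2 * (y ^ 2 - 1)) * ((x - 1) ^ 2 * (y ^ 2 - 9))"
      by (simp add: power2_eq_square numeral_eq_Suc)
    also have "\<dots> = (x - 1) * (x + 3) * (8 * (x + 1)) * (8 * x * (3 - x))"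
      by (simp only: 2 3 y)
    also have "\<dots> = - 64 * (x * (x ^ 2 - 1) * (x ^ 2 - 9))"
      by (simp add: power2_eq_square algebra_simps)
    finally show ?thesis .
  qed
  have "dihedral_function y = ((x - 1) ^ 6 * (y ^ 2 + 3) ^ 3) / ((x - 1) ^ 6 * (y * (y ^ 2 - 1) * (y ^ 2 - 9)))"
    unfolding dihedral_function_def using nz by simp
  also have "\<dots> = - dihedral_function x"
    unfolding num den dihedral_function_def by simp
  finally show ?thesis by (simp add: y_def)
qed

lemma dihedral_function_inversion:
  assumes x: "x \<notin> cusps"
  shows "dihedral_function (3 / x) = dihedral_function x"
proof -
  have nz: "x \<noteq> 0" using x by (auto simp: cusps_def)
  define y where "y = 3 / x"
  have y: "x * y = 3" using nz by (simp add: y_def)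
  have sq: "x ^ 2 * y ^ 2 = 9"
    using arg_cong[OF y, of "\<lambda>u. u ^ 2"] by (simp add: power_mult_distrib)
  have num: "x ^ 6 * (y ^ 2 + 3) ^ 3 = 27 * (x ^ 2 + 3) ^ 3"
  proof -
    have "x ^ 2 * (y ^ 2 + 3) = 3 * (x ^ 2 + 3)" using sq by (simp add: distrib_left)
    from arg_cong[OF this, of "\<lambda>u. u ^ 3"] show ?thesis
      unfolding power_mult_distrib power_mult[symmetric] by simp
  qed
  have den: "x ^ 6 * (y * (y ^ 2 - 1) * (y ^ 2 - 9)) = 27 * (x * (x ^ 2 - 1) * (x ^ 2 - 9))"
  proof -
    have "x ^ 6 * (y * (y ^ 2 - 1) * (y ^ 2 - 9))
        = x * (x * y) * (x ^ 2 * y ^ 2 - x ^ 2) * (x ^ 2 * y ^ 2 - 9 * x ^ 2)"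
      by (simp add: power2_eq_square numeral_eq_Suc algebra_simps)
    also have "\<dots> = x * 3 * (9 - x ^ 2) * (9 - 9 * x ^ 2)"
      by (simp only: sq y)
    also have "\<dots> = 27 * (x * (x ^ 2 - 1) * (x ^ 2 - 9))"
      by (simp add: power2_eq_square algebra_simps)
    finally show ?thesis .
  qed
  have "dihedral_function y = (x ^ 6 * (y ^ 2 + 3) ^ 3) / (x ^ 6 * (y * (y ^ 2 - 1) * (y ^ 2 - 9)))"
    unfolding dihedral_function_def using nz by simp
  also have "\<dots> = dihedral_function x"
    unfolding num den dihedral_function_def by simp
  finally show ?thesis by (simp add: y_def)
qed

text \<open>
  The six values are the orbit of \<open>w\<close> under the index 2 subgroup of the dihedral group that fixes the
  function. Grouping the linear factors in pairs makes each pair a combination of \<open>t = x\<^sup>2 + 3\<close> and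
  \<open>s x\<close> with \<open>s = w\<^sup>2 + 3\<close>.
\<close>

lemma dihedral_function_fibre:
  assumes w: "w \<notin> cusps" and x: "x \<notin> cusps" and eq: "dihedral_function w = dihedral_function x"
  shows "x \<in> {w, 3 / w, 3 * (w + 1) / (w - 3), (w - 3) / (w + 1), - (w + 3) / (w - 1), - 3 * (w - 1) / (w + 3)}"
proof -
  have nz: "w \<noteq> 0" "w - 3 \<noteq> 0" "w + 1 \<noteq> 0" "w - 1 \<noteq> 0" "w + 3 \<noteq> 0"
    using w by (auto simp: cusps_def add_eq_0_iff2)
  have "(x ^ 2 + 3) ^ 3 * (w * (w ^ 2 - 1) * (w ^ 2 - 9)) = (w ^ 2 + 3) ^ 3 * (x * (x ^ 2 - 1) * (x ^ 2 - 9))"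
    using eq w x unfolding dihedral_function_def not_cusp_iff by (subst (asm) frac_eq_eq) auto
  moreover have "(x ^ 2 + 3) ^ 3 * (w * (w ^ 2 - 1) * (w ^ 2 - 9)) - (w ^ 2 + 3) ^ 3 * (x * (x ^ 2 - 1) * (x ^ 2 - 9))
    = ((x - w) * (x * w - 3)) * ((x * (w - 3) - 3 * (w + 1)) * (x * (w + 1) - (w - 3)))
        * ((x * (w - 1) - (- (w + 3))) * (x * (w + 3) - (- 3 * (w - 1))))"
  proof -
    define s t p q where "s = w ^ 2 + 3" "t = x ^ 2 + 3" "p = (w - 3) * (w + 1)" "q = (w - 1) * (w + 3)"
    note defs = this
    have pairs: "(x - w) * (x * w - 3) = w * t - s * x"
      "(x * (w - 3) - 3 * (w + 1)) * (x * (w + 1) - (w - 3)) = p * t - 4 * s * x"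
      "(x * (w - 1) - (- (w + 3))) * (x * (w + 3) - (- 3 * (w - 1))) = q * t + 4 * s * x"
      unfolding defs by (simp_all add: power2_eq_square algebra_simps)
    have pq: "p - q = - 4 * w" "p * q = s ^ 2 - 16 * w ^ 2"
      and poly: "w * (w ^ 2 - 1) * (w ^ 2 - 9) = w * (s ^ 2 - 16 * w ^ 2)"
        "x * (x ^ 2 - 1) * (x ^ 2 - 9) = x * (t ^ 2 - 16 * x ^ 2)"
      unfolding defs by (simp_all add: power2_eq_square algebra_simps)
    have "(p * t - 4 * s * x) * (q * t + 4 * s * x) = p * q * t ^ 2 + 4 * (p - q) * s * x * t - 16 * s ^ 2 * x ^ 2"
      by (simp add: power2_eq_square algebra_simps)
    also have "\<dots> = (s ^ 2 - 16 * w ^ 2) * t ^ 2 - 16 * w * s * x * t - 16 * s ^ 2 * x ^ 2"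
      unfolding pq by simp
    finally have "(w * t - s * x) * (p * t - 4 * s * x) * (q * t + 4 * s * x)
        = t ^ 3 * (w * (s ^ 2 - 16 * w ^ 2)) - s ^ 3 * (x * (t ^ 2 - 16 * x ^ 2))"
      by (simp only: mult.assoc) (simp add: power2_eq_square power3_eq_cube algebra_simps)
    then show ?thesis
      unfolding pairs poly unfolding defs by simp
  qed
  ultimately have "((x - w) * (x * w - 3)) * ((x * (w - 3) - 3 * (w + 1)) * (x * (w + 1) - (w - 3)))
        * ((x * (w - 1) - (- (w + 3))) * (x * (w + 3) - (- 3 * (w - 1)))) = 0"
    by (metis right_minus_eq)
  then have "x = w \<or> x * w = 3 \<or> x * (w - 3) = 3 * (w + 1) \<or> x * (w + 1) = w - 3
      \<or> x * (w - 1) = - (w + 3) \<or> x * (w + 3) = - 3 * (w - 1)"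
    unfolding mult_eq_0_iff right_minus_eq by blast
  then show ?thesis
    unfolding insert_iff nonzero_eq_divide_eq[OF nz(1)] nonzero_eq_divide_eq[OF nz(2)]
      nonzero_eq_divide_eq[OF nz(3)] nonzero_eq_divide_eq[OF nz(4)] nonzero_eq_divide_eq[OF nz(5)]
    by blast
qed

lemma zfun_not_cusp: "0 < Im \<tau> \<Longrightarrow> zfun \<tau> \<notin> cusps"
  using zfun_cusp_free by (simp add: cusps_def)

text \<open>
  For a given \<open>x\<close> some \<open>\<tau>\<close> has \<open>dihedral_function (z \<tau>)\<^sup>2 = dihedral_function x\<^sup>2\<close>. A translation
  adjusts the sign, and then \<open>x\<close> lies in the fibre of a value of \<open>z\<close>. The image of \<open>z\<close> is closed under
  the two generating Moebius maps, hence contains the whole fibre.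
\<close>

theorem zfun_image: "zfun ` upper_half_plane = - cusps"
proof
  show "zfun ` upper_half_plane \<subseteq> - cusps"
    using zfun_not_cusp by auto
  show "- cusps \<subseteq> zfun ` upper_half_plane"
  proof
    fix x assume "x \<in> - cusps"
    then have x: "x \<notin> cusps" by simp
    have not_cusp: "w \<notin> cusps" if "w \<in> zfun ` upper_half_plane" for w
      using that zfun_not_cusp by auto
    have T: "(w + 3) / (w - 1) \<in> zfun ` upper_half_plane" if "w \<in> zfun ` upper_half_plane" for w
    proof -
      obtain \<tau> where "0 < Im \<tau>" "w = zfun \<tau>" using \<open>w \<in> zfun ` upper_half_plane\<close> by auto
      then show ?thesis using zfun_translate[of \<tau>] by (intro image_eqI[of _ _ "\<tau> + 1"]) auto
    qed
    have W: "3 / w \<in> zfun ` upper_half_plane" if "w \<in> zfun ` upper_half_plane" for w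
    proof -
      obtain \<tau> where "0 < Im \<tau>" "w = zfun \<tau>" using \<open>w \<in> zfun ` upper_half_plane\<close> by auto
      then show ?thesis using zfun_fricke[of \<tau>] Im_fricke_pos[of \<tau>] by (intro image_eqI[of _ _ "fricke \<tau>"]) auto
    qed
    \<comment> \<open>translation, involution and translation again\<close>
    have N: "3 * (w + 1) / (w - 3) \<in> zfun ` upper_half_plane" if "w \<in> zfun ` upper_half_plane" for w
    proof -
      define u where "u = 3 / ((w + 3) / (w - 1))"
      have u: "u \<in> zfun ` upper_half_plane" unfolding u_def by (intro W T that)
      have nz: "w - 1 \<noteq> 0" "w + 3 \<noteq> 0" "w - 3 \<noteq> 0"
        using not_cusp[OF that] by (auto simp: cusps_def add_eq_0_iff2)
      have "u = 3 * (w - 1) / (w + 3)" by (simp add: u_def)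
      then have "u + 3 = 6 * (w + 1) / (w + 3)" "u - 1 = 2 * (w - 3) / (w + 3)"
        using nz by (simp_all add: field_simps)
      then have "(u + 3) / (u - 1) = (6 * (w + 1) / (w + 3)) / (2 * (w - 3) / (w + 3))"
        by (simp only:)
      also have "\<dots> = 3 * (w + 1) / (w - 3)"
      proof -
        have "(6 * X / r) / (2 * Y / r) = 3 * X / Y" if "r \<noteq> 0" for X Y r :: complex
          using that by simp
        then show ?thesis using nz(2) .
      qed
      finally have "(u + 3) / (u - 1) = 3 * (w + 1) / (w - 3)" .
      then show ?thesis using T[OF u] by simp
    qed
    define f where "f \<tau> = dihedral_function (zfun \<tau>) ^ 2" for \<tau>
    have "f ` upper_half_plane = UNIV"
    proof (rule fricke_invariant_surjective)
      show "f holomorphic_on upper_half_plane"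
        unfolding f_def dihedral_function_def using zfun_not_cusp
        by (intro holomorphic_intros zfun_holomorphic) (simp add: not_cusp_iff)
      show "f (\<tau> + 1) = f \<tau>" if "0 < Im \<tau>" for \<tau>
        unfolding f_def zfun_translate[OF that] dihedral_function_translate[OF zfun_not_cusp[OF that]] by simp
      show "f (fricke \<tau>) = f \<tau>" if "0 < Im \<tau>" for \<tau>
        unfolding f_def zfun_fricke[OF that] dihedral_function_inversion[OF zfun_not_cusp[OF that]] ..
      show "\<exists>Y. \<forall>\<tau>. Y \<le> Im \<tau> \<longrightarrow> c < norm (f \<tau>)" for c
      proof -
        define Z where "Z x = 3 * (phi (x ^ 3) ^ 2 / phi x ^ 2)" for x
        \<comment> \<open>the claim with denominators cleared: the numerator tends to \<open>12\<^sup>3\<close> at the cusp, the denominator to 0\<close>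
        define w where "w x = norm ((Z x ^ 2 + 3) ^ 3) ^ 2 - c * norm (Z x * (Z x ^ 2 - 1) * (Z x ^ 2 - 9)) ^ 2" for x
        have "Z holomorphic_on ball 0 1"
          unfolding Z_def by (intro holomorphic_intros nome_series_holomorphic) (simp add: phi_nonzero)
        then have "isCont w 0"
          unfolding w_def by (intro continuous_intros isCont_0)
        then have "(w \<longlongrightarrow> w 0) (nhds 0)"
          by (simp add: continuous_at tendsto_at_iff_tendsto_nhds)
        moreover have "w 0 > 0" by (simp add: w_def Z_def)
        ultimately have "\<forall>\<^sub>F x in nhds 0. w x > 0"
          by (rule order_tendstoD(1))
        then obtain Y where Y: "1 / 6 \<le> Y" "\<And>\<tau>. Y \<le> Im \<tau> \<Longrightarrow> w (nome \<tau>) > 0"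
          by (rule nome_eventually) blast
        have "c < norm (f \<tau>)" if "Y \<le> Im \<tau>" for \<tau>
        proof -
          have \<tau>: "0 < Im \<tau>" using that Y(1) by simp
          have "Z (nome \<tau>) = zfun \<tau>" unfolding Z_def zfun_def theta_nome[OF \<tau>] ..
          then have "c * norm (zfun \<tau> * (zfun \<tau> ^ 2 - 1) * (zfun \<tau> ^ 2 - 9)) ^ 2 < norm ((zfun \<tau> ^ 2 + 3) ^ 3) ^ 2"
            using Y(2)[OF that] by (simp only: w_def diff_gt_0_iff_gt)
          moreover have "0 < norm (zfun \<tau> * (zfun \<tau> ^ 2 - 1) * (zfun \<tau> ^ 2 - 9)) ^ 2"
            using zfun_not_cusp[OF \<tau>] unfolding not_cusp_iff
            by (intro zero_less_power) (simp only: zero_less_norm_iff not_False_eq_True)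
          ultimately show ?thesis
            unfolding f_def dihedral_function_def norm_power[of _ 2] norm_divide power_divide
            by (simp only: pos_less_divide_eq)
        qed
        then show ?thesis by blast
      qed
    qed
    then obtain \<tau> where \<tau>: "0 < Im \<tau>" "f \<tau> = dihedral_function x ^ 2"
      by (metis (mono_tags, lifting) UNIV_I imageE mem_Collect_eq)
    obtain w where w: "w \<in> zfun ` upper_half_plane" "dihedral_function w = dihedral_function x"
    proof (cases "dihedral_function (zfun \<tau>) = dihedral_function x")
      case True
      then show ?thesis using that \<tau>(1) by blast
    next
      case False
      then have "dihedral_function (zfun \<tau>) = - dihedral_function x"
        using \<tau>(2) unfolding f_def by (simp add: power2_eq_iff)
      then have "dihedral_function ((zfun \<tau> + 3) / (zfun \<tau> - 1)) = dihedral_function x"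
        using dihedral_function_translate[OF zfun_not_cusp[OF \<tau>(1)]] by simp
      moreover have "(zfun \<tau> + 3) / (zfun \<tau> - 1) \<in> zfun ` upper_half_plane" using \<tau>(1) by (intro T) auto
      ultimately show ?thesis using that by blast
    qed
    have nz: "w \<noteq> 0" "w - 1 \<noteq> 0" "w + 1 \<noteq> 0"
      using not_cusp[OF w(1)] by (auto simp: cusps_def add_eq_0_iff2)
    have rules: "3 / (3 * X / Y) = Y / X" "3 / (- X / Y) = - 3 * Y / X"
      "r \<noteq> 0 \<Longrightarrow> (3 * X / r) / (- 3 * Y / r) = - X / Y" for X Y r :: complex
      by simp_all
    have 4: "3 / (3 * (w + 1) / (w - 3)) = (w - 3) / (w + 1)" by (rule rules(1))
    have 5: "3 * (3 / w + 1) / (3 / w - 3) = - (w + 3) / (w - 1)"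
    proof -
      have "3 / w + 1 = (w + 3) / w" "3 / w - 3 = - 3 * (w - 1) / w"
        using nz by (simp_all add: field_simps)
      then have "3 * (3 / w + 1) / (3 / w - 3) = (3 * (w + 3) / w) / (- 3 * (w - 1) / w)" by simp
      also have "\<dots> = - (w + 3) / (w - 1)" using nz(1) by (rule rules(3))
      finally show ?thesis .
    qed
    have 6: "3 / (- (w + 3) / (w - 1)) = - 3 * (w - 1) / (w + 3)"
      by (rule rules(2))
    have "3 / w \<in> zfun ` upper_half_plane" "3 * (w + 1) / (w - 3) \<in> zfun ` upper_half_plane" by (intro W N w(1))+
    moreover have "(w - 3) / (w + 1) \<in> zfun ` upper_half_plane" unfolding 4[symmetric] by (intro W N w(1))
    moreover have five: "- (w + 3) / (w - 1) \<in> zfun ` upper_half_plane" unfolding 5[symmetric] by (intro W N w(1))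
    moreover have "- 3 * (w - 1) / (w + 3) \<in> zfun ` upper_half_plane" unfolding 6[symmetric] by (intro W five)
    ultimately show "x \<in> zfun ` upper_half_plane"
      using dihedral_function_fibre[OF not_cusp[OF w(1)] x w(2)] w(1) by blast
  qed
qed

section \<open>The parametrization of the curve\<close>

definition vfun :: "complex \<Rightarrow> complex" where
  "vfun \<tau> = 48 * of_real (sqrt 3) * \<i> * (theta3 (3 * \<tau>) ^ 3 / theta3 \<tau> ^ 3)
            * (theta2 \<tau> ^ 2 * theta4 \<tau> ^ 2 / (9 * theta3 (3 * \<tau>) ^ 4 - theta3 \<tau> ^ 4))"

lemma quintic_factor:
  "x ^ 5 - 10 * x ^ 3 + 9 * x = x * (x ^ 2 - 1) * (x ^ 2 - 9)" for x :: complex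
  by (simp add: numeral_eq_Suc algebra_simps)

lemma vfun_denominator_nonzero:
  assumes \<tau>: "0 < Im \<tau>"
  shows "9 * theta3 (3 * \<tau>) ^ 4 - theta3 \<tau> ^ 4 \<noteq> 0"
proof -
  have "9 * A ^ 4 - a ^ 4 = (3 * A ^ 2 - a ^ 2) * (a ^ 2 + 3 * A ^ 2)" for a A :: complex
    by (simp add: power4_eq_xxxx power2_eq_square algebra_simps)
  then show ?thesis using theta_degree_3_nonzero[OF \<tau>] by simp
qed

lemma vfun_holomorphic: "vfun holomorphic_on upper_half_plane"
  unfolding vfun_def[abs_def]
  by (intro holomorphic_intros theta_holomorphic; use theta_nonzero vfun_denominator_nonzero in auto)

text \<open>
  Up to constants \<open>v\<^sup>2\<close> is \<open>(A/a)\<^sup>6 b\<^sup>4c\<^sup>4/(9A\<^sup>4 - a\<^sup>4)\<^sup>2\<close>, and the formulas for \<open>b\<^sup>4\<close> and \<open>c\<^sup>4\<close> give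
  \<open>256a\<^sup>4A\<^sup>4 b\<^sup>4c\<^sup>4 = (a\<^sup>4 - A\<^sup>4)(9A\<^sup>4 - a\<^sup>4)\<^sup>3\<close>.
\<close>

lemma vfun_square:
  assumes \<tau>: "0 < Im \<tau>"
  shows "vfun \<tau> ^ 2 = zfun \<tau> ^ 5 - 10 * zfun \<tau> ^ 3 + 9 * zfun \<tau>"
proof -
  define p q b c where "p = theta3 \<tau> ^ 2" "q = theta3 (3 * \<tau>) ^ 2" "b = theta4 \<tau> ^ 4" "c = theta2 \<tau> ^ 4"
  note defs = this
  have nz: "p \<noteq> 0" "q \<noteq> 0" using theta_nonzero[OF \<tau>] by (simp_all add: defs)
  define d where "d = 9 * q ^ 2 - p ^ 2"
  have d: "d = 9 * theta3 (3 * \<tau>) ^ 4 - theta3 \<tau> ^ 4" by (simp add: d_def defs flip: power_mult)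
  have d_nz: "d \<noteq> 0" unfolding d by (rule vfun_denominator_nonzero[OF \<tau>])
  have quartic: "16 * p * q * b = (q + p) * (3 * q - p) ^ 3" "16 * p * q * c = (p - q) * (p + 3 * q) ^ 3"
    unfolding defs by (rule theta_quartic_degree_3[OF \<tau>])+
  have bc: "256 * p ^ 2 * q ^ 2 * (b * c) = (p ^ 2 - q ^ 2) * d ^ 3"
  proof -
    have "256 * p ^ 2 * q ^ 2 * (b * c) = (16 * p * q * b) * (16 * p * q * c)"
      by (simp add: power2_eq_square)
    also have "\<dots> = ((q + p) * (p - q)) * ((3 * q - p) * (p + 3 * q)) ^ 3"
      unfolding quartic by (simp add: power_mult_distrib)
    also have "(q + p) * (p - q) = p ^ 2 - q ^ 2" by (simp add: power2_eq_square algebra_simps)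
    also have "(3 * q - p) * (p + 3 * q) = d" by (simp add: d_def power2_eq_square algebra_simps)
    finally show ?thesis .
  qed
  have "of_real (sqrt 3) ^ 2 = (3 :: complex)" by (simp flip: of_real_power)
  then have "vfun \<tau> ^ 2 = - 6912 * (q ^ 3 / p ^ 3) * (b * c / d ^ 2)"
    unfolding vfun_def d[symmetric] power_mult_distrib power_divide
    by (simp add: defs flip: power_mult)
  also have "\<dots> = - 27 * (q ^ 3 / p ^ 3) * ((256 * p ^ 2 * q ^ 2 * (b * c)) / (p ^ 2 * q ^ 2 * d ^ 2))"
    using nz by simp
  also have "\<dots> = - 27 * (q ^ 3 / p ^ 3) * ((p ^ 2 - q ^ 2) * d / (p ^ 2 * q ^ 2))"
    unfolding bc using d_nz by (simp add: power2_eq_square power3_eq_cube)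
  also have "\<dots> = 3 * (q / p) * (d / p ^ 2) * (9 * (q ^ 2 - p ^ 2) / p ^ 2)"
    using nz by (simp add: field_simps power2_eq_square power3_eq_cube)
  also have "d / p ^ 2 = (3 * (q / p)) ^ 2 - 1"
    using nz by (simp add: d_def field_simps power2_eq_square)
  also have "9 * (q ^ 2 - p ^ 2) / p ^ 2 = (3 * (q / p)) ^ 2 - 9"
    using nz by (simp add: field_simps power2_eq_square)
  also have "3 * (q / p) = zfun \<tau>"
    by (simp add: zfun_def defs)
  finally show ?thesis unfolding quintic_factor .
qed

text \<open>
  Translation by 2 fixes \<open>\<theta>\<^sub>3\<close> and \<open>\<theta>\<^sub>4\<close> and multiplies \<open>\<theta>\<^sub>2\<^sup>2\<close> by \<open>i\<^sup>2 = -1\<close>. It therefore realizes the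
  hyperelliptic involution of the curve.
\<close>

lemma zfun_vfun_translate_two:
  assumes \<tau>: "0 < Im \<tau>"
  shows "zfun (\<tau> + 1 + 1) = zfun \<tau>" "vfun (\<tau> + 1 + 1) = - vfun \<tau>"
proof -
  have \<tau>1: "0 < Im (\<tau> + 1)" using \<tau> by simp
  show "zfun (\<tau> + 1 + 1) = zfun \<tau>"
    unfolding zfun_def theta3_plus_one[OF \<tau>1] theta3_triple_plus_one[OF \<tau>1]
      theta4_plus_one[OF \<tau>] theta4_triple_plus_one[OF \<tau>] ..
  show "vfun (\<tau> + 1 + 1) = - vfun \<tau>"
    unfolding vfun_def theta3_plus_one[OF \<tau>1] theta3_triple_plus_one[OF \<tau>1] theta4_plus_one[OF \<tau>1]
      theta2_square_translate[OF \<tau>1]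
    unfolding theta4_plus_one[OF \<tau>] theta4_triple_plus_one[OF \<tau>] theta3_plus_one[OF \<tau>]
      theta2_square_translate[OF \<tau>] by simp
qed

theorem zfun_vfun_image:
  "(\<lambda>\<tau>. (zfun \<tau>, vfun \<tau>)) ` upper_half_plane = {(x, y) \<in> hyperelliptic_curve. y \<noteq> 0}"
proof
  show "(\<lambda>\<tau>. (zfun \<tau>, vfun \<tau>)) ` upper_half_plane \<subseteq> {(x, y) \<in> hyperelliptic_curve. y \<noteq> 0}"
  proof clarsimp
    fix \<tau> assume \<tau>: "0 < Im \<tau>"
    have "vfun \<tau> ^ 2 \<noteq> 0"
      using zfun_not_cusp[OF \<tau>] unfolding vfun_square[OF \<tau>] quintic_factor not_cusp_iff .
    then have "vfun \<tau> \<noteq> 0" by simp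
    then show "(zfun \<tau>, vfun \<tau>) \<in> hyperelliptic_curve \<and> vfun \<tau> \<noteq> 0"
      using vfun_square[OF \<tau>] by (simp add: hyperelliptic_curve_def)
  qed
  show "{(x, y) \<in> hyperelliptic_curve. y \<noteq> 0} \<subseteq> (\<lambda>\<tau>. (zfun \<tau>, vfun \<tau>)) ` upper_half_plane"
  proof clarsimp
    fix x y :: complex assume xy: "(x, y) \<in> hyperelliptic_curve" "y \<noteq> 0"
    then have y: "y ^ 2 = x ^ 5 - 10 * x ^ 3 + 9 * x" by (simp add: hyperelliptic_curve_def)
    then have "x * (x ^ 2 - 1) * (x ^ 2 - 9) \<noteq> 0" unfolding quintic_factor using xy(2) by (metis power_eq_0_iff)
    then have "x \<in> zfun ` upper_half_plane" unfolding zfun_image not_cusp_iff[symmetric] by simp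
    then obtain \<tau> where \<tau>: "0 < Im \<tau>" "x = zfun \<tau>" by auto
    have "vfun \<tau> ^ 2 = y ^ 2" using vfun_square[OF \<tau>(1)] y \<tau>(2) by simp
    then consider "y = vfun \<tau>" | "y = - vfun \<tau>" by (metis power2_eq_iff)
    then show "(x, y) \<in> (\<lambda>\<tau>. (zfun \<tau>, vfun \<tau>)) ` upper_half_plane"
    proof cases
      case 1
      then show ?thesis using \<tau> by blast
    next
      case 2
      then have "(x, y) = (zfun (\<tau> + 1 + 1), vfun (\<tau> + 1 + 1))"
        using \<tau> zfun_vfun_translate_two[OF \<tau>(1)] by simp
      moreover have "\<tau> + 1 + 1 \<in> upper_half_plane" using \<tau>(1) by simp
      ultimately show ?thesis by blast
    qed
  qed
qed

lemma mero_deriv_eq_schwarzian: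
  assumes "deriv f w \<noteq> 0"
  shows "mero_deriv f w = schwarzian f w / deriv f w ^ 2"
  unfolding mero_deriv_def schwarzian_def using assms
  by (simp add: diff_divide_distrib power_divide power2_eq_square power3_eq_cube power4_eq_xxxx mult.assoc)

text \<open>
  Division of the Schwarzian derivative by \<open>z'\<^sup>2 = -\<pi>\<^sup>2z\<^sup>2m\<^sup>2\<close> with \<open>m = bBcC\<close>; the quotient \<open>form2/m\<close> is, up
  to sign, the rational function \<open>(z\<^sup>2 + 3)\<^sup>2/((z\<^sup>2 - 1)(z\<^sup>2 - 9))\<close>.
\<close>

theorem mero_deriv_zfun:
  assumes \<tau>: "0 < Im \<tau>"
  shows "mero_deriv zfun \<tau> =
    - 1 / 2 * ((zfun \<tau> ^ 2 + 3) ^ 4 / (zfun \<tau> ^ 5 - 10 * zfun \<tau> ^ 3 + 9 * zfun \<tau>) ^ 2)"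
proof -
  define z where "z = zfun \<tau>"
  define p q where "p = theta3 \<tau> ^ 2" "q = theta3 (3 * \<tau>) ^ 2"
  note defs = this
  have nz: "p \<noteq> 0" "q \<noteq> 0" using theta_nonzero[OF \<tau>] by (simp_all add: defs)
  define m where "m = theta4 \<tau> * theta4 (3 * \<tau>) * (theta2 \<tau> * theta2 (3 * \<tau>))"
  have m_nz: "m \<noteq> 0" using theta_nonzero[OF \<tau>] by (simp add: m_def)
  have m: "m = (p ^ 2 - q ^ 2) * (9 * q ^ 2 - p ^ 2) / (16 * p * q)"
    unfolding m_def theta24_product[OF \<tau>] defs by (simp flip: power_mult)
  have eta: "form2 \<tau> = (3 * q ^ 2 + p ^ 2) ^ 2 / (16 * p * q)"
    by (simp add: form2_def defs)
  have z: "z = 3 * (q / p)" by (simp add: z_def zfun_def defs)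
  have z_nz: "z * (z ^ 2 - 1) * (z ^ 2 - 9) \<noteq> 0"
    using zfun_not_cusp[OF \<tau>] unfolding not_cusp_iff z_def .
  have ratio: "(z ^ 2 + 3) ^ 2 / ((z ^ 2 - 1) * (z ^ 2 - 9)) = - (form2 \<tau> / m)"
  proof -
    have "z ^ 2 + 3 = 3 * (3 * q ^ 2 + p ^ 2) / p ^ 2" "z ^ 2 - 1 = (9 * q ^ 2 - p ^ 2) / p ^ 2"
      "z ^ 2 - 9 = - 9 * (p ^ 2 - q ^ 2) / p ^ 2"
      unfolding z using nz by (simp_all add: field_simps power2_eq_square)
    then have "(z ^ 2 + 3) ^ 2 / ((z ^ 2 - 1) * (z ^ 2 - 9))
      = (3 * (3 * q ^ 2 + p ^ 2) / p ^ 2) ^ 2 / ((9 * q ^ 2 - p ^ 2) / p ^ 2 * (- 9 * (p ^ 2 - q ^ 2) / p ^ 2))"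
      by (simp only:)
    also have "\<dots> = - ((3 * q ^ 2 + p ^ 2) ^ 2 / ((p ^ 2 - q ^ 2) * (9 * q ^ 2 - p ^ 2)))"
    proof -
      have eq: "(3 * X / s) ^ 2 / (Y / s * (- 9 * W / s)) = - (X ^ 2 / (W * Y))" if "s \<noteq> 0" for X Y W s :: complex
        using that by (simp add: power_divide power_mult_distrib power2_eq_square mult_ac)
      show ?thesis by (rule eq) (use nz in simp)
    qed
    also have "(3 * q ^ 2 + p ^ 2) ^ 2 / ((p ^ 2 - q ^ 2) * (9 * q ^ 2 - p ^ 2)) = form2 \<tau> / m"
      unfolding eta m using nz by simp
    finally show ?thesis .
  qed
  have "mero_deriv zfun \<tau> = (of_real pi ^ 2 / 2 * form2 \<tau> ^ 2) / (- (of_real pi * \<i>) * z * m) ^ 2"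
    unfolding mero_deriv_eq_schwarzian[OF zfun_deriv_nonzero[OF \<tau>]] schwarzian_zfun[OF \<tau>]
      zfun_has_derivative[OF \<tau>] z_def m_def ..
  also have "\<dots> = - 1 / 2 * ((- (form2 \<tau> / m)) ^ 2 / z ^ 2)"
    using m_nz z_nz by (simp add: power_mult_distrib power_divide)
  also have "\<dots> = - 1 / 2 * ((z ^ 2 + 3) ^ 4 / (z * (z ^ 2 - 1) * (z ^ 2 - 9)) ^ 2)"
    unfolding ratio[symmetric] by (simp add: power_divide power_mult_distrib mult_ac flip: power_mult)
  finally show ?thesis unfolding quintic_factor z_def .
qed

theorem proposition18:
  fixes z v :: "complex \<Rightarrow> complex"
  assumes z_def: "\<And>\<tau>. 0 < Im \<tau> \<Longrightarrow> z \<tau> = 3 * (theta3 (3 * \<tau>) ^ 2 / theta3 \<tau> ^ 2)"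
    and v_def: "\<And>\<tau>. 0 < Im \<tau> \<Longrightarrow>
      v \<tau> = 48 * of_real (sqrt 3) * \<i> * (theta3 (3 * \<tau>) ^ 3 / theta3 \<tau> ^ 3)
            * (theta2 \<tau> ^ 2 * theta4 \<tau> ^ 2 / (9 * theta3 (3 * \<tau>) ^ 4 - theta3 \<tau> ^ 4))"
  shows
    "(\<forall>x::complex. x ^ 5 - 10 * x ^ 3 + 9 * x = x * (x - 1) * (x + 1) * (x - 3) * (x + 3)) \<and>
     (\<forall>\<tau>. 0 < Im \<tau> \<longrightarrow>
        theta3 \<tau> \<noteq> 0 \<and> 9 * theta3 (3 * \<tau>) ^ 4 - theta3 \<tau> ^ 4 \<noteq> 0 \<and>
        deriv z \<tau> \<noteq> 0 \<and> z \<tau> ^ 5 - 10 * z \<tau> ^ 3 + 9 * z \<tau> \<noteq> 0) \<and>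
     z holomorphic_on upper_half_plane \<and>
     v holomorphic_on upper_half_plane \<and>
     (\<forall>\<tau>. 0 < Im \<tau> \<longrightarrow> v \<tau> ^ 2 = z \<tau> ^ 5 - 10 * z \<tau> ^ 3 + 9 * z \<tau>) \<and>
     (\<lambda>\<tau>. (z \<tau>, v \<tau>)) ` upper_half_plane = {(x, y) \<in> hyperelliptic_curve. y \<noteq> 0} \<and>
     (\<forall>\<tau>. 0 < Im \<tau> \<longrightarrow>
        mero_deriv z \<tau> =
          - 1 / 2 * ((z \<tau> ^ 2 + 3) ^ 4 / (z \<tau> ^ 5 - 10 * z \<tau> ^ 3 + 9 * z \<tau>) ^ 2))"
proof -
  have z: "z \<tau> = zfun \<tau>" if "0 < Im \<tau>" for \<tau>
    using z_def[OF that] by (simp add: zfun_def)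
  have v: "v \<tau> = vfun \<tau>" if "0 < Im \<tau>" for \<tau>
    using v_def[OF that] by (simp add: vfun_def)
  have z_hol: "z holomorphic_on upper_half_plane"
    using zfun_holomorphic by (rule holomorphic_transform) (simp add: z)
  have v_hol: "v holomorphic_on upper_half_plane"
    using vfun_holomorphic by (rule holomorphic_transform) (simp add: v)
  have derivs: "(deriv ^^ n) z \<tau> = (deriv ^^ n) zfun \<tau>" if "0 < Im \<tau>" for n \<tau>
    by (rule higher_deriv_transform_within_open[OF z_hol zfun_holomorphic open_upper_half_plane])
       (use that z in auto)
  have deriv: "deriv z \<tau> = deriv zfun \<tau>" if "0 < Im \<tau>" for \<tau>
    using derivs[OF that, of 1] by simp
  have mero: "mero_deriv z \<tau> = mero_deriv zfun \<tau>" if "0 < Im \<tau>" for \<tau>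
    by (simp only: mero_deriv_def derivs[OF that] deriv[OF that])
  have image: "(\<lambda>\<tau>. (z \<tau>, v \<tau>)) ` upper_half_plane = (\<lambda>\<tau>. (zfun \<tau>, vfun \<tau>)) ` upper_half_plane"
    by (rule image_cong) (simp_all add: z v)
  have factor: "x ^ 5 - 10 * x ^ 3 + 9 * x = x * (x - 1) * (x + 1) * (x - 3) * (x + 3)" for x :: complex
    by (simp add: numeral_eq_Suc algebra_simps)
  have quintic_nz: "zfun \<tau> ^ 5 - 10 * zfun \<tau> ^ 3 + 9 * zfun \<tau> \<noteq> 0" if "0 < Im \<tau>" for \<tau>
    using zfun_not_cusp[OF that] unfolding quintic_factor not_cusp_iff .
  show ?thesis
  proof (intro conjI allI impI)
    fix \<tau> assume \<tau>: "0 < Im \<tau>"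
    show "theta3 \<tau> \<noteq> 0" by (rule theta3_nonzero[OF \<tau>])
    show "9 * theta3 (3 * \<tau>) ^ 4 - theta3 \<tau> ^ 4 \<noteq> 0" by (rule vfun_denominator_nonzero[OF \<tau>])
    show "deriv z \<tau> \<noteq> 0" unfolding deriv[OF \<tau>] by (rule zfun_deriv_nonzero[OF \<tau>])
    show "z \<tau> ^ 5 - 10 * z \<tau> ^ 3 + 9 * z \<tau> \<noteq> 0" unfolding z[OF \<tau>] by (rule quintic_nz[OF \<tau>])
    show "v \<tau> ^ 2 = z \<tau> ^ 5 - 10 * z \<tau> ^ 3 + 9 * z \<tau>"
      unfolding z[OF \<tau>] v[OF \<tau>] by (rule vfun_square[OF \<tau>])
    show "mero_deriv z \<tau> = - 1 / 2 * ((z \<tau> ^ 2 + 3) ^ 4 / (z \<tau> ^ 5 - 10 * z \<tau> ^ 3 + 9 * z \<tau>) ^ 2)"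
      unfolding mero[OF \<tau>] z[OF \<tau>] by (rule mero_deriv_zfun[OF \<tau>])
  qed (use factor z_hol v_hol image zfun_vfun_image in auto)
qed

end
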